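(* For every integer $n \ge 18$, \[ sat(n, \mathcal{R}_{\min}(K_3, \mathcal{T}_4)) = \left\lfloor \frac{5n}{2} \right\rfloor. \]
   Context: All graphs are finite, simple (no loops or multiple edges). For an integer $k$, $\mathcal{T}_k$ denotes the family of all trees on $k$ vertices. A graph $G$ is $(K_3,\mathcal{T}_k)$-Ramsey-minimal if every $2$-coloring $c:E(G)\to\{\text{red},\text{blue}\}$ of the edges of $G$ contains either a red $K_3$ (triangle all of whose edges are red) or a blue tree $T\in\mathcal{T}_k$ (a subgraph isomorphic to some tree on $k$ vertices all of whose edges are blue), but no proper subgraph of $G$ has this property. $\mathcal{R}_{\min}(K_3,\mathcal{T}_k)$ is the family of all $(K_3,\mathcal{T}_k)$-Ramsey-minimal graphs. A graph $G$ is $\mathcal{R}_{\min}(K_3,\mathcal{T}_k)$-saturated if no member of $\mathcal{R}_{\min}(K_3,\mathcal{T}_k)$ is a subgraph of $G$, but for every edge $e$ of the complement of $G$, some member of $\mathcal{R}_{\min}(K_3,\mathcal{T}_k)$ is a subgraph of $G+e$. $sat(n,\mathcal{R}_{\min}(K_3,\mathcal{T}_k))$ is the minimum number of edges of an $\mathcal{R}_{\min}(K_3,\mathcal{T}_k)$-saturated graph on $n$ vertices. *)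

theory Defs
  imports Complex_Main
begin

type_synonym 'a graph = "'a set \<times> 'a set set"

abbreviation verts :: "'a graph \<Rightarrow> 'a set" where "verts \<equiv> fst"
abbreviation edges :: "'a graph \<Rightarrow> 'a set set" where "edges \<equiv> snd"

definition simple_graph :: "'a graph \<Rightarrow> bool" where
  "simple_graph G \<longleftrightarrow>
     finite (verts G) \<and> (\<forall>e\<in>edges G. e \<subseteq> verts G \<and> card e = 2)"

definition complement_edges :: "'a graph \<Rightarrow> 'a set set" where
  "complement_edges G = {e. e \<subseteq> verts G \<and> card e = 2 \<and> e \<notin> edges G}"

definition add_edge :: "'a graph \<Rightarrow> 'a set \<Rightarrow> 'a graph" where
  "add_edge G e = (verts G, insert e (edges G))"

definition proper_subgraph :: "'a graph \<Rightarrow> 'a graph \<Rightarrow> bool" where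
  "proper_subgraph H G \<longleftrightarrow> simple_graph H \<and>
     verts H \<subseteq> verts G \<and> edges H \<subseteq> edges G \<and> H \<noteq> G"

text \<open>\<open>has_copy H G\<close>: some subgraph of \<open>G\<close>, not necessarily induced, is isomorphic to \<open>H\<close>.\<close>

definition has_copy :: "'b graph \<Rightarrow> 'a graph \<Rightarrow> bool" where
  "has_copy H G \<longleftrightarrow> (\<exists>f. inj_on f (verts H) \<and> f ` verts H \<subseteq> verts G \<and>
     (\<forall>e\<in>edges H. f ` e \<in> edges G))"

definition complete_graph :: "nat \<Rightarrow> nat graph" where
  "complete_graph k = ({..<k}, {e. e \<subseteq> {..<k} \<and> card e = 2})"

definition connected_graph :: "'a graph \<Rightarrow> bool" where
  "connected_graph G \<longleftrightarrow> verts G \<noteq> {} \<and>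
     (\<forall>u\<in>verts G. \<forall>v\<in>verts G. (u, v) \<in> {(x, y). {x, y} \<in> edges G}\<^sup>*)"

definition is_cycle :: "'a graph \<Rightarrow> 'a list \<Rightarrow> bool" where
  "is_cycle G p \<longleftrightarrow> 3 \<le> length p \<and> distinct p \<and> set p \<subseteq> verts G \<and>
     (\<forall>i<length p. {p ! i, p ! (Suc i mod length p)} \<in> edges G)"

definition is_tree :: "'a graph \<Rightarrow> bool" where
  "is_tree G \<longleftrightarrow> simple_graph G \<and> connected_graph G \<and> (\<nexists>p. is_cycle G p)"

text \<open>
  Families of graphs are sets of graphs with vertices in \<^typ>\<open>nat\<close>. Every finite graph is isomorphic
  to such a graph, and families are only ever used through \<^term>\<open>has_copy\<close>.
\<close>

definition trees :: "nat \<Rightarrow> nat graph set" where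
  "trees k = {T. is_tree T \<and> card (verts T) = k}"

datatype colour = Red | Blue

definition colour_class :: "'a graph \<Rightarrow> ('a set \<Rightarrow> colour) \<Rightarrow> colour \<Rightarrow> 'a graph" where
  "colour_class G c x = (verts G, {e \<in> edges G. c e = x})"

text \<open>The values of a colouring \<open>c\<close> outside \<open>edges G\<close> are irrelevant.\<close>

definition ramsey :: "'a graph \<Rightarrow> nat graph set \<Rightarrow> nat graph set \<Rightarrow> bool" where
  "ramsey G \<F> \<H> \<longleftrightarrow> (\<forall>c.
     (\<exists>F\<in>\<F>. has_copy F (colour_class G c Red)) \<or>
     (\<exists>H\<in>\<H>. has_copy H (colour_class G c Blue)))"

definition ramsey_minimal :: "'a graph \<Rightarrow> nat graph set \<Rightarrow> nat graph set \<Rightarrow> bool" where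
  "ramsey_minimal G \<F> \<H> \<longleftrightarrow> simple_graph G \<and> ramsey G \<F> \<H> \<and>
     (\<forall>G'. proper_subgraph G' G \<longrightarrow> \<not> ramsey G' \<F> \<H>)"

definition R_min :: "nat graph set \<Rightarrow> nat graph set \<Rightarrow> nat graph set" where
  "R_min \<F> \<H> = {G. ramsey_minimal G \<F> \<H>}"

definition saturated :: "nat graph set \<Rightarrow> 'a graph \<Rightarrow> bool" where
  "saturated \<F> G \<longleftrightarrow> simple_graph G \<and>
     (\<forall>F\<in>\<F>. \<not> has_copy F G) \<and>
     (\<forall>e\<in>complement_edges G. \<exists>F\<in>\<F>. has_copy F (add_edge G e))"

text \<open>
  On \<^typ>\<open>nat\<close>, \<^term>\<open>Inf\<close> of a nonempty set is its minimum and \<^term>\<open>Inf {}\<close> is \<open>0\<close>, so a positive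
  value of \<open>sat\<close> is always attained by some saturated graph.
\<close>

definition sat :: "nat \<Rightarrow> nat graph set \<Rightarrow> nat" where
  "sat n \<F> = Inf {card (edges G) | G :: nat graph. saturated \<F> G \<and> card (verts G) = n}"

end

theory Submission
  imports Defs
begin

text \<open>
  A graph is not \<open>(K\<^sub>3, T\<^sub>4)\<close>-Ramsey iff its vertices can be split into parts of at most three vertices,
  the blue components, such that every triangle has two vertices in one part. In a saturated graph
  the parts are cliques, and nonadjacent vertices have a common neighbour in a third part; hence a
  maximal red graph \<open>R\<close> is a maximal triangle-free graph. If \<open>R\<close> has minimum degree at least three,
  it has more than \<open>2n\<close> edges (for \<open>n \<ge> 18\<close>, by the Moore bound or by a count around a vertex of
  degree three), and there are at least \<open>(n - 2) / 2\<close> blue edges since at most two parts are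
  singletons. Otherwise \<open>R\<close> has a vertex of degree two and is a blown-up pentagon; if such a graph
  had fewer than \<open>(5n - 1) / 2\<close> edges, a rearrangement of a few parts would put two nonadjacent
  vertices into one part or destroy all their common neighbours in a third part. Equality is attained
  by blown-up pentagons whose splitting into parts is unique.
\<close>

section \<open>Good labellings\<close>

text \<open>Saturation constrains every good labelling, not only the one that is fixed. This drives
  the lower bound: each regrouping of parts that is again good must keep nonadjacent vertices apart
  and leave them a common neighbour with a third label, so a regrouping that violates this is a
  contradiction. The target is a degree sum of at least \<open>5 * n - 1\<close>, whose half rounds
  up to the floor of \<open>5 * n / 2\<close> for both parities. With minimum red degree three the
  red sum \<open>4 * n + 1\<close> and the blue sum \<open>n - 2\<close> meet it exactly. The
  obstacle is a pentagon with class sizes \<open>x\<close>, \<open>y\<close>, \<open>z\<close>: its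
  red sum \<open>2 * x + 2 * y + 4 * z + 2 * x * y\<close> is too small when \<open>x\<close> and
  \<open>y\<close> are small. Vertices of blue degree two must then make up the deficit, and
  regroupings exclude the few configurations with too few of them. The bound \<open>18\<close>
  enters because a 4-regular graph with common neighbours has at most \<open>17\<close> vertices,
  and because the counts around a vertex of degree three use \<open>14\<close> vertices at distance
  two.\<close>

abbreviation adj :: "'a graph \<Rightarrow> 'a \<Rightarrow> 'a \<Rightarrow> bool" where
  "adj G u v \<equiv> {u, v} \<in> edges G"

text \<open>The labels name the blue components. Only edges between differently labelled vertices have to be
  red, and edges inside a part may be taken blue.\<close>

definition good_labelling :: "'a set \<Rightarrow> ('a \<Rightarrow> 'a \<Rightarrow> bool) \<Rightarrow> ('a \<Rightarrow> nat) \<Rightarrow> bool" where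
  "good_labelling V E l \<longleftrightarrow> (\<forall>c. card {v \<in> V. l v = c} \<le> 3) \<and>
     (\<forall>x y z. E x y \<longrightarrow> E y z \<longrightarrow> E x z \<longrightarrow> l x = l y \<or> l y = l z \<or> l x = l z)"

lemma adjD:
  assumes "simple_graph G" "adj G u v"
  shows "u \<in> verts G" "v \<in> verts G" "u \<noteq> v"
proof -
  have "{u, v} \<subseteq> verts G" "card {u, v} = 2"
    using assms unfolding simple_graph_def by blast+
  then show "u \<in> verts G" "v \<in> verts G" "u \<noteq> v" by auto
qed

lemma finite_edges:
  assumes "simple_graph G"
  shows "finite (edges G)"
proof (rule finite_subset)
  show "edges G \<subseteq> Pow (verts G)" using assms unfolding simple_graph_def by blast
  show "finite (Pow (verts G))" using assms unfolding simple_graph_def by simp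
qed

section \<open>Copies and Ramsey-minimal subgraphs\<close>

lemma has_copy_trans:
  assumes "has_copy F G" "has_copy G H"
  shows "has_copy F H"
proof -
  obtain f where f: "inj_on f (verts F)" "f ` verts F \<subseteq> verts G" "\<forall>e\<in>edges F. f ` e \<in> edges G"
    using assms(1) unfolding has_copy_def by blast
  obtain g where g: "inj_on g (verts G)" "g ` verts G \<subseteq> verts H" "\<forall>e\<in>edges G. g ` e \<in> edges H"
    using assms(2) unfolding has_copy_def by blast
  have "inj_on (g \<circ> f) (verts F)"
    using f(1,2) g(1) by (meson comp_inj_on inj_on_subset)
  moreover have "(g \<circ> f) ` verts F \<subseteq> verts H" using f(2) g(2) by auto
  moreover have "\<forall>e\<in>edges F. (g \<circ> f) ` e \<in> edges H"
    using f(3) g(3) by (metis image_comp)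
  ultimately show ?thesis unfolding has_copy_def by blast
qed

text \<open>A colouring of \<open>G\<close> is pulled back along an embedding of \<open>F\<close>,
  and the one-coloured copy found in \<open>F\<close> is carried over to \<open>G\<close>.\<close>

lemma ramsey_mono:
  assumes "has_copy F G" "ramsey F \<F> \<H>"
  shows "ramsey G \<F> \<H>"
  unfolding ramsey_def
proof
  fix c
  obtain f where f: "inj_on f (verts F)" "f ` verts F \<subseteq> verts G" "\<forall>e\<in>edges F. f ` e \<in> edges G"
    using assms(1) unfolding has_copy_def by blast
  have *: "has_copy (colour_class F (\<lambda>e. c (f ` e)) x) (colour_class G c x)" for x
    unfolding has_copy_def colour_class_def using f by (intro exI[of _ f]) auto
  show "(\<exists>F\<in>\<F>. has_copy F (colour_class G c Red)) \<or> (\<exists>H\<in>\<H>. has_copy H (colour_class G c Blue))"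
    using assms(2)[unfolded ramsey_def, rule_format, of "\<lambda>e. c (f ` e)"] has_copy_trans[OF _ *]
    by blast
qed

text \<open>Descent to proper subgraphs that are still Ramsey. The measure adds vertices and edges
  because a proper subgraph may differ by isolated vertices only.\<close>

lemma ramsey_minimal_exists:
  fixes G :: "'a graph"
  assumes "simple_graph G" "ramsey G \<F> \<H>"
  shows "\<exists>F :: 'a graph. ramsey_minimal F \<F> \<H> \<and> has_copy F G"
  using assms
proof (induction "card (verts G) + card (edges G)" arbitrary: G rule: less_induct)
  case less
  show ?case
  proof (cases "\<exists>G'. proper_subgraph G' G \<and> ramsey G' \<F> \<H>")
    case True
    then obtain G' where G': "proper_subgraph G' G" "ramsey G' \<F> \<H>" by blast
    note d = G'(1)[unfolded proper_subgraph_def]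
    have "card (verts G') + card (edges G') < card (verts G) + card (edges G)"
    proof -
      have f: "finite (verts G)" "finite (edges G)"
        using less.prems(1) finite_edges unfolding simple_graph_def by blast+
      have "verts G' \<subset> verts G \<or> edges G' \<subset> edges G" using d
        by (metis prod.collapse psubsetI)
      then show ?thesis using d f
        by (metis add_le_less_mono add_less_le_mono card_mono psubset_card_mono)
    qed
    with less.hyps[of G'] G' d obtain F :: "'a graph" where "ramsey_minimal F \<F> \<H>" "has_copy F G'" by blast
    moreover have "has_copy G' G" unfolding has_copy_def
      using d by (intro exI[of _ id]) auto
    ultimately show ?thesis using has_copy_trans by blast
  next
    case False
    then have "ramsey_minimal G \<F> \<H>" using less.prems unfolding ramsey_minimal_def by blast
    moreover have "has_copy G G" unfolding has_copy_def by (intro exI[of _ id]) auto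
    ultimately show ?thesis by blast
  qed
qed

lemma R_min_copy_iff_ramsey:
  fixes G :: "nat graph"
  assumes "simple_graph G"
  shows "(\<exists>F\<in>R_min \<F> \<H>. has_copy F G) \<longleftrightarrow> ramsey G \<F> \<H>"
proof
  assume "\<exists>F\<in>R_min \<F> \<H>. has_copy F G"
  then show "ramsey G \<F> \<H>" unfolding R_min_def ramsey_minimal_def using ramsey_mono by blast
next
  assume "ramsey G \<F> \<H>"
  then show "\<exists>F\<in>R_min \<F> \<H>. has_copy F G"
    using ramsey_minimal_exists[OF assms] unfolding R_min_def by blast
qed

text \<open>A parent map with \<open>f i < i\<close> gives every vertex at most one smaller
  neighbour, which turns acyclicity into a local argument.\<close>

lemma parent_function_tree:
  fixes f :: "nat \<Rightarrow> nat"
  assumes "k > 0" and f: "\<And>i. 0 < i \<Longrightarrow> i < k \<Longrightarrow> f i < i"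
  shows "is_tree ({..<k}, {{i, f i} | i. 0 < i \<and> i < k})" (is "is_tree ?T")
  unfolding is_tree_def
proof (intro conjI)
  show "simple_graph ?T"
    unfolding simple_graph_def
  proof (intro conjI ballI)
    fix e assume "e \<in> edges ?T"
    then obtain i where i: "e = {i, f i}" "0 < i" "i < k" by auto
    show "e \<subseteq> verts ?T" "card e = 2" using f[OF i(2,3)] i by (auto simp: card_insert_if)
  qed auto
  let ?r = "{(x, y). {x, y} \<in> edges ?T}"
  have sym: "sym ?r" by (auto simp: sym_def insert_commute)
  have root: "(i, 0) \<in> ?r\<^sup>*" if "i < k" for i
    using that
  proof (induction i rule: less_induct)
    case (less i)
    show ?case
    proof (cases "i = 0")
      case False
      with less.prems have "(i, f i) \<in> ?r" "f i < i" using f by auto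
      moreover have "(f i, 0) \<in> ?r\<^sup>*" using less calculation by auto
      ultimately show ?thesis by (meson converse_rtrancl_into_rtrancl)
    qed auto
  qed
  show "connected_graph ?T"
    unfolding connected_graph_def
  proof (intro conjI ballI)
    fix u v assume "u \<in> verts ?T" "v \<in> verts ?T"
    then have "(u, 0) \<in> ?r\<^sup>*" "(v, 0) \<in> ?r\<^sup>*" using root by auto
    then show "(u, v) \<in> ?r\<^sup>*" using sym_rtrancl[OF sym]
      by (meson rtrancl_trans symD)
  qed (use assms in auto)
  \<comment> \<open>The largest vertex of a cycle would have two distinct smaller neighbours.\<close>
  show "\<nexists>p. is_cycle ?T p"
  proof
    assume "\<exists>p. is_cycle ?T p"
    then obtain p where p: "3 \<le> length p" "distinct p" "set p \<subseteq> {..<k}"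
      and e: "\<And>i. i < length p \<Longrightarrow> {p ! i, p ! (Suc i mod length p)} \<in> edges ?T"
      unfolding is_cycle_def by auto
    define L where "L = length p"
    have "Max (set p) \<in> set p" using p(1) by (intro Max_in) auto
    then obtain j where j: "j < L" "p ! j = Max (set p)" unfolding L_def by (metis in_set_conv_nth)
    define n1 where "n1 = Suc j mod L"
    define n0 where "n0 = (if j = 0 then L - 1 else j - 1)"
    have L3: "L \<ge> 3" using p(1) L_def by simp
    have n: "n1 < L" "n0 < L" "Suc n0 mod L = j" "n1 \<noteq> j" "n0 \<noteq> j" "n0 \<noteq> n1"
      using L3 j(1) unfolding n1_def n0_def
      by (auto simp: mod_Suc split: if_splits)
    have lt: "p ! i = f (p ! j)" if i: "i < L" "i \<noteq> j" "{p ! i, p ! j} \<in> edges ?T" for i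
    proof -
      have "p ! i \<le> p ! j" using i(1) j(2) unfolding L_def by simp
      moreover have "p ! i \<noteq> p ! j" using i p(2) j(1) unfolding L_def by (simp add: nth_eq_iff_index_eq)
      ultimately have "p ! i < p ! j" by simp
      moreover obtain q where q: "{p ! i, p ! j} = {q, f q}" "0 < q" "q < k" using i(3) by auto
      moreover have "f q < q" using f q by simp
      ultimately show ?thesis by (auto simp: doubleton_eq_iff)
    qed
    have "p ! n1 = f (p ! j)" using lt[of n1] n e[of j] j(1) unfolding n1_def L_def
      by (simp add: insert_commute)
    moreover have "p ! n0 = f (p ! j)" using lt[of n0] n e[of n0] unfolding L_def by simp
    ultimately show False using n(1,2,6) p(2) nth_eq_iff_index_eq unfolding L_def by metis
  qed
qed

lemma reachable_grow:
  assumes "(x, y) \<in> r\<^sup>*" "x \<in> S" "y \<notin> S"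
  shows "\<exists>u v. u \<in> S \<and> v \<notin> S \<and> (u, v) \<in> r \<and> (x, v) \<in> r\<^sup>*"
  using assms
proof (induction rule: rtrancl_induct)
  case (step y z)
  then show ?case by (cases "y \<in> S") (auto intro: rtrancl_into_rtrancl)
qed auto

text \<open>The tree is grown one leaf at a time.\<close>

lemma four_vertex_tree_in_component:
  assumes G: "simple_graph G" and x: "x \<in> verts G"
    and S: "4 \<le> card {y \<in> verts G. (x, y) \<in> {(u, v). adj G u v}\<^sup>*}"
  shows "\<exists>T\<in>trees 4. has_copy T G"
proof -
  define r where "r = {(u, v). adj G u v}"
  define C where "C = {y \<in> verts G. (x, y) \<in> r\<^sup>*}"
  have finC: "finite C" using G unfolding C_def simple_graph_def by simp
  have grow: "\<exists>u v. u \<in> S \<and> v \<notin> S \<and> adj G u v \<and> v \<in> C" if "x \<in> S" "finite S" "card S < 4" for S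
  proof -
    have "\<not> C \<subseteq> S" using that S card_mono[OF that(2), of C] unfolding C_def r_def by auto
    then obtain y where "y \<in> C" "y \<notin> S" by blast
    then have "(x, y) \<in> r\<^sup>*" unfolding C_def by simp
    from reachable_grow[OF this that(1) \<open>y \<notin> S\<close>] obtain u v
      where uv: "u \<in> S" "v \<notin> S" "(u, v) \<in> r" "(x, v) \<in> r\<^sup>*" by blast
    then have "v \<in> C" using adjD[OF G] unfolding C_def r_def by auto
    then show ?thesis using uv unfolding r_def by auto
  qed
  obtain v1 where v1: "adj G x v1" "v1 \<noteq> x" "v1 \<in> C" using grow[of "{x}"] by auto
  obtain u2 v2 where v2: "adj G u2 v2" "u2 \<in> {x, v1}" "v2 \<notin> {x, v1}" "v2 \<in> C"
    using grow[of "{x, v1}"] v1 by (auto simp: card_insert_if)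
  obtain u3 v3 where v3: "adj G u3 v3" "u3 \<in> {x, v1, v2}" "v3 \<notin> {x, v1, v2}" "v3 \<in> C"
    using grow[of "{x, v1, v2}"] v1 v2 by (auto simp: card_insert_if)
  \<comment> \<open>Vertices are numbered in the order in which they were found, and
    \<open>f\<close> gives the number of the vertex to which each was attached; entry
    \<open>0\<close> of \<open>f\<close> is a dummy for the root.\<close>
  define g where "g = (!) [x, v1, v2, v3]"
  define f where "f = (!) [0, 0, if u2 = x then 0 else 1, if u3 = x then 0 else if u3 = v1 then 1 else (2::nat)]"
  let ?T = "({..<4}, {{i, f i} | i. 0 < i \<and> i < 4}) :: nat graph"
  have four: "i < 4 \<longleftrightarrow> i = 0 \<or> i = 1 \<or> i = 2 \<or> i = (3::nat)" for i by auto
  have "is_tree ?T"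
    by (rule parent_function_tree) (auto simp: f_def four)
  then have "?T \<in> trees 4" unfolding trees_def by simp
  moreover have "has_copy ?T G" unfolding has_copy_def
  proof (intro exI[of _ g] conjI ballI)
    show "inj_on g (verts ?T)" unfolding inj_on_def g_def using v1 v2 v3 by (auto simp: four)
    show "g ` verts ?T \<subseteq> verts G" using x v1 v2 v3 unfolding g_def C_def by (auto simp: four)
    fix e assume "e \<in> edges ?T"
    then obtain i where i: "e = {i, f i}" "0 < i" "i < 4" by auto
    show "g ` e \<in> edges G" using i v1 v2 v3 unfolding g_def f_def
      by (auto simp: four insert_commute)
  qed
  ultimately show ?thesis by blast
qed

lemma connected_copy_single_label:
  assumes T: "connected_graph T" and f: "\<forall>e\<in>edges T. f ` e \<in> edges H"
    and l: "\<And>u v. adj H u v \<Longrightarrow> l u = l v" and "x \<in> verts T" "y \<in> verts T"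
  shows "l (f x) = l (f y)"
proof -
  have "(x, y) \<in> {(u, v). adj T u v}\<^sup>*" using assms unfolding connected_graph_def by blast
  then show ?thesis
  proof (induction rule: rtrancl_induct)
    case (step y z)
    then have "f ` {y, z} \<in> edges H" using f by blast
    then show ?case using l step by simp
  qed auto
qed

text \<open>A blue component is named by its least vertex. Conversely, an edge is coloured blue iff
  it stays inside a part, so a blue copy of a connected graph cannot leave that part.\<close>

lemma not_ramsey_iff_good_labelling:
  fixes G :: "nat graph"
  assumes G: "simple_graph G"
  shows "\<not> ramsey G {complete_graph 3} (trees 4) \<longleftrightarrow> (\<exists>l. good_labelling (verts G) (adj G) l)"
proof
  assume "\<not> ramsey G {complete_graph 3} (trees 4)"
  then obtain c where red: "\<not> has_copy (complete_graph 3) (colour_class G c Red)"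
    and blue: "\<not> (\<exists>T\<in>trees 4. has_copy T (colour_class G c Blue))"
    unfolding ramsey_def by blast
  let ?B = "colour_class G c Blue"
  have B: "simple_graph ?B" using G unfolding simple_graph_def colour_class_def by auto
  define r where "r = {(u, v). adj ?B u v}"
  define C where "C x = {y \<in> verts G. (x, y) \<in> r\<^sup>*}" for x
  define l where "l x = Min (C x)" for x
  have fin: "finite (verts G)" using G unfolding simple_graph_def by simp
  have sym: "sym (r\<^sup>*)" unfolding r_def by (intro sym_rtrancl) (auto simp: sym_def insert_commute)
  have C_eq: "C x = C y" if "(x, y) \<in> r\<^sup>*" for x y
    using that symD[OF sym that] unfolding C_def by (meson rtrancl_trans)
  have C_l: "(x, l x) \<in> r\<^sup>*" if "x \<in> verts G" for x
  proof -
    have "x \<in> C x" using that unfolding C_def by simp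
    then have "Min (C x) \<in> C x" using fin unfolding C_def by (intro Min_in) auto
    then show ?thesis unfolding l_def C_def by simp
  qed
  have "good_labelling (verts G) (adj G) l" unfolding good_labelling_def
  proof (intro conjI allI impI)
    fix k
    show "card {v \<in> verts G. l v = k} \<le> 3"
    proof (cases "\<exists>x\<in>verts G. l x = k")
      case True
      then obtain x where x: "x \<in> verts G" "l x = k" by blast
      have "{v \<in> verts G. l v = k} \<subseteq> C x"
      proof
        fix v assume "v \<in> {v \<in> verts G. l v = k}"
        then have "(v, k) \<in> r\<^sup>*" "v \<in> verts G" using C_l[of v] by auto
        moreover have "(x, k) \<in> r\<^sup>*" using C_l[of x] x by simp
        ultimately show "v \<in> C x" unfolding C_def using symD[OF sym] by (auto intro: rtrancl_trans)
      qed
      then have "card {v \<in> verts G. l v = k} \<le> card (C x)" using fin by (intro card_mono) (auto simp: C_def)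
      moreover have "\<not> 4 \<le> card (C x)"
        using four_vertex_tree_in_component[OF B, of x] blue x(1) unfolding C_def r_def
        by (auto simp: colour_class_def)
      ultimately show ?thesis by simp
    next
      case False
      then have "{v \<in> verts G. l v = k} = {}" by auto
      then show ?thesis by (simp only: card.empty)
    qed
  next
    fix x y z assume t: "adj G x y" "adj G y z" "adj G x z"
    have same: "l u = l v" if "adj G u v" "c {u, v} \<noteq> Red" for u v
    proof -
      have "c {u, v} = Blue" using that(2) by (cases "c {u, v}") auto
      then have "(u, v) \<in> r" using that unfolding r_def colour_class_def by simp
      then show ?thesis using C_eq[OF r_into_rtrancl] unfolding l_def by simp
    qed
    have redd: "{u, v} \<in> edges (colour_class G c Red)" if "adj G u v" "l u \<noteq> l v" for u v
      using that same[OF that(1)] unfolding colour_class_def by auto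
    show "l x = l y \<or> l y = l z \<or> l x = l z"
    proof (rule ccontr)
      assume n: "\<not> ?thesis"
      let ?f = "(!) [x, y, z]"
      have three: "i < 3 \<longleftrightarrow> i = 0 \<or> i = 1 \<or> i = (2::nat)" for i by auto
      have "has_copy (complete_graph 3) (colour_class G c Red)"
        unfolding has_copy_def
      proof (intro exI[of _ ?f] conjI ballI)
        show "inj_on ?f (verts (complete_graph 3))"
          using n unfolding inj_on_def complete_graph_def by (auto simp: three)
        show "?f ` verts (complete_graph 3) \<subseteq> verts (colour_class G c Red)"
          using adjD[OF G] t unfolding complete_graph_def colour_class_def by (auto simp: three)
        fix e assume "e \<in> edges (complete_graph 3)"
        then obtain i j where "e = {i, j}" "i \<noteq> j" "i < 3" "j < 3"
          unfolding complete_graph_def by (auto simp: card_2_iff)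
        then have "?f ` e \<in> {{x, y}, {y, z}, {x, z}}" unfolding three by (elim disjE) auto
        then show "?f ` e \<in> edges (colour_class G c Red)" using redd t n by auto
      qed
      then show False using red by simp
    qed
  qed
  then show "\<exists>l. good_labelling (verts G) (adj G) l" by blast
next
  assume "\<exists>l. good_labelling (verts G) (adj G) l"
  then obtain l where gl: "good_labelling (verts G) (adj G) l" ..
  note l = gl[unfolded good_labelling_def, THEN conjunct1, rule_format]
    gl[unfolded good_labelling_def, THEN conjunct2, rule_format]
  define c where "c e = (if \<exists>k. l ` e = {k} then Blue else Red)" for e
  have c: "c {u, v} = Blue \<longleftrightarrow> l u = l v" for u v unfolding c_def by auto
  have "\<not> has_copy (complete_graph 3) (colour_class G c Red)"
  proof
    assume "has_copy (complete_graph 3) (colour_class G c Red)"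
    then obtain f where f: "\<forall>e\<in>edges (complete_graph 3). f ` e \<in> edges (colour_class G c Red)"
      unfolding has_copy_def by blast
    have *: "adj G (f i) (f j) \<and> l (f i) \<noteq> l (f j)" if "i < 3" "j < 3" "i \<noteq> j" for i j
    proof -
      have "{i, j} \<in> edges (complete_graph 3)" using that unfolding complete_graph_def by auto
      then have "f ` {i, j} \<in> edges (colour_class G c Red)" using f by blast
      then show ?thesis using c[of "f i" "f j"] unfolding colour_class_def by auto
    qed
    show False using l(2)[of "f 0" "f 1" "f 2"] *[of 0 1] *[of 1 2] *[of 0 2] by simp
  qed
  moreover have "\<not> has_copy T (colour_class G c Blue)" if "T \<in> trees 4" for T
  proof
    have T: "connected_graph T" "card (verts T) = 4" using that unfolding trees_def is_tree_def by auto
    assume "has_copy T (colour_class G c Blue)"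
    then obtain f where f: "inj_on f (verts T)" "f ` verts T \<subseteq> verts G"
      "\<forall>e\<in>edges T. f ` e \<in> edges (colour_class G c Blue)"
      unfolding has_copy_def colour_class_def by auto
    obtain x where x: "x \<in> verts T" using T(2) by fastforce
    have "l (f y) = l (f x)" if "y \<in> verts T" for y
      by (rule connected_copy_single_label[OF T(1) f(3) _ that x]) (use c in \<open>auto simp: colour_class_def\<close>)
    then have "f ` verts T \<subseteq> {v \<in> verts G. l v = l (f x)}" using f(2) by auto
    then have "card (f ` verts T) \<le> card {v \<in> verts G. l v = l (f x)}"
      using G unfolding simple_graph_def by (intro card_mono) auto
    then show False using l(1)[of "l (f x)"] card_image[OF f(1)] T(2) by simp
  qed
  ultimately show "\<not> ramsey G {complete_graph 3} (trees 4)" unfolding ramsey_def by blast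
qed

text \<open>This removes colourings, trees and minimal graphs: both bounds below argue with
  labellings only.\<close>

lemma saturated_iff_good_labelling:
  fixes G :: "nat graph"
  shows "saturated (R_min {complete_graph 3} (trees 4)) G \<longleftrightarrow>
    simple_graph G \<and> (\<exists>l. good_labelling (verts G) (adj G) l) \<and>
    (\<forall>e\<in>complement_edges G. \<nexists>l. good_labelling (verts G) (adj (add_edge G e)) l)"
proof (cases "simple_graph G")
  case True
  have add: "simple_graph (add_edge G e)" if "e \<in> complement_edges G" for e
    using True that unfolding simple_graph_def add_edge_def complement_edges_def by auto
  let ?R = "R_min {complete_graph 3} (trees 4)"
  have iff: "(\<exists>F\<in>?R. has_copy F H) \<longleftrightarrow> \<not> (\<exists>l. good_labelling (verts H) (adj H) l)"
    if "simple_graph H" for H :: "nat graph"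
    unfolding R_min_copy_iff_ramsey[OF that] not_ramsey_iff_good_labelling[OF that, symmetric] by (rule not_not[symmetric])
  have "(\<forall>F\<in>?R. \<not> has_copy F G) \<longleftrightarrow> (\<exists>l. good_labelling (verts G) (adj G) l)"
    unfolding Set.bex_simps(8)[symmetric] iff[OF True] by (rule not_not)
  moreover have "(\<forall>e\<in>complement_edges G. \<exists>F\<in>?R. has_copy F (add_edge G e)) \<longleftrightarrow>
    (\<forall>e\<in>complement_edges G. \<nexists>l. good_labelling (verts G) (adj (add_edge G e)) l)"
  proof (rule ball_cong[OF refl])
    fix e assume "e \<in> complement_edges G"
    from iff[OF add[OF this]]
    show "(\<exists>F\<in>?R. has_copy F (add_edge G e)) \<longleftrightarrow> (\<nexists>l. good_labelling (verts G) (adj (add_edge G e)) l)"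
      by (simp add: add_edge_def)
  qed
  ultimately show ?thesis unfolding saturated_def using True by (simp only: simp_thms)
qed (simp add: saturated_def)

section \<open>Maximal triangle-free graphs of minimum degree three\<close>

definition edges_between :: "('a \<Rightarrow> 'a \<Rightarrow> bool) \<Rightarrow> 'a set \<Rightarrow> 'a set \<Rightarrow> nat" where
  "edges_between R A B = card {(x, y). x \<in> A \<and> y \<in> B \<and> R x y}"

lemma edges_between_eq_sum:
  assumes "finite A" "finite B"
  shows "edges_between R A B = (\<Sum>x\<in>A. card {y \<in> B. R x y})"
proof -
  have "{(x, y). x \<in> A \<and> y \<in> B \<and> R x y} = Sigma A (\<lambda>x. {y \<in> B. R x y})" by auto
  then show ?thesis unfolding edges_between_def using assms by (simp add: card_SigmaI)
qed

lemma edges_between_commute: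
  assumes "symp R"
  shows "edges_between R A B = edges_between R B A"
proof -
  have "{(x, y). x \<in> B \<and> y \<in> A \<and> R x y} = prod.swap ` {(x, y). x \<in> A \<and> y \<in> B \<and> R x y}"
    using assms by (auto simp: symp_def image_iff)
  then show ?thesis unfolding edges_between_def by (simp add: card_image)
qed

text \<open>Only \<open>a\<close> keeps its exact degree, which the edges found at the nonneighbours
  of \<open>a\<close> will complete to \<open>card B + card C\<close>; every other vertex of
  \<open>A\<close> is estimated by \<open>m\<close>.\<close>

lemma edges_at_part:
  assumes "finite A" "finite B" "finite C" "a \<in> A"
    and m: "\<And>a'. a' \<in> A \<Longrightarrow> a' \<noteq> a \<Longrightarrow> m \<le> card {b \<in> B. R a' b} + card {c \<in> C. R a' c}"
  shows "card {b \<in> B. R a b} + card {c \<in> C. R a c} + m * (card A - 1)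
    \<le> edges_between R A B + edges_between R A C"
proof -
  define d where "d a' = card {b \<in> B. R a' b} + card {c \<in> C. R a' c}" for a'
  have "d a + m * (card A - 1) \<le> d a + (\<Sum>a'\<in>A - {a}. d a')"
    using sum_bounded_below[of "A - {a}" m d] m assms(1,4) unfolding d_def by (simp add: mult.commute)
  also have "\<dots> = (\<Sum>a'\<in>A. d a')" using assms by (simp add: sum.remove)
  also have "\<dots> = edges_between R A B + edges_between R A C"
    using assms by (simp add: edges_between_eq_sum d_def sum.distrib)
  finally show ?thesis unfolding d_def .
qed

lemma card_nonneighbours:
  assumes "finite B"
  shows "card {b \<in> B. \<not> R a b} + card {b \<in> B. R a b} = card B"
proof -
  have "card ({b \<in> B. \<not> R a b} \<union> {b \<in> B. R a b}) = card {b \<in> B. \<not> R a b} + card {b \<in> B. R a b}"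
    using assms by (intro card_Un_disjoint) auto
  moreover have "{b \<in> B. \<not> R a b} \<union> {b \<in> B. R a b} = B" by auto
  ultimately show ?thesis by simp
qed

text \<open>Every vertex of \<open>B\<close> not adjacent to \<open>a\<close> is joined to a neighbour of \<open>a\<close> in \<open>C\<close>, and vice versa;
  these edges are pairwise distinct because each has exactly one end adjacent to \<open>a\<close>.\<close>

lemma tripartite_edges:
  assumes fin: "finite A" "finite B" "finite C" and a: "a \<in> A"
    and B: "\<And>b. b \<in> B \<Longrightarrow> \<not> R a b \<Longrightarrow> \<exists>c\<in>C. R a c \<and> R b c"
    and C: "\<And>c. c \<in> C \<Longrightarrow> \<not> R a c \<Longrightarrow> \<exists>b\<in>B. R a b \<and> R b c"
    and m: "\<And>a'. a' \<in> A \<Longrightarrow> a' \<noteq> a \<Longrightarrow> m \<le> card {b \<in> B. R a' b} + card {c \<in> C. R a' c}"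
  shows "card B + card C + m * (card A - 1)
    \<le> edges_between R A B + edges_between R A C + edges_between R B C"
proof -
  define B0 where "B0 = {b \<in> B. \<not> R a b}"
  define C0 where "C0 = {c \<in> C. \<not> R a c}"
  obtain g where g: "\<And>b. b \<in> B0 \<Longrightarrow> g b \<in> C \<and> R a (g b) \<and> R b (g b)"
    using B unfolding B0_def by (metis (no_types, lifting) mem_Collect_eq)
  obtain h where h: "\<And>c. c \<in> C0 \<Longrightarrow> h c \<in> B \<and> R a (h c) \<and> R (h c) c"
    using C unfolding C0_def by (metis (no_types, lifting) mem_Collect_eq)
  let ?P = "(\<lambda>b. (b, g b)) ` B0" and ?Q = "(\<lambda>c. (h c, c)) ` C0"
  have f0: "finite B0" "finite C0" using fin unfolding B0_def C0_def by auto
  have "card B0 + card C0 = card ?P + card ?Q"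
    by (subst (1 2) card_image) (auto simp: inj_on_def)
  also have "\<dots> = card (?P \<union> ?Q)"
    using f0 h by (intro card_Un_disjoint[symmetric]) (auto simp: B0_def)
  also have "\<dots> \<le> edges_between R B C" unfolding edges_between_def
  proof (rule card_mono)
    show "finite {(x, y). x \<in> B \<and> y \<in> C \<and> R x y}"
      by (rule finite_subset[of _ "B \<times> C"]) (use fin in auto)
    show "?P \<union> ?Q \<subseteq> {(x, y). x \<in> B \<and> y \<in> C \<and> R x y}"
      using g h unfolding B0_def C0_def by auto
  qed
  finally have "card B0 + card C0 \<le> edges_between R B C" .
  moreover have "card {b \<in> B. R a b} + card {c \<in> C. R a c} + m * (card A - 1)
    \<le> edges_between R A B + edges_between R A C"
    by (rule edges_at_part[OF fin a]) (rule m)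
  moreover note card_nonneighbours[OF fin(2), of R a]
    card_nonneighbours[OF fin(3), of R a]
  ultimately show ?thesis unfolding B0_def C0_def by linarith
qed

text \<open>The edges of \<open>tripartite_edges\<close> are joined by two stars with centres
  \<open>b1\<close> and \<open>c1\<close>. Since the centres are not adjacent to \<open>a\<close>,
  the stars avoid the chosen edges once \<open>b1\<close> and \<open>c1\<close> choose none. This
  loses two edges, and each star misses the other centre, hence the \<open>4\<close>.\<close>

lemma tripartite_edges_hubs:
  assumes fin: "finite A" "finite B" "finite C" and a: "a \<in> A"
    and B: "\<And>b. b \<in> B \<Longrightarrow> \<not> R a b \<Longrightarrow> \<exists>c\<in>C. R a c \<and> R b c"
    and C: "\<And>c. c \<in> C \<Longrightarrow> \<not> R a c \<Longrightarrow> \<exists>b\<in>B. R a b \<and> R b c"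
    and m: "\<And>a'. a' \<in> A \<Longrightarrow> a' \<noteq> a \<Longrightarrow> m \<le> card {b \<in> B. R a' b} + card {c \<in> C. R a' c}"
    and hubs: "b1 \<in> B" "c1 \<in> C" "\<not> R a b1" "\<not> R a c1"
      "\<And>c. c \<in> C \<Longrightarrow> c \<noteq> c1 \<Longrightarrow> R b1 c" "\<And>b. b \<in> B \<Longrightarrow> b \<noteq> b1 \<Longrightarrow> R b c1"
  shows "2 * card B + 2 * card C + m * (card A - 1)
    \<le> edges_between R A B + edges_between R A C + edges_between R B C + 4"
proof -
  define B0 where "B0 = {b \<in> B. \<not> R a b} - {b1}"
  define C0 where "C0 = {c \<in> C. \<not> R a c} - {c1}"
  obtain g where g: "\<And>b. b \<in> B0 \<Longrightarrow> g b \<in> C \<and> R a (g b) \<and> R b (g b)"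
    using B unfolding B0_def by (metis (no_types, lifting) DiffD1 mem_Collect_eq)
  obtain h where h: "\<And>c. c \<in> C0 \<Longrightarrow> h c \<in> B \<and> R a (h c) \<and> R (h c) c"
    using C unfolding C0_def by (metis (no_types, lifting) DiffD1 mem_Collect_eq)
  let ?P = "(\<lambda>b. (b, g b)) ` B0" and ?Q = "(\<lambda>c. (h c, c)) ` C0"
  let ?S = "(\<lambda>b. (b, c1)) ` (B - {b1})" and ?T = "(\<lambda>c. (b1, c)) ` (C - {c1})"
  have f0: "finite B0" "finite C0" using fin unfolding B0_def C0_def by auto
  have "card B0 + card C0 + (card B - 1) + (card C - 1) = card ?P + card ?Q + card ?S + card ?T"
    using fin hubs by (subst (1 2 3 4) card_image) (auto simp: inj_on_def)
  also have "\<dots> = card (?P \<union> ?Q \<union> ?S \<union> ?T)"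
  proof -
    have "?P \<inter> ?Q = {}" using h by (auto simp: B0_def)
    moreover have "(?P \<union> ?Q) \<inter> ?S = {}" using g h hubs(3,4) by (auto simp: C0_def)
    moreover have "(?P \<union> ?Q \<union> ?S) \<inter> ?T = {}" using g h hubs(3,4) by (auto simp: B0_def)
    ultimately show ?thesis using f0 fin by (simp add: card_Un_disjoint)
  qed
  also have "\<dots> \<le> edges_between R B C" unfolding edges_between_def
  proof (rule card_mono)
    show "finite {(x, y). x \<in> B \<and> y \<in> C \<and> R x y}"
      by (rule finite_subset[of _ "B \<times> C"]) (use fin in auto)
    have "?P \<subseteq> {(x, y). x \<in> B \<and> y \<in> C \<and> R x y}"
      using g unfolding B0_def by blast
    moreover have "?Q \<subseteq> {(x, y). x \<in> B \<and> y \<in> C \<and> R x y}"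
      using h unfolding C0_def by blast
    moreover have "?S \<subseteq> {(x, y). x \<in> B \<and> y \<in> C \<and> R x y}" using hubs(2,6) by blast
    moreover have "?T \<subseteq> {(x, y). x \<in> B \<and> y \<in> C \<and> R x y}" using hubs(1,5) by blast
    ultimately show "?P \<union> ?Q \<union> ?S \<union> ?T \<subseteq> {(x, y). x \<in> B \<and> y \<in> C \<and> R x y}"
      by (intro Un_least)
  qed
  finally have "card B0 + card C0 + (card B - 1) + (card C - 1) \<le> edges_between R B C" .
  moreover have "card {b \<in> B. \<not> R a b} = card B0 + 1" "card {c \<in> C. \<not> R a c} = card C0 + 1"
    using fin hubs(1-4) card_Suc_Diff1[of "{b \<in> B. \<not> R a b}" b1]
      card_Suc_Diff1[of "{c \<in> C. \<not> R a c}" c1] unfolding B0_def C0_def by simp_all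
  moreover have "card B \<ge> 1" "card C \<ge> 1" using fin hubs by (auto simp: Suc_le_eq card_gt_0_iff)
  moreover have "card {b \<in> B. R a b} + card {c \<in> C. R a c} + m * (card A - 1)
    \<le> edges_between R A B + edges_between R A C"
    by (rule edges_at_part[OF fin a]) (rule m)
  moreover note card_nonneighbours[OF fin(2), of R a]
    card_nonneighbours[OF fin(3), of R a]
  ultimately show ?thesis by linarith
qed

locale maximal_triangle_free =
  fixes V :: "'a set" and R :: "'a \<Rightarrow> 'a \<Rightarrow> bool"
  assumes fin: "finite V"
    and in_V: "R x y \<Longrightarrow> x \<in> V"
    and sym: "R x y \<Longrightarrow> R y x"
    and triangle_free: "R x y \<Longrightarrow> R y z \<Longrightarrow> \<not> R x z"
    and common_nb: "x \<in> V \<Longrightarrow> y \<in> V \<Longrightarrow> x \<noteq> y \<Longrightarrow> \<not> R x y \<Longrightarrow> \<exists>z. R x z \<and> R y z"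
begin

definition nb :: "'a \<Rightarrow> 'a set" where "nb x = {y. R x y}"

abbreviation deg :: "'a \<Rightarrow> nat" where "deg x \<equiv> card (nb x)"

lemma in_nb: "y \<in> nb x \<longleftrightarrow> R x y" by (simp add: nb_def)

lemma irrefl: "\<not> R x x" using triangle_free by blast

lemma nb_V: "nb x \<subseteq> V" using in_V[OF sym] by (auto simp: in_nb)

lemma finite_nb [simp]: "finite (nb x)" using finite_subset[OF nb_V fin] .

lemma symp: "symp R" using sym by (auto intro: sympI)

text \<open>Otherwise the graph is 4-regular, and every vertex is \<open>v\<close>, one of its
  \<open>4\<close> neighbours, or one of at most \<open>4 * 3\<close> further vertices next to
  those: \<open>17\<close> in all.\<close>

lemma min_degree_4_sum:
  assumes n: "card V \<ge> 18" and d: "\<And>x. x \<in> V \<Longrightarrow> deg x \<ge> 4"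
  shows "(\<Sum>x\<in>V. deg x) \<ge> 4 * card V + 1"
proof (rule ccontr)
  assume "\<not> ?thesis"
  then have le: "(\<Sum>x\<in>V. deg x) \<le> 4 * card V" by simp
  have d4: "deg x = 4" if "x \<in> V" for x
  proof (rule ccontr)
    assume "deg x \<noteq> 4"
    then have "deg x > 4" using d[OF that] by simp
    then have "(\<Sum>x\<in>V. 4) < (\<Sum>x\<in>V. deg x)"
      using fin that d by (intro sum_strict_mono_ex1) auto
    then show False using le by simp
  qed
  obtain v where v: "v \<in> V" using n by fastforce
  have "V \<subseteq> insert v (nb v \<union> (\<Union>u\<in>nb v. nb u - {v}))"
  proof
    fix w assume w: "w \<in> V"
    show "w \<in> insert v (nb v \<union> (\<Union>u\<in>nb v. nb u - {v}))"
    proof (cases "w = v \<or> w \<in> nb v")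
      case False
      then obtain z where "R v z" "R w z" using common_nb[OF v w] by (auto simp: in_nb)
      then have "z \<in> nb v" "w \<in> nb z - {v}" using sym False by (auto simp: in_nb)
      then show ?thesis by blast
    qed auto
  qed
  then have "card V \<le> card (insert v (nb v \<union> (\<Union>u\<in>nb v. nb u - {v})))"
    by (intro card_mono) auto
  also have "\<dots> \<le> Suc (card (nb v \<union> (\<Union>u\<in>nb v. nb u - {v})))" by (simp add: card_insert_le_m1 card_insert_if)
  also have "card (nb v \<union> (\<Union>u\<in>nb v. nb u - {v})) \<le> deg v + card (\<Union>u\<in>nb v. nb u - {v})"
    by (rule card_Un_le)
  also have "card (\<Union>u\<in>nb v. nb u - {v}) \<le> (\<Sum>u\<in>nb v. card (nb u - {v}))"
    by (rule card_UN_le) simp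
  also have "(\<Sum>u\<in>nb v. card (nb u - {v})) = (\<Sum>u\<in>nb v. 3)"
    using d4 nb_V sym by (intro sum.cong) (auto simp: subset_iff in_nb)
  finally show False using d4[OF v] n by simp
qed

end

section \<open>The classes around a vertex of degree three\<close>

locale degree_3_vertex = maximal_triangle_free +
  fixes v
  assumes v: "v \<in> V" and v3: "card (nb v) = 3"
    and min_degree: "x \<in> V \<Longrightarrow> 3 \<le> card (nb x)"
begin

definition "W = V - {v} - nb v"

text \<open>The vertices at distance two from \<open>v\<close> are sorted by their neighbours in \<open>nb v\<close>: exactly \<open>x\<close>
  for \<open>One x\<close>, all but \<open>x\<close> for \<open>Two x\<close>, all three for \<open>Three\<close>.\<close>

definition "One x = {w \<in> W. nb w \<inter> nb v = {x}}"

definition "Two x = {w \<in> W. nb w \<inter> nb v = nb v - {x}}"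

definition "Three = {w \<in> W. nb w \<inter> nb v = nb v}"

lemma finite_classes [simp]: "finite W" "finite (One x)" "finite (Two x)" "finite Three"
  using fin unfolding W_def One_def Two_def Three_def by auto

lemma nb_commute: "u \<in> nb w \<longleftrightarrow> w \<in> nb u"
  using sym by (auto simp: in_nb)

lemma W_nb:
  assumes "w \<in> W"
  shows "nb w \<inter> nb v \<noteq> {}"
proof -
  have "w \<in> V" "w \<noteq> v" "\<not> R w v" using assms nb_commute[of v w] unfolding W_def by (auto simp: in_nb)
  then obtain z where "R w z" "R v z" using common_nb v by blast
  then show ?thesis by (auto simp: in_nb)
qed

lemma adjacent_disjoint: "u \<in> nb w \<Longrightarrow> nb u \<inter> nb w = {}"
  using triangle_free by (auto simp: in_nb)

lemma subsets3:
  assumes "nb v = {x, y, z}" "distinct [x, y, z]" "S \<subseteq> nb v" "S \<noteq> {}"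
  shows "S = {x} \<or> S = {y} \<or> S = {z} \<or> S = nb v - {x} \<or> S = nb v - {y} \<or> S = nb v - {z} \<or> S = nb v"
proof -
  have vd: "nb v - {x} = {y, z}" "nb v - {y} = {x, z}" "nb v - {z} = {x, y}" using assms(1,2) by auto
  have "S \<in> Pow {x, y, z}" using assms(1,3) by auto
  then show ?thesis using assms(4) unfolding Pow_insert Pow_empty vd unfolding assms(1) by auto
qed

lemma not_nb_v: "w \<in> W \<Longrightarrow> w \<notin> nb v" "v \<notin> W" "v \<notin> nb v"
  unfolding W_def using irrefl by (auto simp: in_nb)

lemma nb_W:
  assumes "w \<in> W" "u \<in> nb w" "u \<notin> nb v"
  shows "u \<in> W"
proof -
  have "u \<noteq> v" using assms(1,2) nb_commute not_nb_v(1) by blast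
  then show ?thesis using assms(2,3) nb_V unfolding W_def by blast
qed

text \<open>A neighbour of \<open>w\<close> outside \<open>nb v\<close> does not see
  \<open>x\<close>, which leaves the three classes named. All of \<open>Two x\<close> occurs: a
  nonadjacent \<open>u\<close> in \<open>Two x\<close> would share with \<open>w\<close> a neighbour
  in one of these classes, which sees \<open>y\<close> or \<open>z\<close> and so closes a triangle
  with \<open>u\<close>.\<close>

lemma nb_One:
  assumes xyz: "nb v = {x, y, z}" "distinct [x, y, z]" and w: "w \<in> One x"
  shows "nb w = insert x (Two x \<union> {u \<in> One y. R w u} \<union> {u \<in> One z. R w u})" (is "_ = ?N")
proof
  have wW: "w \<in> W" and wx: "nb w \<inter> nb v = {x}" using w unfolding One_def by blast+
  have vx: "nb v - {x} = {y, z}" using xyz by auto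
  show sub: "nb w \<subseteq> ?N"
  proof
    fix u assume u: "u \<in> nb w"
    show "u \<in> ?N"
    proof (cases "u \<in> nb v")
      case True
      then show ?thesis using u wx by blast
    next
      case False
      then have uW: "u \<in> W" using nb_W wW u by blast
      have "x \<notin> nb u" using adjacent_disjoint[OF u] wx by blast
      then have "x \<notin> nb u \<inter> nb v" by blast
      moreover have "x \<in> nb v" "x \<in> nb v - {y}" "x \<in> nb v - {z}" using xyz by simp_all
      ultimately have "nb u \<inter> nb v = {y} \<or> nb u \<inter> nb v = {z} \<or> nb u \<inter> nb v = nb v - {x}"
        using subsets3[OF xyz, of "nb u \<inter> nb v"] W_nb[OF uW] by (metis insertI1 inf_le2)
      then show ?thesis using u uW unfolding One_def Two_def in_nb by blast
    qed
  qed
  show "?N \<subseteq> nb w"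
  proof -
    have "u \<in> nb w" if u: "u \<in> Two x" for u
    proof (rule ccontr)
      assume n: "u \<notin> nb w"
      have uW: "u \<in> W" and ux: "nb u \<inter> nb v = {y, z}" using u vx unfolding Two_def by auto
      have "x \<notin> {y, z}" using xyz(2) by simp
      then have "w \<noteq> u" using wx ux by blast
      then obtain t where t: "t \<in> nb w" "t \<in> nb u"
        using common_nb[of w u] wW uW n unfolding W_def in_nb by blast
      have "x \<notin> nb u" using ux xyz by auto
      then have "t \<in> Two x \<union> One y \<union> One z" using t sub by blast
      then have "nb t \<inter> {y, z} \<noteq> {}" using vx unfolding One_def Two_def by blast
      then show False using adjacent_disjoint[OF t(2)] ux by blast
    qed
    moreover have "x \<in> nb w" using wx by blast
    ultimately show ?thesis by (auto simp: in_nb)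
  qed
qed

lemma classes_disjoint:
  assumes "x \<in> nb v" "y \<in> nb v" "x \<noteq> y"
  shows "One x \<inter> One y = {}" "Two x \<inter> Two y = {}"
proof -
  show "One x \<inter> One y = {}" using assms(3) unfolding One_def by blast
  have "nb v - {x} \<noteq> nb v - {y}" using assms by blast
  then show "Two x \<inter> Two y = {}" unfolding Two_def by blast
qed

lemma card_nb_v_Diff: "x \<in> nb v \<Longrightarrow> card (nb v - {x}) = 2"
  using v3 by (simp add: card_Diff_singleton_if)

lemma One_disjoint:
  assumes "x \<in> nb v" "y \<in> nb v"
  shows "One x \<inter> Two y = {}" "One x \<inter> Three = {}" "Two x \<inter> Three = {}"
proof -
  have "{x} \<noteq> nb v - {y}"
  proof
    assume "{x} = nb v - {y}"
    then have "card {x} = 2" using card_nb_v_Diff[OF assms(2)] by simp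
    then show False by simp
  qed
  then show "One x \<inter> Two y = {}" unfolding One_def Two_def by blast
  have "{x} \<noteq> nb v"
  proof
    assume "{x} = nb v"
    then have "card {x} = 3" using v3 by simp
    then show False by simp
  qed
  then show "One x \<inter> Three = {}" unfolding One_def Three_def by blast
  have "nb v - {x} \<noteq> nb v" using assms(1) by blast
  then show "Two x \<inter> Three = {}" unfolding Two_def Three_def by blast
qed

lemma deg_One:
  assumes xyz: "nb v = {x, y, z}" "distinct [x, y, z]" and w: "w \<in> One x"
  shows "deg w = 1 + card (Two x) + card {u \<in> One y. R w u} + card {u \<in> One z. R w u}"
proof -
  have x: "x \<in> nb v" and y: "y \<in> nb v" and z: "z \<in> nb v" using xyz by auto
  have "x \<notin> Two x \<union> {u \<in> One y. R w u} \<union> {u \<in> One z. R w u}"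
    using x not_nb_v(1) unfolding One_def Two_def by blast
  moreover have "Two x \<inter> {u \<in> One y. R w u} = {}"
    "(Two x \<union> {u \<in> One y. R w u}) \<inter> {u \<in> One z. R w u} = {}"
    using One_disjoint(1)[OF y x] One_disjoint(1)[OF z x] classes_disjoint(1)[OF y z] xyz(2) by auto
  ultimately show ?thesis unfolding nb_One[OF assms] by (simp add: card_Un_disjoint)
qed

lemma One_Two_adjacent:
  assumes "x \<in> nb v" "w \<in> One x" "u \<in> Two x"
  shows "R w u"
proof -
  obtain y z where yz: "nb v - {x} = {y, z}" "y \<noteq> z"
    using card_nb_v_Diff[OF assms(1)] unfolding card_2_iff by blast
  then have "nb v = {x, y, z}" "distinct [x, y, z]" using assms(1) by auto
  then have "u \<in> nb w" using nb_One[of x y z w] assms by blast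
  then show ?thesis by (simp add: in_nb)
qed

text \<open>A neighbour outside \<open>nb v\<close> can see neither \<open>y\<close> nor
  \<open>z\<close>, so \<open>x\<close> is all that it sees; the converse is
  \<open>One_Two_adjacent\<close>.\<close>

lemma nb_Two:
  assumes xyz: "nb v = {x, y, z}" "distinct [x, y, z]" and w: "w \<in> Two x"
  shows "nb w = {y, z} \<union> One x"
proof
  have vx: "nb v - {x} = {y, z}" using xyz by auto
  have wW: "w \<in> W" and wx: "nb w \<inter> nb v = {y, z}" using w vx unfolding Two_def by auto
  show "nb w \<subseteq> {y, z} \<union> One x"
  proof
    fix u assume u: "u \<in> nb w"
    show "u \<in> {y, z} \<union> One x"
    proof (cases "u \<in> nb v")
      case True
      then show ?thesis using u wx by blast
    next
      case False
      then have uW: "u \<in> W" using nb_W wW u by blast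
      have "y \<notin> nb u" "z \<notin> nb u" using adjacent_disjoint[OF u] wx by blast+
      then have "nb u \<inter> nb v = {x}" using W_nb[OF uW] unfolding xyz(1) by blast
      then show ?thesis using uW unfolding One_def by blast
    qed
  qed
  have "u \<in> nb w" if "u \<in> One x" for u
    using One_Two_adjacent[OF _ that w] xyz(1) sym by (auto simp: in_nb)
  then show "{y, z} \<union> One x \<subseteq> nb w" using wx by blast
qed

lemma deg_Two:
  assumes xyz: "nb v = {x, y, z}" "distinct [x, y, z]" and w: "w \<in> Two x"
  shows "deg w = 2 + card (One x)"
proof -
  have "y \<in> nb v" "z \<in> nb v" using xyz by auto
  then have "{y, z} \<inter> One x = {}" using not_nb_v(1) unfolding One_def by blast
  then show ?thesis unfolding nb_Two[OF assms] using xyz(2) by (simp add: card_Un_disjoint)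
qed

lemma deg_Three:
  assumes w: "w \<in> Three"
  shows "deg w = 3"
proof -
  have "nb v \<subseteq> nb w" "w \<in> W" using w unfolding Three_def by blast+
  moreover have "u \<in> nb v" if u: "u \<in> nb w" for u
  proof (rule ccontr)
    assume "u \<notin> nb v"
    then have "u \<in> W" using nb_W \<open>w \<in> W\<close> u by blast
    then show False using W_nb[of u] adjacent_disjoint[OF u] \<open>nb v \<subseteq> nb w\<close> by blast
  qed
  ultimately have "nb w = nb v" by blast
  then show ?thesis using v3 by simp
qed

lemma deg_nb_v:
  assumes xyz: "nb v = {x, y, z}" "distinct [x, y, z]"
  shows "deg x = 1 + card (One x) + card (Two y) + card (Two z) + card Three"
proof -
  have x: "x \<in> nb v" and y: "y \<in> nb v" and z: "z \<in> nb v" using xyz by auto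
  have v: "nb v - {y} = {x, z}" "nb v - {z} = {x, y}" using xyz by auto
  have "nb x = insert v (One x \<union> Two y \<union> Two z \<union> Three)"
  proof
    show "nb x \<subseteq> insert v (One x \<union> Two y \<union> Two z \<union> Three)"
    proof
      fix u assume u: "u \<in> nb x"
      show "u \<in> insert v (One x \<union> Two y \<union> Two z \<union> Three)"
      proof (cases "u = v")
        case False
        have "u \<notin> nb v" using adjacent_disjoint[OF x] u nb_commute[of u x] nb_commute by blast
        then have uW: "u \<in> W" using False u nb_V unfolding W_def by blast
        have "x \<in> nb u \<inter> nb v" using u x nb_commute by blast
        moreover have "x \<notin> {y}" "x \<notin> {z}" "x \<notin> nb v - {x}" using xyz(2) by auto
        ultimately have "nb u \<inter> nb v = {x} \<or> nb u \<inter> nb v = nb v - {y} \<or> nb u \<inter> nb v = nb v - {z} \<or> nb u \<inter> nb v = nb v"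
          using subsets3[OF xyz, of "nb u \<inter> nb v"] by (metis empty_iff inf_le2)
        then show ?thesis using uW unfolding One_def Two_def Three_def by blast
      qed simp
    qed
    have "x \<in> nb u" if "u \<in> One x \<union> Two y \<union> Two z \<union> Three" for u
      using that v x unfolding One_def Two_def Three_def by blast
    then show "insert v (One x \<union> Two y \<union> Two z \<union> Three) \<subseteq> nb x"
      using x nb_commute by blast
  qed
  moreover have "v \<notin> One x \<union> Two y \<union> Two z \<union> Three"
    using not_nb_v(2) unfolding One_def Two_def Three_def by blast
  moreover have "One x \<inter> Two y = {}" "(One x \<union> Two y) \<inter> Two z = {}" "(One x \<union> Two y \<union> Two z) \<inter> Three = {}"
    using One_disjoint[OF x y] One_disjoint[OF x z] One_disjoint(3)[OF y z] One_disjoint(3)[OF z y]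
      classes_disjoint(2)[OF y z] xyz(2) by auto
  ultimately show ?thesis by (simp add: card_Un_disjoint)
qed

lemma V_split:
  assumes xyz: "nb v = {x, y, z}" "distinct [x, y, z]"
  shows "sum f V = f v + f x + f y + f z + sum f (One x) + sum f (One y) + sum f (One z)
    + sum f (Two x) + sum f (Two y) + sum f (Two z) + (sum f Three :: nat)"
proof -
  have x: "x \<in> nb v" and y: "y \<in> nb v" and z: "z \<in> nb v" using xyz by auto
  have W: "W = One x \<union> One y \<union> One z \<union> Two x \<union> Two y \<union> Two z \<union> Three"
  proof
    show "W \<subseteq> One x \<union> One y \<union> One z \<union> Two x \<union> Two y \<union> Two z \<union> Three"
    proof
      fix u assume u: "u \<in> W"
      then show "u \<in> One x \<union> One y \<union> One z \<union> Two x \<union> Two y \<union> Two z \<union> Three"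
        using subsets3[OF xyz, of "nb u \<inter> nb v"] W_nb[OF u]
        unfolding One_def Two_def Three_def by blast
    qed
  qed (auto simp: One_def Two_def Three_def)
  have V: "V = insert v (insert x (insert y (insert z W)))"
  proof -
    have "V = insert v (nb v \<union> W)" using v nb_V[of v] unfolding W_def by blast
    then show ?thesis unfolding xyz(1) by simp
  qed
  have "v \<notin> insert x (insert y (insert z W))" "x \<notin> insert y (insert z W)" "y \<notin> insert z W" "z \<notin> W"
    using xyz(2) not_nb_v x y z by auto
  then have "sum f V = f v + f x + f y + f z + sum f W"
    using arg_cong[OF V, of "sum f"] by (simp add: add.assoc)
  moreover have "sum f W = sum f (One x) + sum f (One y) + sum f (One z)
    + sum f (Two x) + sum f (Two y) + sum f (Two z) + sum f Three"
  proof -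
    note d = One_disjoint[OF x x] One_disjoint[OF x y] One_disjoint[OF x z]
        One_disjoint[OF y x] One_disjoint[OF y y] One_disjoint[OF y z]
        One_disjoint[OF z x] One_disjoint[OF z y] One_disjoint[OF z z]
        classes_disjoint[OF x y] classes_disjoint[OF x z] classes_disjoint[OF y z]
    have "x \<noteq> y" "x \<noteq> z" "y \<noteq> z" using xyz(2) by auto
    then have "One x \<inter> One y = {}" "(One x \<union> One y) \<inter> One z = {}" "(One x \<union> One y \<union> One z) \<inter> Two x = {}"
      "(One x \<union> One y \<union> One z \<union> Two x) \<inter> Two y = {}"
      "(One x \<union> One y \<union> One z \<union> Two x \<union> Two y) \<inter> Two z = {}"
      "(One x \<union> One y \<union> One z \<union> Two x \<union> Two y \<union> Two z) \<inter> Three = {}"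
      unfolding Int_Un_distrib2 by (simp_all only: d Un_empty_left simp_thms)
    then show ?thesis using arg_cong[OF W, of "sum f"] by (simp add: sum.union_disjoint)
  qed
  ultimately show ?thesis by simp
qed

lemma symR: "R u w \<longleftrightarrow> R w u"
  using sym by blast

text \<open>The common neighbour of \<open>w\<close> and \<open>u\<close> cannot see
  \<open>y\<close>, which excludes \<open>Two x\<close> and \<open>One y\<close>, and it is not
  \<open>x\<close> because \<open>u\<close> does not see \<open>x\<close>.\<close>

lemma path_One:
  assumes xyz: "nb v = {x, y, z}" "distinct [x, y, z]" and w: "w \<in> One x" "u \<in> One y" "\<not> R w u"
  shows "\<exists>t\<in>One z. R w t \<and> R u t"
proof -
  have y: "y \<in> nb v" "y \<in> nb v - {x}" using xyz by auto
  have u: "nb u \<inter> nb v = {y}" "u \<in> V" using w(2) unfolding One_def W_def by blast+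
  have "w \<in> V" using w(1) unfolding One_def W_def by blast
  moreover have "w \<noteq> u" using w classes_disjoint(1)[of x y] xyz by auto
  ultimately obtain t where t: "t \<in> nb w" "t \<in> nb u" using common_nb[of w u] u(2) w(3) by (auto simp: in_nb)
  have ty: "y \<notin> nb t" using adjacent_disjoint[OF t(2)] u(1) by blast
  then have "t \<notin> Two x" "t \<notin> One y" using y unfolding Two_def One_def by blast+
  moreover have "t \<noteq> x" using t(2) u(1) xyz by auto
  ultimately show ?thesis using t(1) t(2) unfolding nb_One[OF xyz w(1)] by (auto simp: in_nb)
qed

text \<open>\<open>w\<close> and \<open>y\<close> are not adjacent, and a common neighbour sees
  \<open>y\<close>; among the neighbours of \<open>w\<close> this leaves only \<open>One y\<close>
  when \<open>Two x\<close> is empty.\<close>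

lemma One_has_nb:
  assumes xyz: "nb v = {x, y, z}" "distinct [x, y, z]" and w: "w \<in> One x" and e: "Two x = {}"
  shows "\<exists>u\<in>One y. R w u"
proof -
  have x: "x \<in> nb v" and y: "y \<in> nb v" using xyz by auto
  have w': "nb w \<inter> nb v = {x}" "w \<in> V" "w \<notin> nb v" using w unfolding One_def W_def by blast+
  have "y \<noteq> x" using xyz by auto
  then have "y \<notin> nb w" using w'(1) y by blast
  then have "\<not> R w y" by (simp add: in_nb)
  moreover have "w \<noteq> y" "y \<in> V" using w'(3) y nb_V by auto
  ultimately obtain t where "R w t" "R y t" using common_nb w'(2) by blast
  then have t: "t \<in> nb w" "t \<in> nb y" by (simp_all add: in_nb)
  have "t \<noteq> x" using t(2) adjacent_disjoint[OF y] x by blast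
  moreover have "y \<in> nb t" "y \<noteq> z" using nb_commute[THEN iffD1, OF t(2)] xyz(2) by auto
  then have "t \<notin> One z" using y unfolding One_def by blast
  ultimately show ?thesis using t(1) e unfolding nb_One[OF xyz w] by blast
qed

lemma One_nonempty:
  assumes "x \<in> nb v" "Two x \<noteq> {}"
  shows "One x \<noteq> {}"
proof -
  obtain y z where yz: "nb v - {x} = {y, z}" "y \<noteq> z"
    using card_nb_v_Diff[OF assms(1)] unfolding card_2_iff by blast
  then have xyz: "nb v = {x, y, z}" "distinct [x, y, z]" using assms(1) by auto
  obtain w where w: "w \<in> Two x" using assms(2) by blast
  then have "w \<in> V" unfolding Two_def W_def by blast
  then have "3 \<le> 2 + card (One x)" using min_degree[of w] deg_Two[OF xyz w] by simp
  then show ?thesis by auto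
qed

section \<open>Counting the edges around a vertex of degree three\<close>

abbreviation "e_One x y \<equiv> edges_between R (One x) (One y)"

abbreviation "d_One w y z \<equiv> card {u \<in> One y. R w u} + card {u \<in> One z. R w u}"

lemma e_One_commute: "e_One x y = e_One y x"
  by (rule edges_between_commute[OF symp])

lemma d_One_ge:
  assumes "nb v = {x, y, z}" "distinct [x, y, z]" "w \<in> One x"
  shows "2 \<le> card (Two x) + d_One w y z"
proof -
  have "w \<in> V" using assms(3) unfolding One_def W_def by blast
  then show ?thesis using min_degree[of w] deg_One[OF assms] by simp
qed

lemma One_edges:
  assumes xyz: "nb v = {x, y, z}" "distinct [x, y, z]" and "One x \<noteq> {}"
    and m: "\<And>w. w \<in> One x \<Longrightarrow> m \<le> d_One w y z"
  shows "card (One y) + card (One z) + m * (card (One x) - 1) \<le> e_One x y + e_One x z + e_One y z"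
proof -
  obtain w where w: "w \<in> One x" using assms(3) by blast
  have xzy: "nb v = {x, z, y}" "distinct [x, z, y]" using xyz by auto
  show ?thesis
  proof (rule tripartite_edges[OF _ _ _ w])
    show "\<exists>c\<in>One z. R w c \<and> R b c" if "b \<in> One y" "\<not> R w b" for b
      using path_One[OF xyz w that] .
    show "\<exists>b\<in>One y. R w b \<and> R b c" if "c \<in> One z" "\<not> R w c" for c
      using path_One[OF xzy w that] symR by blast
  qed (use m in auto)
qed

text \<open>\<open>w\<close> has a single neighbour \<open>b1\<close> in \<open>One y\<close> and a
  single neighbour \<open>c1\<close> in \<open>One z\<close>. By \<open>path_One\<close>, every
  other vertex of \<open>One y\<close> must reach \<open>w\<close> through \<open>c1\<close>, and
  every other vertex of \<open>One z\<close> through \<open>b1\<close>: these are the hubs.\<close>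

lemma One_edges_hubs:
  assumes xyz: "nb v = {x, y, z}" "distinct [x, y, z]" and e: "Two x = {}" "Two y = {}"
    and w: "w \<in> One x" "d_One w y z = 2" and y2: "card (One y) \<ge> 2"
  shows "2 * card (One x) + 2 * card (One y) + 2 * card (One z) \<le> e_One x y + e_One x z + e_One y z + 6"
proof -
  have xzy: "nb v = {x, z, y}" "distinct [x, z, y]" and yxz: "nb v = {y, x, z}" "distinct [y, x, z]"
    using xyz by auto
  obtain b1 where b1: "b1 \<in> One y" "R w b1" using One_has_nb[OF xyz w(1) e(1)] by blast
  obtain c1 where c1: "c1 \<in> One z" "R w c1" using One_has_nb[OF xzy w(1) e(1)] by blast
  have "card {u \<in> One y. R w u} \<noteq> 0" "card {u \<in> One z. R w u} \<noteq> 0" using b1 c1 by auto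
  then have "card {u \<in> One y. R w u} = 1" "card {u \<in> One z. R w u} = 1" using w(2) by linarith+
  then have only: "b = b1" if "b \<in> One y" "R w b" for b
  proof -
    obtain s where "{u \<in> One y. R w u} = {s}"
      using \<open>card {u \<in> One y. R w u} = 1\<close> by (rule card_1_singletonE)
    then show ?thesis using that b1 by (metis (mono_tags, lifting) mem_Collect_eq singletonD)
  qed
  have only': "c = c1" if "c \<in> One z" "R w c" for c
  proof -
    obtain s where "{u \<in> One z. R w u} = {s}"
      using \<open>card {u \<in> One z. R w u} = 1\<close> by (rule card_1_singletonE)
    then show ?thesis using that c1 by (metis (mono_tags, lifting) mem_Collect_eq singletonD)
  qed
  have Bc1: "R b c1" if "b \<in> One y" "b \<noteq> b1" for b
    using path_One[OF xyz w(1) that(1)] only[OF that(1)] that(2) only' by blast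
  have b1C: "R b1 c" if "c \<in> One z" "c \<noteq> c1" for c
    using path_One[OF xzy w(1) that(1)] only'[OF that(1)] that(2) only sym by blast
  have "One y \<noteq> {b1}" using y2 by auto
  \<comment> \<open>The count cannot be centred at \<open>w\<close>, which is adjacent to both hubs.
    A neighbour \<open>a0\<close> of a second vertex \<open>b\<close> works: \<open>b\<close> is
    adjacent to \<open>c1\<close>, so \<open>a0\<close> is not; the neighbour of \<open>a0\<close>
    in \<open>One z\<close> is then adjacent to \<open>b1\<close>, so \<open>a0\<close> is not
    adjacent to \<open>b1\<close> either.\<close>
  then obtain b where b: "b \<in> One y" "b \<noteq> b1" using b1(1) by blast
  obtain a0 where a0: "a0 \<in> One x" "R b a0" using One_has_nb[OF yxz b(1) e(2)] by blast
  have n1: "\<not> R a0 c1" using triangle_free[of b a0 c1] a0(2) Bc1[OF b] by blast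
  obtain c where c: "c \<in> One z" "R a0 c" using One_has_nb[OF xzy a0(1) e(1)] by blast
  then have "R b1 c" using b1C n1 by blast
  then have n2: "\<not> R a0 b1" using triangle_free[of a0 b1 c] c by blast
  have m: "2 \<le> d_One a y z" if "a \<in> One x" for a using d_One_ge[OF xyz that] e(1) by simp
  have "2 * card (One y) + 2 * card (One z) + 2 * (card (One x) - 1) \<le> e_One x y + e_One x z + e_One y z + 4"
  proof (rule tripartite_edges_hubs[where R = R and a = a0 and ?b1.0 = b1 and ?c1.0 = c1])
    show "\<exists>c\<in>One z. R a0 c \<and> R b c" if "b \<in> One y" "\<not> R a0 b" for b
      using path_One[OF xyz a0(1) that] .
    show "\<exists>b\<in>One y. R a0 b \<and> R b c" if "c \<in> One z" "\<not> R a0 c" for c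
      using path_One[OF xzy a0(1) that] symR by blast
    show "2 \<le> d_One a y z" if "a \<in> One x" "a \<noteq> a0" for a using m[OF that(1)] .
    show "R b1 c" if "c \<in> One z" "c \<noteq> c1" for c using b1C[OF that] .
    show "R b c1" if "b \<in> One y" "b \<noteq> b1" for b using Bc1[OF that] .
  qed (fact a0(1) b1(1) c1(1) n1 n2 finite_classes)+
  moreover have "card (One x) \<ge> 1" using a0(1) by (auto simp: Suc_le_eq card_gt_0_iff)
  ultimately show ?thesis by linarith
qed

text \<open>Counting degrees class by class turns a degree sum above \<open>4 * card V\<close> into this inequality.\<close>

definition "enough_edges x y z \<longleftrightarrow> 6 + card (One x) + card (One y) + card (One z) \<le> e_One x y + e_One x z + e_One y z
  + card Three + card (One x) * card (Two x) + card (One y) * card (Two y) + card (One z) * card (Two z)"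

lemma sum_le_prod: "1 \<le> a \<Longrightarrow> 1 \<le> b \<Longrightarrow> a + b \<le> a * b + (1 :: nat)"
  by (cases a; cases b) auto

lemma W_card:
  assumes "nb v = {x, y, z}" "distinct [x, y, z]" "card V \<ge> 18"
  shows "14 \<le> card (One x) + card (One y) + card (One z) + card (Two x) + card (Two y) + card (Two z) + card Three"
proof -
  have "(\<Sum>u\<in>V. 1) = 4 + card (One x) + card (One y) + card (One z)
    + card (Two x) + card (Two y) + card (Two z) + card Three"
   unfolding V_split[OF assms(1,2)] by simp
  then have "card V = 4 + card (One x) + card (One y) + card (One z)
    + card (Two x) + card (Two y) + card (Two z) + card Three" by (simp only: card_eq_sum)
  then show ?thesis using assms(3) by linarith
qed

lemma One_adjacent_other:
  assumes xyz: "nb v = {x, y, z}" "distinct [x, y, z]" and "w \<in> One x" "One y \<noteq> {}"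
  shows "1 \<le> d_One w y z"
proof -
  obtain u where "u \<in> One y" using assms(4) by blast
  then have "{u \<in> One y. R w u} \<noteq> {} \<or> {u \<in> One z. R w u} \<noteq> {}"
    using path_One[OF xyz assms(3)] by blast
  then have "card {u \<in> One y. R w u} \<noteq> 0 \<or> card {u \<in> One z. R w u} \<noteq> 0" by auto
  then show ?thesis by linarith
qed

text \<open>\<open>sum_le_prod\<close> turns the three products into sums at the cost of one each.
  Then \<open>m = 1\<close> suffices in \<open>One_edges\<close>, and the surplus comes from the
  \<open>14\<close> vertices of \<open>W_card\<close>.\<close>

lemma enough_edges_no_Two_empty:
  assumes xyz: "nb v = {x, y, z}" "distinct [x, y, z]" and n: "card V \<ge> 18"
    and ne: "Two x \<noteq> {}" "Two y \<noteq> {}" "Two z \<noteq> {}"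
  shows "enough_edges x y z"
proof -
  have o: "One x \<noteq> {}" "One y \<noteq> {}" "One z \<noteq> {}" using One_nonempty ne xyz(1) by auto
  then have c: "1 \<le> card (One x)" "1 \<le> card (One y)" "1 \<le> card (One z)"
    "1 \<le> card (Two x)" "1 \<le> card (Two y)" "1 \<le> card (Two z)"
    using ne by (simp_all add: Suc_le_eq card_gt_0_iff)
  have "card (One y) + card (One z) + 1 * (card (One x) - 1) \<le> e_One x y + e_One x z + e_One y z"
    using One_edges[OF xyz o(1)] One_adjacent_other[OF xyz _ o(2)] by blast
  then show ?thesis unfolding enough_edges_def
    using sum_le_prod[OF c(1,4)] sum_le_prod[OF c(2,5)] sum_le_prod[OF c(3,6)] c W_card[OF xyz n]
    by linarith
qed

text \<open>Without \<open>Two x\<close>, a vertex of \<open>One x\<close> needs two neighbours in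
  \<open>One y\<close> and \<open>One z\<close> to reach degree three, so \<open>m = 2\<close>
  replaces the missing product. If \<open>One x\<close> is empty, the count is centred at
  \<open>One y\<close>.\<close>

lemma enough_edges_one_Two_empty:
  assumes xyz: "nb v = {x, y, z}" "distinct [x, y, z]" and n: "card V \<ge> 18"
    and ne: "Two x = {}" "Two y \<noteq> {}" "Two z \<noteq> {}"
  shows "enough_edges x y z"
proof -
  have o: "One y \<noteq> {}" "One z \<noteq> {}" using One_nonempty ne xyz(1) by auto
  then have c: "1 \<le> card (One y)" "1 \<le> card (One z)" "1 \<le> card (Two y)" "1 \<le> card (Two z)"
    using ne by (simp_all add: Suc_le_eq card_gt_0_iff)
  show ?thesis
  proof (cases "One x = {}")
    case True
    have yzx: "nb v = {y, z, x}" "distinct [y, z, x]" using xyz by auto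
    have "card (One z) + card (One x) + 1 * (card (One y) - 1) \<le> e_One y z + e_One y x + e_One z x"
      using One_edges[OF yzx o(1)] One_adjacent_other[OF yzx _ o(2)] by blast
    then show ?thesis unfolding enough_edges_def
      using sum_le_prod[OF c(1,3)] sum_le_prod[OF c(2,4)] c W_card[OF xyz n]
        arg_cong[OF ne(1), of card] arg_cong[OF True, of card] e_One_commute[of y x] e_One_commute[of z x]
      unfolding card.empty by linarith
  next
    case False
    then have "1 \<le> card (One x)" by (simp add: Suc_le_eq card_gt_0_iff)
    moreover have "card (One y) + card (One z) + 2 * (card (One x) - 1) \<le> e_One x y + e_One x z + e_One y z"
      using One_edges[OF xyz False] d_One_ge[OF xyz] ne(1) by simp
    moreover have "card (Two x) = 0" using ne by simp
    ultimately show ?thesis unfolding enough_edges_def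
      using sum_le_prod[OF c(1,3)] sum_le_prod[OF c(2,4)] c W_card[OF xyz n] by simp
  qed
qed

text \<open>With one product left, the edges among the classes \<open>One\<close> must carry more:
  either a vertex with exactly two neighbours there brings in \<open>One_edges_hubs\<close>, or
  \<open>m = 3\<close> is available.\<close>

lemma enough_edges_two_Two_empty:
  assumes xyz: "nb v = {x, y, z}" "distinct [x, y, z]" and n: "card V \<ge> 18"
    and ne: "Two x = {}" "Two y = {}" "Two z \<noteq> {}"
  shows "enough_edges x y z"
proof -
  have yxz: "nb v = {y, x, z}" "distinct [y, x, z]" and zxy: "nb v = {z, x, y}" "distinct [z, x, y]" using xyz by auto
  have o: "One z \<noteq> {}" using One_nonempty ne xyz(1) by auto
  then have c: "1 \<le> card (One z)" "1 \<le> card (Two z)"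
    using ne by (simp_all add: Suc_le_eq card_gt_0_iff)
  have c0: "card (Two x) = 0" "card (Two y) = 0" using ne by auto
  note W = W_card[OF xyz n]
  have emp: "One x = {} \<longleftrightarrow> One y = {}"
    using One_has_nb[OF xyz _ ne(1)] One_has_nb[OF yxz _ ne(2)] by blast
  show ?thesis
  proof (cases "One x = {}")
    case True
    then have o': "card (One x) = 0" "card (One y) = 0" using emp by auto
    obtain w where "w \<in> One z" using o by blast
    from d_One_ge[OF zxy this] True emp have "2 \<le> card (Two z)" by simp
    then obtain i where i: "card (Two z) = i + 2" using le_Suc_ex by (metis add.commute)
    obtain j where j: "card (One z) = j + 1" using c(1) le_Suc_ex by (metis add.commute)
    have "2 * card (One z) + card (Two z) \<le> card (One z) * card (Two z) + 2" unfolding i j by simp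
    then show ?thesis unfolding enough_edges_def using W o' c0 by simp
  next
    case False
    then have c': "1 \<le> card (One x)" "1 \<le> card (One y)" using emp by (auto simp: Suc_le_eq card_gt_0_iff)
    have Lx: "card (One y) + card (One z) + m * (card (One x) - 1) \<le> e_One x y + e_One x z + e_One y z"
      if "\<And>w. w \<in> One x \<Longrightarrow> m \<le> d_One w y z" for m
      using One_edges[OF xyz False that] .
    have Ly: "card (One x) + card (One z) + m * (card (One y) - 1) \<le> e_One x y + e_One y z + e_One x z"
      if "\<And>w. w \<in> One y \<Longrightarrow> m \<le> d_One w x z" for m
      using One_edges[OF yxz _ that] False emp e_One_commute[of y x] by simp
    have d2x: "2 \<le> d_One w y z" if "w \<in> One x" for w using d_One_ge[OF xyz that] c0 by simp
    have d2y: "2 \<le> d_One w x z" if "w \<in> One y" for w using d_One_ge[OF yxz that] c0 by simp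
    note P = sum_le_prod[OF c]
    show ?thesis
    \<comment> \<open>\<open>Lx\<close> with \<open>m = 2\<close> is enough once \<open>9\<close>
      vertices of \<open>W\<close> lie outside \<open>One y\<close>; as \<open>W\<close> has at
      least \<open>14\<close>, this holds if \<open>One y\<close> has at most \<open>5\<close>.
      \<open>Ly\<close> serves \<open>One x\<close> in the same way.\<close>
    proof (cases "card (One x) \<le> 5 \<or> card (One y) \<le> 5")
      case True
      then show ?thesis unfolding enough_edges_def using Lx[of 2] Ly[of 2] d2x d2y P W c c' c0 by auto
    next
      case big: False
      show ?thesis
      proof (cases "(\<exists>w\<in>One x. d_One w y z = 2) \<or> (\<exists>w\<in>One y. d_One w x z = 2)")
        case True
        then have "2 * card (One x) + 2 * card (One y) + 2 * card (One z) \<le> e_One x y + e_One x z + e_One y z + 6"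
        proof
          assume "\<exists>w\<in>One x. d_One w y z = 2"
          then show ?thesis using One_edges_hubs[OF xyz ne(1,2)] big by auto
        next
          assume "\<exists>w\<in>One y. d_One w x z = 2"
          then have "2 * card (One y) + 2 * card (One x) + 2 * card (One z) \<le> e_One y x + e_One y z + e_One x z + 6"
            using One_edges_hubs[OF yxz ne(2,1)] big by auto
          then show ?thesis using e_One_commute[of y x] by linarith
        qed
        then show ?thesis unfolding enough_edges_def using P W c c' c0 by simp
      next
        case False
        have "3 \<le> d_One w y z" if "w \<in> One x" for w
        proof -
          have "d_One w y z \<noteq> 2" using False that by blast
          then show ?thesis using d2x[OF that] by linarith
        qed
        moreover have "3 \<le> d_One w x z" if "w \<in> One y" for w
        proof -
          have "d_One w x z \<noteq> 2" using False that by blast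
          then show ?thesis using d2y[OF that] by linarith
        qed
        ultimately show ?thesis unfolding enough_edges_def using Lx[of 3] Ly[of 3] P W c c' c0 by simp
      qed
    qed
  qed
qed

text \<open>No product is left. Unless \<open>One_edges_hubs\<close> applies, \<open>m = 3\<close>
  holds at all three classes, and adding the three bounds shows that \<open>3 * E\<close> is at
  least five times the size of the classes \<open>One\<close> together, minus
  \<open>9\<close>.\<close>

lemma enough_edges_all_Two_empty:
  assumes xyz: "nb v = {x, y, z}" "distinct [x, y, z]" and n: "card V \<ge> 18"
    and ne: "Two x = {}" "Two y = {}" "Two z = {}"
  shows "enough_edges x y z"
proof -
  have yzx: "nb v = {y, z, x}" "distinct [y, z, x]" and zxy: "nb v = {z, x, y}" "distinct [z, x, y]"
    and zyx: "nb v = {z, y, x}" "distinct [z, y, x]" using xyz by auto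
  have c0: "card (Two x) = 0" "card (Two y) = 0" "card (Two z) = 0" using ne by auto
  note W = W_card[OF xyz n]
  have emp: "One x = {} \<longleftrightarrow> One y = {}" "One z = {} \<longleftrightarrow> One y = {}"
    using One_has_nb[OF xyz _ ne(1)] One_has_nb[OF yzx _ ne(2)] One_has_nb[OF zxy _ ne(3)]
    by blast+
  note ec = e_One_commute[of y x] e_One_commute[of z x] e_One_commute[of z y]
  show ?thesis
  proof (cases "One x = {}")
    case True
    then show ?thesis unfolding enough_edges_def using emp W c0 by simp
  next
    case False
    then have o: "One x \<noteq> {}" "One y \<noteq> {}" "One z \<noteq> {}" using emp by auto
    then have c': "1 \<le> card (One x)" "1 \<le> card (One y)" "1 \<le> card (One z)"
      by (auto simp: Suc_le_eq card_gt_0_iff)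
    have H: "2 * card (One x) + 2 * card (One y) + 2 * card (One z) \<le> e_One x y + e_One x z + e_One y z + 6"
      if xyz: "nb v = {x, y, z}" "distinct [x, y, z]" and ne: "Two x = {}" "Two y = {}" "Two z = {}"
        and w: "w \<in> One x" "d_One w y z = 2" for x y z w
    proof (rule One_edges_hubs[OF xyz ne(1,2) w])
      have xzy: "nb v = {x, z, y}" "distinct [x, z, y]" and zyx: "nb v = {z, y, x}" "distinct [z, y, x]"
        using xyz by auto
      obtain b where b: "b \<in> One y" "R w b" using One_has_nb[OF xyz w(1) ne(1)] by blast
      obtain c where c: "c \<in> One z" "R w c" using One_has_nb[OF xzy w(1) ne(1)] by blast
      \<comment> \<open>This is a second vertex of \<open>One y\<close>, as \<open>w\<close>,
        \<open>b\<close> and \<open>c\<close> cannot be pairwise adjacent.\<close>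
      obtain b' where b': "b' \<in> One y" "R c b'" using One_has_nb[OF zyx c(1) ne(3)] by blast
      have "b \<noteq> b'" using b(2) b'(2) c(2) triangle_free[of w c b'] by blast
      then have "card {b, b'} = 2" by simp
      moreover have "card {b, b'} \<le> card (One y)" using b(1) b'(1) by (intro card_mono) auto
      ultimately show "2 \<le> card (One y)" by simp
    qed
    show ?thesis
    proof (cases "(\<exists>w\<in>One x. d_One w y z = 2) \<or> (\<exists>w\<in>One y. d_One w z x = 2) \<or> (\<exists>w\<in>One z. d_One w x y = 2)")
      case True
      then have "2 * card (One x) + 2 * card (One y) + 2 * card (One z) \<le> e_One x y + e_One x z + e_One y z + 6"
      proof (elim disjE bexE)
        show ?thesis if "w \<in> One x" "d_One w y z = 2" for w using H[OF xyz ne that] .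
        show ?thesis if "w \<in> One y" "d_One w z x = 2" for w using H[OF yzx ne(2,3,1) that] ec by linarith
        show ?thesis if "w \<in> One z" "d_One w x y = 2" for w using H[OF zxy ne(3,1,2) that] ec by linarith
      qed
      then show ?thesis unfolding enough_edges_def using W c' c0 by simp
    next
      case False
      have 3: "3 \<le> d_One w y z" if "w \<in> One x" for w
      proof -
        have "d_One w y z \<noteq> 2" using False that by blast
        then show ?thesis using d_One_ge[OF xyz that] unfolding c0 by linarith
      qed
      have 4: "3 \<le> d_One w z x" if "w \<in> One y" for w
      proof -
        have "d_One w z x \<noteq> 2" using False that by blast
        then show ?thesis using d_One_ge[OF yzx that] unfolding c0 by linarith
      qed
      have 5: "3 \<le> d_One w x y" if "w \<in> One z" for w
      proof -
        have "d_One w x y \<noteq> 2" using False that by blast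
        then show ?thesis using d_One_ge[OF zxy that] unfolding c0 by linarith
      qed
      define E where "E = e_One x y + e_One x z + e_One y z"
      have "card (One y) + card (One z) + 3 * (card (One x) - 1) \<le> E"
        using One_edges[OF xyz o(1) 3] unfolding E_def by blast
      moreover have "card (One z) + card (One x) + 3 * (card (One y) - 1) \<le> E"
        using One_edges[OF yzx o(2) 4] ec unfolding E_def by linarith
      moreover have "card (One x) + card (One y) + 3 * (card (One z) - 1) \<le> E"
        using One_edges[OF zxy o(3) 5] ec unfolding E_def by linarith
      ultimately have "6 + card (One x) + card (One y) + card (One z) \<le> E + card Three"
        using W c' unfolding c0 by linarith
      then show ?thesis unfolding enough_edges_def E_def c0 by simp
    qed
  qed
qed

lemma enough_edges_permute:
  assumes "enough_edges x y z"
  shows "enough_edges y x z" "enough_edges x z y" "enough_edges z y x"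
proof -
  note e = assms[unfolded enough_edges_def] e_One_commute[of y x] e_One_commute[of z x] e_One_commute[of z y]
  show "enough_edges y x z" unfolding enough_edges_def using e by linarith
  show "enough_edges x z y" unfolding enough_edges_def using e by linarith
  show "enough_edges z y x" unfolding enough_edges_def using e by linarith
qed

lemma degree_3_sum:
  assumes n: "card V \<ge> 18"
  shows "(\<Sum>x\<in>V. deg x) \<ge> 4 * card V + 1"
proof -
  obtain x y z where xyz: "nb v = {x, y, z}" "distinct [x, y, z]"
    using v3 unfolding card_3_iff by auto
  have yxz: "nb v = {y, x, z}" "distinct [y, x, z]" and xzy: "nb v = {x, z, y}" "distinct [x, z, y]"
    and zyx: "nb v = {z, y, x}" "distinct [z, y, x]" using xyz by auto
  have enough_edges: "enough_edges x y z"
    using enough_edges_no_Two_empty[OF xyz n] enough_edges_one_Two_empty[OF xyz n] enough_edges_one_Two_empty[OF yxz n] enough_edges_one_Two_empty[OF zyx n]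
      enough_edges_two_Two_empty[OF xyz n] enough_edges_two_Two_empty[OF xzy n] enough_edges_two_Two_empty[OF zyx n] enough_edges_all_Two_empty[OF xyz n] enough_edges_permute
    by metis
  have One: "(\<Sum>w\<in>One x. deg w) = card (One x) + card (One x) * card (Two x) + e_One x y + e_One x z"
    if "nb v = {x, y, z}" "distinct [x, y, z]" for x y z
  proof -
    have "(\<Sum>w\<in>One x. deg w) = (\<Sum>w\<in>One x. 1 + card (Two x) + card {u \<in> One y. R w u} + card {u \<in> One z. R w u})"
      using deg_One[OF that] by (intro sum.cong) auto
    also have "\<dots> = (\<Sum>w\<in>One x. 1 + card (Two x)) + e_One x y + e_One x z"
      by (simp only: sum.distrib edges_between_eq_sum finite_classes)
    finally show ?thesis by simp
  qed
  have Two: "(\<Sum>w\<in>Two x. deg w) = 2 * card (Two x) + card (One x) * card (Two x)"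
    if "nb v = {x, y, z}" "distinct [x, y, z]" for x y z
  proof -
    have "(\<Sum>w\<in>Two x. deg w) = (\<Sum>w\<in>Two x. 2 + card (One x))"
      using deg_Two[OF that] by (intro sum.cong) auto
    then show ?thesis by (simp add: algebra_simps)
  qed
  have Three: "(\<Sum>w\<in>Three. deg w) = 3 * card Three" using deg_Three by simp
  have "(\<Sum>w\<in>V. deg w) = 6 + 2 * (card (One x) + card (One y) + card (One z))
    + 4 * (card (Two x) + card (Two y) + card (Two z)) + 6 * card Three
    + 2 * (card (One x) * card (Two x) + card (One y) * card (Two y) + card (One z) * card (Two z))
    + 2 * (e_One x y + e_One x z + e_One y z)"
    unfolding V_split[OF xyz] One[OF xyz] One[OF yxz] One[OF zyx] Two[OF xyz] Two[OF yxz] Two[OF zyx]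
      Three deg_nb_v[OF xyz] deg_nb_v[OF yxz] deg_nb_v[OF zyx] v3
      e_One_commute[of y x] e_One_commute[of z x] e_One_commute[of z y] by simp
  moreover have "card V = 4 + (card (One x) + card (One y) + card (One z))
    + (card (Two x) + card (Two y) + card (Two z)) + card Three"
    using V_split[OF xyz, of "\<lambda>_. 1"] by simp
  moreover note enough_edges[unfolded enough_edges_def]
  ultimately show ?thesis unfolding distrib_left by linarith
qed

end

context maximal_triangle_free
begin

theorem min_degree_3_sum:
  assumes n: "card V \<ge> 18" and d: "\<And>x. x \<in> V \<Longrightarrow> deg x \<ge> 3"
  shows "(\<Sum>x\<in>V. deg x) \<ge> 4 * card V + 1"
proof (cases "\<exists>v\<in>V. deg v = 3")
  case True
  then obtain v where "v \<in> V" "deg v = 3" by blast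
  then interpret degree_3_vertex V R v using d by unfold_locales auto
  show ?thesis by (rule degree_3_sum[OF n])
next
  case False
  then have "deg x \<ge> 4" if "x \<in> V" for x using d[OF that] that by fastforce
  then show ?thesis by (rule min_degree_4_sum[OF n])
qed

end

section \<open>Labelled saturated graphs\<close>

text \<open>\<open>third_label\<close> is saturation: adding the edge \<open>{u, v}\<close> must create a triangle with three labels.\<close>

locale saturated_graph =
  fixes V :: "'a set" and E :: "'a \<Rightarrow> 'a \<Rightarrow> bool"
  assumes fin: "finite V"
    and E_V: "E x y \<Longrightarrow> x \<in> V"
    and E_sym: "E x y \<Longrightarrow> E y x"
    and E_irrefl: "\<not> E x x"
    and third_label: "good_labelling V E l \<Longrightarrow> u \<in> V \<Longrightarrow> v \<in> V \<Longrightarrow> u \<noteq> v \<Longrightarrow> \<not> E u v \<Longrightarrow>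
      l u \<noteq> l v \<and> (\<exists>z. E u z \<and> E v z \<and> l z \<noteq> l u \<and> l z \<noteq> l v)"
    and n18: "18 \<le> card V"

text \<open>\<open>R\<close> is the red graph. Maximality of \<open>R\<close> gives the ends of each blue edge a common red
  neighbour, and maximality of the number of labels makes the blue edges connect every part.\<close>

locale red_coloured = saturated_graph +
  fixes l :: "'a \<Rightarrow> nat" and R :: "'a \<Rightarrow> 'a \<Rightarrow> bool"
  assumes good: "good_labelling V E l"
    and most_labels: "good_labelling V E l' \<Longrightarrow> card (l' ` V) \<le> card (l ` V)"
    and R_E: "R x y \<Longrightarrow> E x y"
    and cross: "E x y \<Longrightarrow> l x \<noteq> l y \<Longrightarrow> R x y"
    and R_sym: "R x y \<Longrightarrow> R y x"
    and R_triangle_free: "R x y \<Longrightarrow> R y z \<Longrightarrow> \<not> R x z"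
    and R_maximal: "E x y \<Longrightarrow> \<not> R x y \<Longrightarrow> \<exists>z. R x z \<and> R y z"
begin

text \<open>Vertices not adjacent in \<open>E\<close> share a neighbour with a third label, and
  edges between different labels are red; for blue edges \<open>R_maximal\<close> applies.\<close>

sublocale maximal_triangle_free V R
proof
  show "\<exists>z. R x z \<and> R y z" if "x \<in> V" "y \<in> V" "x \<noteq> y" "\<not> R x y" for x y
  proof (cases "E x y")
    case True
    then show ?thesis using R_maximal that by blast
  next
    case False
    then show ?thesis using third_label[OF good that(1,2,3)] cross by metis
  qed
  show "finite V" by (rule fin)
  show "x \<in> V" if "R x y" for x y using E_V[OF R_E[OF that]] .
  show "R y x" if "R x y" for x y using R_sym[OF that] .
  show "\<not> R x z" if "R x y" "R y z" for x y z using R_triangle_free[OF that] .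
qed

section \<open>Parts, their regrouping, and blue degrees\<close>

definition part :: "'a \<Rightarrow> 'a set" where "part v = {u \<in> V. l u = l v}"

lemma in_part [simp]: "u \<in> part v \<longleftrightarrow> u \<in> V \<and> l u = l v"
  by (simp add: part_def)

lemma finite_part [simp]: "finite (part v)"
  using fin by (simp add: part_def)

lemma card_part: "card (part v) \<le> 3"
  using good unfolding good_labelling_def part_def by blast

lemma part_eq: "l u = l v \<Longrightarrow> part u = part v"
  by (simp add: part_def)

lemma part_eqI:
  assumes "S \<subseteq> part v" "card S = 3"
  shows "part v = S"
proof -
  have "S = part v" by (rule card_seteq[OF finite_part assms(1)]) (simp only: card_part assms(2))
  then show ?thesis by simp
qed

lemma part_adjacent: "u \<in> V \<Longrightarrow> v \<in> V \<Longrightarrow> u \<noteq> v \<Longrightarrow> l u = l v \<Longrightarrow> E u v"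
  using third_label[OF good] by blast

text \<open>Every triangle already has two vertices with equal \<open>l\<close>; up to symmetry
  these are \<open>x\<close> and \<open>y\<close>, so only triangles that the new labelling splits
  there can be bad.\<close>

lemma good_labellingI:
  assumes "\<And>c. card {v \<in> V. l' v = c} \<le> 3"
    and "\<And>x y z. E x y \<Longrightarrow> E y z \<Longrightarrow> E x z \<Longrightarrow> l x = l y \<Longrightarrow>
      l' x \<noteq> l' y \<Longrightarrow> l' y \<noteq> l' z \<Longrightarrow> l' x \<noteq> l' z \<Longrightarrow> False"
  shows "good_labelling V E l'"
  unfolding good_labelling_def
proof (intro conjI allI impI assms(1))
  fix x y z assume t: "E x y" "E y z" "E x z"
  note t' = t(1)[THEN E_sym] t(2)[THEN E_sym] t(3)[THEN E_sym]
  have "l x = l y \<or> l y = l z \<or> l x = l z" using good t unfolding good_labelling_def by blast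
  then show "l' x = l' y \<or> l' y = l' z \<or> l' x = l' z"
    using assms(2)[of x y z] assms(2)[of y z x] assms(2)[of x z y] t t' by metis
qed

text \<open>Merging the two parts keeps the labelling good but gives \<open>u\<close> and
  \<open>v\<close> the same label, which saturation forbids for nonadjacent vertices.\<close>

lemma small_parts_adjacent:
  assumes "u \<in> V" "v \<in> V" "u \<noteq> v" "card (part u) + card (part v) \<le> 3"
  shows "E u v"
proof (rule ccontr)
  assume n: "\<not> E u v"
  define l' where "l' x = (if l x = l v then l u else l x)" for x
  have "good_labelling V E l'"
  proof (rule good_labellingI)
    fix c
    show "card {w \<in> V. l' w = c} \<le> 3"
    proof (cases "c = l u")
      case True
      then have "{w \<in> V. l' w = c} \<subseteq> part u \<union> part v" unfolding l'_def by (auto split: if_splits)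
      then have "card {w \<in> V. l' w = c} \<le> card (part u \<union> part v)" by (intro card_mono) auto
      also have "\<dots> \<le> card (part u) + card (part v)" by (rule card_Un_le)
      finally show ?thesis using assms(4) by simp
    next
      case False
      then have "{w \<in> V. l' w = c} \<subseteq> {w \<in> V. l w = c}" unfolding l'_def by (auto split: if_splits)
      then have "card {w \<in> V. l' w = c} \<le> card {w \<in> V. l w = c}" using fin by (intro card_mono) auto
      then show ?thesis using good unfolding good_labelling_def by (meson le_trans)
    qed
  next
    fix x y z assume "l x = l y" "l' x \<noteq> l' y"
    moreover from this(1) have "l' x = l' y" unfolding l'_def by simp
    ultimately show False by blast
  qed
  then show False using third_label[OF _ assms(1,2,3) n, of l'] unfolding l'_def by simp
qed

text \<open>The later regroupings take at most two sets out of their parts and make each a part of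
  its own. Labels above the maximum cannot clash with those that stay.\<close>

definition relabel :: "'a set \<Rightarrow> 'a set \<Rightarrow> 'a \<Rightarrow> nat" where
  "relabel K K' x = (let N = Suc (Max (l ` V)) in if x \<in> K then N else if x \<in> K' then Suc N else l x)"

lemma fresh: "x \<in> V \<Longrightarrow> l x < Suc (Max (l ` V))"
  using fin by (simp add: less_Suc_eq_le)

lemma relabel_eq:
  assumes "x \<in> V" "y \<in> V"
  shows "relabel K K' x = relabel K K' y \<longleftrightarrow>
    (if x \<in> K then y \<in> K else if x \<in> K' then y \<in> K' \<and> y \<notin> K else y \<notin> K \<and> y \<notin> K' \<and> l x = l y)"
proof -
  define N where "N = Suc (Max (l ` V))"
  have "l x < N" "l y < N" using fresh assms unfolding N_def by blast+
  then show ?thesis unfolding relabel_def Let_def N_def[symmetric]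
    by (cases "x \<in> K"; cases "y \<in> K"; cases "x \<in> K'"; cases "y \<in> K'") simp_all
qed

text \<open>A triangle with \<open>l x = l y\<close> either has its third vertex in another part,
  and then both edges to it are red, or is a whole part because parts have at most three
  vertices.\<close>

lemma good_relabel:
  assumes K: "finite K" "finite K'" "card K \<le> 3" "card K' \<le> 3"
    and c1: "\<And>x y z. x \<in> V \<Longrightarrow> y \<in> V \<Longrightarrow> z \<in> V \<Longrightarrow> x \<noteq> y \<Longrightarrow> l x = l y \<Longrightarrow> R x z \<Longrightarrow> R y z \<Longrightarrow>
      relabel K K' x \<noteq> relabel K K' y \<Longrightarrow> relabel K K' y \<noteq> relabel K K' z \<Longrightarrow>
      relabel K K' x \<noteq> relabel K K' z \<Longrightarrow> False"
    and c2: "\<And>x y z. x \<in> V \<Longrightarrow> y \<in> V \<Longrightarrow> z \<in> V \<Longrightarrow> distinct [x, y, z] \<Longrightarrow> l x = l y \<Longrightarrow> l y = l z \<Longrightarrow>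
      part x = {x, y, z} \<Longrightarrow>
      relabel K K' x \<noteq> relabel K K' y \<Longrightarrow> relabel K K' y \<noteq> relabel K K' z \<Longrightarrow>
      relabel K K' x \<noteq> relabel K K' z \<Longrightarrow> False"
  shows "good_labelling V E (relabel K K')"
proof (rule good_labellingI)
  fix c
  let ?l' = "relabel K K'" and ?N = "Suc (Max (l ` V))"
  consider "c = ?N" | "c = Suc ?N" | "c \<noteq> ?N" "c \<noteq> Suc ?N" by blast
  then show "card {v \<in> V. ?l' v = c} \<le> 3"
  proof cases
    case 1
    have "{v \<in> V. ?l' v = c} \<subseteq> K"
    proof
      fix v assume "v \<in> {v \<in> V. ?l' v = c}"
      then show "v \<in> K" using fresh[of v] 1 by (cases "v \<in> K"; cases "v \<in> K'") (simp_all add: relabel_def)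
    qed
    then have "card {v \<in> V. ?l' v = c} \<le> card K" using K by (intro card_mono) auto
    then show ?thesis using K by simp
  next
    case 2
    have "{v \<in> V. ?l' v = c} \<subseteq> K'"
    proof
      fix v assume "v \<in> {v \<in> V. ?l' v = c}"
      then show "v \<in> K'" using fresh[of v] 2 by (cases "v \<in> K"; cases "v \<in> K'") (simp_all add: relabel_def)
    qed
    then have "card {v \<in> V. ?l' v = c} \<le> card K'" using K by (intro card_mono) auto
    then show ?thesis using K by simp
  next
    case 3
    then have "{v \<in> V. ?l' v = c} \<subseteq> {v \<in> V. l v = c}" by (auto simp: relabel_def Let_def split: if_splits)
    then have "card {v \<in> V. ?l' v = c} \<le> card {v \<in> V. l v = c}" using fin by (intro card_mono) auto
    then show ?thesis using good unfolding good_labelling_def by (meson le_trans)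
  qed
next
  fix x y z assume e: "E x y" "E y z" "E x z" "l x = l y"
    and n: "relabel K K' x \<noteq> relabel K K' y" "relabel K K' y \<noteq> relabel K K' z"
      "relabel K K' x \<noteq> relabel K K' z"
  have V: "x \<in> V" "y \<in> V" "z \<in> V" using E_V[OF e(1)] E_V[OF e(2)] E_V[OF E_sym[OF e(2)]] by auto
  have d: "distinct [x, y, z]" using e E_irrefl by auto
  show False
  proof (cases "l z = l x")
    case True
    have "part x = {x, y, z}" by (rule part_eqI) (use V d e True in auto)
    then show False using c2[OF V d e(4) _ _ n] e(4) True by simp
  next
    case False
    then have "R x z" "R y z" using cross[OF e(3)] cross[OF e(2)] e(4) by simp_all
    moreover have "x \<noteq> y" using d by simp
    ultimately show False using c1[OF V _ e(4) _ _ n] by blast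
  qed
qed

text \<open>Otherwise \<open>v\<close> could be split off as a part of its own: any triangle spoilt
  by this would be entirely red. As \<open>u\<close> keeps the old label, the number of labels would
  grow, against \<open>most_labels\<close>.\<close>

lemma blue_mate:
  assumes "u \<in> V" "v \<in> V" "u \<noteq> v" "l u = l v"
  shows "\<exists>m \<in> part v. m \<noteq> v \<and> \<not> R v m"
proof (rule ccontr)
  assume "\<not> ?thesis"
  then have red: "R v m" if "m \<in> V" "l m = l v" "m \<noteq> v" for m using that by auto
  have g: "good_labelling V E (relabel {v} {})"
  proof (rule good_relabel)
    fix x y z assume a: "x \<in> V" "y \<in> V" "z \<in> V" "x \<noteq> y" "l x = l y" "R x z" "R y z"
      "relabel {v} {} x \<noteq> relabel {v} {} y"
    then have "x = v \<or> y = v" by (auto simp: relabel_eq split: if_splits)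
    then have "R x y" using red[of x] red[of y] a R_sym by metis
    then show False using R_triangle_free a(6,7) by blast
  next
    fix x y z assume a: "x \<in> V" "y \<in> V" "z \<in> V" "distinct [x, y, z]" "l x = l y" "l y = l z"
      "relabel {v} {} x \<noteq> relabel {v} {} y" "relabel {v} {} y \<noteq> relabel {v} {} z"
      "relabel {v} {} x \<noteq> relabel {v} {} z"
    then show False by (auto simp: relabel_eq split: if_splits)
  qed auto
  have "relabel {v} {} ` V = insert (Suc (Max (l ` V))) (l ` V)"
  proof
    show "relabel {v} {} ` V \<subseteq> insert (Suc (Max (l ` V))) (l ` V)" by (auto simp: relabel_def Let_def)
    show "insert (Suc (Max (l ` V))) (l ` V) \<subseteq> relabel {v} {} ` V"
    proof
      fix c assume "c \<in> insert (Suc (Max (l ` V))) (l ` V)"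
      then consider "c = Suc (Max (l ` V))" | w where "w \<in> V" "c = l w" by blast
      then show "c \<in> relabel {v} {} ` V"
      proof cases
        case 1
        then have "c = relabel {v} {} v" by (simp add: relabel_def)
        then show ?thesis using assms(2) by blast
      next
        case 2
        then have "c = relabel {v} {} (if w = v then u else w)" using assms by (auto simp: relabel_def)
        then show ?thesis using 2 assms(1) by auto
      qed
    qed
  qed
  moreover have "Suc (Max (l ` V)) \<notin> l ` V"
  proof
    assume "Suc (Max (l ` V)) \<in> l ` V"
    then obtain w where "w \<in> V" "Suc (Max (l ` V)) = l w" by blast
    then show False using fresh[of w] by simp
  qed
  ultimately have "card (relabel {v} {} ` V) = Suc (card (l ` V))" using fin by simp
  then show False using most_labels[OF g] by simp
qed

definition blue_deg :: "'a \<Rightarrow> nat" where "blue_deg v = card {u. E v u \<and> \<not> R v u}"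

definition singles :: "'a set" where "singles = {v \<in> V. part v = {v}}"

lemma finite_E [simp]: "finite {u. E v u}" "finite {u. E v u \<and> \<not> R v u}"
  by (rule finite_subset[OF _ fin]; use E_V E_sym in blast)+

lemma deg_blue_deg: "card {u. E v u} = deg v + blue_deg v"
proof -
  have "{u. E v u} = nb v \<union> {u. E v u \<and> \<not> R v u}" using R_E by (auto simp: in_nb)
  moreover have "nb v \<inter> {u. E v u \<and> \<not> R v u} = {}" by (auto simp: in_nb)
  ultimately show ?thesis unfolding blue_deg_def by (simp add: card_Un_disjoint)
qed

lemma blue_deg_ge:
  assumes "M \<subseteq> part v" "v \<in> V" "v \<notin> M" "\<And>m. m \<in> M \<Longrightarrow> \<not> R v m"
  shows "card M \<le> blue_deg v"
  unfolding blue_deg_def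
proof (rule card_mono)
  show "M \<subseteq> {u. E v u \<and> \<not> R v u}"
  proof
    fix m assume m: "m \<in> M"
    then have "m \<in> V" "l v = l m" "v \<noteq> m" using assms(1,3) by auto
    then show "m \<in> {u. E v u \<and> \<not> R v u}" using part_adjacent assms(2,4) m by blast
  qed
qed simp

lemma blue_deg_2:
  assumes "v \<in> V" "card (part v) = 3" "\<And>m. m \<in> part v \<Longrightarrow> \<not> R v m"
  shows "2 \<le> blue_deg v"
proof -
  have "card (part v - {v}) = 2" using assms(1,2) by (simp add: card_Diff_singleton_if)
  moreover have "card (part v - {v}) \<le> blue_deg v"
    by (rule blue_deg_ge) (use assms(1,3) in blast)+
  ultimately show ?thesis by simp
qed

lemma not_single: "v \<in> V \<Longrightarrow> v \<notin> singles \<Longrightarrow> \<exists>u\<in>V. u \<noteq> v \<and> l u = l v"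
  unfolding singles_def by (auto simp: part_def)

lemma blue_deg_1:
  assumes "v \<in> V" "v \<notin> singles"
  shows "1 \<le> blue_deg v"
proof -
  obtain u where "u \<in> V" "u \<noteq> v" "l u = l v" using not_single[OF assms] by blast
  then obtain m where "m \<in> part v" "m \<noteq> v" "\<not> R v m" using blue_mate assms(1) by blast
  then show ?thesis using blue_deg_ge[of "{m}" v] assms(1) by simp
qed

lemma finite_singles [simp]: "finite singles" using fin unfolding singles_def by simp

text \<open>Singleton parts could be merged unless their vertices are adjacent, so three of them
  would form a red triangle.\<close>

lemma card_singles: "card singles \<le> 2"
proof (rule ccontr)
  assume "\<not> ?thesis"
  then have "3 \<le> card singles" by simp
  then obtain T where T: "T \<subseteq> singles" "card T = 3" using obtain_subset_with_card_n by metis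
  then obtain x y z where xyz: "T = {x, y, z}" "x \<noteq> y" "x \<noteq> z" "y \<noteq> z" unfolding card_3_iff by auto
  have red: "R u w" if "u \<in> singles" "w \<in> singles" "u \<noteq> w" for u w
  proof -
    have p: "u \<in> V" "w \<in> V" "part u = {u}" "part w = {w}" using that unfolding singles_def by auto
    then have "E u w" using small_parts_adjacent[OF p(1,2) that(3)] by simp
    moreover have "w \<notin> part u" using p that(3) by simp
    then have "l u \<noteq> l w" using p(2) by simp
    ultimately show ?thesis using cross by blast
  qed
  have "R x y" "R y z" "R x z" using red T xyz by auto
  then show False using R_triangle_free by blast
qed

text \<open>Each vertex outside \<open>singles\<close> contributes one by \<open>blue_deg_1\<close>,
  and those in \<open>P\<close> a second unit.\<close>

lemma blue_deg_sum:
  assumes P: "P \<subseteq> V" "\<And>v. v \<in> P \<Longrightarrow> 2 \<le> blue_deg v"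
  shows "card V + card P \<le> (\<Sum>v\<in>V. blue_deg v) + card singles"
proof -
  define g where "g v = (if v \<in> P then 1 else 0 :: nat)" for v
  define h where "h v = (if v \<in> singles then 1 else 0 :: nat)" for v
  have "card V + card P = (\<Sum>v\<in>V. 1 + g v)"
    unfolding sum.distrib g_def using P(1) fin by (simp add: sum.If_cases Int_absorb1)
  also have "\<dots> \<le> (\<Sum>v\<in>V. blue_deg v + h v)"
  proof (rule sum_mono)
    fix v assume v: "v \<in> V"
    show "1 + g v \<le> blue_deg v + h v"
      using P(2)[of v] blue_deg_1[OF v] by (auto simp: g_def h_def)
  qed
  also have "\<dots> = (\<Sum>v\<in>V. blue_deg v) + card (V \<inter> singles)"
    unfolding sum.distrib h_def using fin by (simp add: sum.If_cases)
  also have "V \<inter> singles = singles" unfolding singles_def by auto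
  finally show ?thesis .
qed

lemma other_part:
  assumes "S \<subseteq> V" "4 \<le> card S"
  shows "\<exists>w\<in>S. l w \<noteq> c"
proof (rule ccontr)
  assume "\<not> ?thesis"
  then have "S \<subseteq> {v \<in> V. l v = c}" using assms(1) by auto
  then have "card S \<le> card {v \<in> V. l v = c}" using fin by (intro card_mono) auto
  moreover have "card {v \<in> V. l v = c} \<le> 3" using good unfolding good_labelling_def by blast
  ultimately show False using assms(2) by linarith
qed

lemma good_isolate:
  assumes K: "finite K" "card K \<le> 3"
    and c: "\<And>x y z. x \<in> K \<Longrightarrow> x \<in> V \<Longrightarrow> y \<in> V \<Longrightarrow> z \<in> V \<Longrightarrow> y \<notin> K \<Longrightarrow> z \<notin> K \<Longrightarrow>
      l x = l y \<Longrightarrow> R x z \<Longrightarrow> R y z \<Longrightarrow> False"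
  shows "good_labelling V E (relabel K {})"
proof (rule good_relabel)
  fix x y z assume V: "x \<in> V" "y \<in> V" "z \<in> V" and a: "l x = l y" "R x z" "R y z"
    and n: "relabel K {} x \<noteq> relabel K {} y" "relabel K {} y \<noteq> relabel K {} z"
      "relabel K {} x \<noteq> relabel K {} z"
  have "x \<in> K \<and> y \<notin> K \<and> z \<notin> K \<or> y \<in> K \<and> x \<notin> K \<and> z \<notin> K"
    using n a(1) unfolding relabel_eq[OF V(1,2)] relabel_eq[OF V(2,3)] relabel_eq[OF V(1,3)]
    by (simp split: if_splits)
  then show False using c[of x y z] c[of y x z] V a by metis
next
  fix x y z assume V: "x \<in> V" "y \<in> V" "z \<in> V" and a: "l x = l y" "l y = l z"
    and n: "relabel K {} x \<noteq> relabel K {} y" "relabel K {} y \<noteq> relabel K {} z"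
      "relabel K {} x \<noteq> relabel K {} z"
  show False
    using n a unfolding relabel_eq[OF V(1,2)] relabel_eq[OF V(2,3)] relabel_eq[OF V(1,3)]
    by (simp split: if_splits)
qed (simp_all add: K)

text \<open>\<open>c1\<close> and \<open>c2\<close> treat triangles whose equally labelled pair is
  separated by \<open>K\<close> or \<open>K'\<close>; \<open>c3\<close> excludes that one old part
  is broken into three pieces.\<close>

lemma good_isolate2:
  assumes K: "finite K" "card K \<le> 3" "finite K'" "card K' \<le> 3" "K \<inter> K' = {}"
    and c1: "\<And>x y z. x \<in> K \<Longrightarrow> x \<in> V \<Longrightarrow> y \<in> V \<Longrightarrow> z \<in> V \<Longrightarrow> y \<notin> K \<Longrightarrow> z \<notin> K \<Longrightarrow>
      \<not> (y \<in> K' \<and> z \<in> K') \<Longrightarrow> l x = l y \<Longrightarrow> R x z \<Longrightarrow> R y z \<Longrightarrow> False"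
    and c2: "\<And>x y z. x \<in> K' \<Longrightarrow> x \<in> V \<Longrightarrow> y \<in> V \<Longrightarrow> z \<in> V \<Longrightarrow> y \<notin> K' \<Longrightarrow> z \<notin> K' \<Longrightarrow>
      \<not> (y \<in> K \<and> z \<in> K) \<Longrightarrow> l x = l y \<Longrightarrow> R x z \<Longrightarrow> R y z \<Longrightarrow> False"
    and c3: "\<And>x y z. x \<in> K \<Longrightarrow> y \<in> K' \<Longrightarrow> z \<in> V \<Longrightarrow> z \<notin> K \<Longrightarrow> z \<notin> K' \<Longrightarrow> l x = l y \<Longrightarrow> l y = l z \<Longrightarrow> False"
  shows "good_labelling V E (relabel K K')"
proof (rule good_relabel)
  fix x y z assume V: "x \<in> V" "y \<in> V" "z \<in> V" and a: "l x = l y" "R x z" "R y z"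
    and n: "relabel K K' x \<noteq> relabel K K' y" "relabel K K' y \<noteq> relabel K K' z"
      "relabel K K' x \<noteq> relabel K K' z"
  note n' = n[unfolded relabel_eq[OF V(1,2)] relabel_eq[OF V(2,3)] relabel_eq[OF V(1,3)]]
  consider "x \<in> K" | "y \<in> K" "x \<notin> K" | "x \<in> K'" "x \<notin> K" "y \<notin> K" | "y \<in> K'" "x \<notin> K'" "x \<notin> K" "y \<notin> K"
    using n'(1) a(1) by (auto split: if_splits)
  then show False
  proof cases
    case 1
    then have "y \<notin> K" "z \<notin> K" "\<not> (y \<in> K' \<and> z \<in> K')" using n' by (simp_all split: if_splits)
    then show False using c1[OF 1 V] a by blast
  next
    case 2
    then have "z \<notin> K" "\<not> (x \<in> K' \<and> z \<in> K')" using n' by (auto split: if_splits)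
    then show False using c1[OF 2(1) V(2,1,3) 2(2)] a by simp
  next
    case 3
    then have "y \<notin> K'" "z \<notin> K'" "\<not> (y \<in> K \<and> z \<in> K)" using n' K(5) by (auto split: if_splits)
    then show False using c2[OF 3(1) V] a by blast
  next
    case 4
    then have "z \<notin> K'" "\<not> (x \<in> K \<and> z \<in> K)" using n' K(5) by (auto split: if_splits)
    then show False using c2[OF 4(1) V(2,1,3) 4(2)] a by simp
  qed
next
  fix x y z assume V: "x \<in> V" "y \<in> V" "z \<in> V" and a: "l x = l y" "l y = l z"
    and n: "relabel K K' x \<noteq> relabel K K' y" "relabel K K' y \<noteq> relabel K K' z"
      "relabel K K' x \<noteq> relabel K K' z"
  have "\<exists>p q r. {p, q, r} = {x, y, z} \<and> p \<in> K \<and> q \<in> K' \<and> r \<notin> K \<and> r \<notin> K'"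
    using n a unfolding relabel_eq[OF V(1,2)] relabel_eq[OF V(2,3)] relabel_eq[OF V(1,3)]
    by (cases "x \<in> K"; cases "y \<in> K"; cases "z \<in> K"; cases "x \<in> K'"; cases "y \<in> K'"; cases "z \<in> K'";
      simp; metis insert_commute)
  then obtain p q r where pqr: "{p, q, r} = {x, y, z}" "p \<in> K" "q \<in> K'" "r \<notin> K" "r \<notin> K'" by blast
  have "l w = l x \<and> w \<in> V" if "w \<in> {p, q, r}" for w using that a V unfolding pqr(1) by auto
  then have "l p = l x" "l q = l x" "l r = l x" "r \<in> V" by simp_all
  then show False using c3[OF pqr(2,3) _ pqr(4,5)] by simp
qed (simp_all add: K(1-4))

end

section \<open>Red graphs that are blown-up pentagons\<close>

text \<open>The red graph is a blown-up pentagon with classes \<open>{a}\<close>, \<open>X\<close>, \<open>Y\<close>, \<open>{b}\<close>, \<open>Z\<close> in cyclic order.\<close>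

locale pentagon = red_coloured +
  fixes a b :: 'a and X Y Z :: "'a set"
  assumes V_eq: "V = {a, b} \<union> X \<union> Y \<union> Z"
    and ab: "a \<noteq> b"
    and notin: "a \<notin> X" "a \<notin> Y" "a \<notin> Z" "b \<notin> X" "b \<notin> Y" "b \<notin> Z"
    and disj: "X \<inter> Y = {}" "X \<inter> Z = {}" "Y \<inter> Z = {}"
    and Ra: "R a u \<longleftrightarrow> u \<in> X \<or> u \<in> Z"
    and Rb: "R b u \<longleftrightarrow> u \<in> Y \<or> u \<in> Z"
    and RX: "x \<in> X \<Longrightarrow> R x u \<longleftrightarrow> u = a \<or> u \<in> Y"
    and RY: "y \<in> Y \<Longrightarrow> R y u \<longleftrightarrow> u = b \<or> u \<in> X"
    and RZ: "z \<in> Z \<Longrightarrow> R z u \<longleftrightarrow> u = a \<or> u = b"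
    and Z_ne: "Z \<noteq> {}"
    and XY_empty: "X = {} \<longleftrightarrow> Y = {}"
begin

text \<open>The pentagon read backwards; interpreting it transfers statements about \<open>a\<close>
  and \<open>Y\<close> to \<open>b\<close> and \<open>X\<close>.\<close>

lemma swap: "pentagon V E l R b a Y X Z"
  by unfold_locales (use V_eq ab notin disj Ra Rb RX RY RZ Z_ne XY_empty in auto)

lemma finite_classes [simp]: "finite X" "finite Y" "finite Z"
  using fin V_eq by auto

lemma in_V_classes: "a \<in> V" "b \<in> V" "x \<in> X \<Longrightarrow> x \<in> V" "y \<in> Y \<Longrightarrow> y \<in> V" "z \<in> Z \<Longrightarrow> z \<in> V"
  using V_eq by auto

lemma in_V_iff: "u \<in> V \<longleftrightarrow> u = a \<or> u = b \<or> u \<in> X \<or> u \<in> Y \<or> u \<in> Z"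
  using arg_cong[OF V_eq, of "\<lambda>S. u \<in> S"] by simp

lemma cards: "card V = 2 + card X + card Y + card Z"
proof -
  have "({a, b} \<union> X) \<inter> Y = {}" "({a, b} \<union> X \<union> Y) \<inter> Z = {}" "{a, b} \<inter> X = {}" using notin disj by auto
  then show ?thesis unfolding V_eq using ab by (simp add: card_Un_disjoint)
qed

lemma sum_V: "sum f V = f a + f b + sum f X + sum f Y + (sum f Z :: nat)"
proof -
  have "({a, b} \<union> X) \<inter> Y = {}" "({a, b} \<union> X \<union> Y) \<inter> Z = {}" "{a, b} \<inter> X = {}" using notin disj by auto
  then show ?thesis unfolding V_eq using ab by (simp add: sum.union_disjoint)
qed

lemma sum_deg: "(\<Sum>v\<in>V. deg v) = 2 * card X + 2 * card Y + 4 * card Z + 2 * card X * card Y"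
proof -
  have "nb a = X \<union> Z" "nb b = Y \<union> Z" by (auto simp: in_nb Ra Rb)
  then have "deg a = card X + card Z" "deg b = card Y + card Z" using disj by (simp_all add: card_Un_disjoint)
  moreover have "deg x = 1 + card Y" if "x \<in> X" for x
  proof -
    have "nb x = insert a Y" using that by (auto simp: in_nb RX)
    then show ?thesis using notin by simp
  qed
  moreover have "deg y = 1 + card X" if "y \<in> Y" for y
  proof -
    have "nb y = insert b X" using that by (auto simp: in_nb RY)
    then show ?thesis using notin by simp
  qed
  moreover have "deg z = 2" if "z \<in> Z" for z
  proof -
    have "nb z = {a, b}" using that by (auto simp: in_nb RZ)
    then show ?thesis using ab by simp
  qed
  ultimately show ?thesis unfolding sum_V by (simp add: algebra_simps)
qed

text \<open>By \<open>sum_deg\<close> this says that the degree sum of the whole graph is at least \<open>5 * card V - 1\<close>.\<close>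

definition "enough_blue \<longleftrightarrow> 9 + 3 * card X + 3 * card Y + card Z \<le> 2 * card X * card Y + (\<Sum>v\<in>V. blue_deg v)"

lemma enough_blueI:
  assumes "P \<subseteq> V" "\<And>v. v \<in> P \<Longrightarrow> 2 \<le> blue_deg v"
    and "7 + 2 * card X + 2 * card Y + card singles \<le> 2 * card X * card Y + card P"
  shows enough_blue
  using blue_deg_sum[OF assms(1,2)] assms(3) cards unfolding enough_blue_def by linarith

lemma enough_blue_edges:
  assumes enough_blue
  shows "5 * card V \<le> (\<Sum>v\<in>V. card {u. E v u}) + 1"
  using assms unfolding deg_blue_deg sum.distrib sum_deg enough_blue_def cards distrib_left by linarith

lemma cross_not_E: "u \<in> V \<Longrightarrow> l u \<noteq> l w \<Longrightarrow> \<not> R u w \<Longrightarrow> \<not> E u w"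
  using cross by blast

text \<open>The vertex with a third label is joined to \<open>z\<close> by a red edge, and
  \<open>a\<close> and \<open>b\<close> are the only red neighbours of \<open>z\<close>.\<close>

lemma third_label_Z:
  assumes "z \<in> Z" "p \<in> V" "p \<noteq> z" "l p \<noteq> l z" "\<not> R z p"
  shows "R a p \<and> l a \<noteq> l p \<and> l a \<noteq> l z \<or> R b p \<and> l b \<noteq> l p \<and> l b \<noteq> l z"
proof -
  have "\<not> E z p" using cross_not_E[OF in_V_classes(5)[OF assms(1)]] assms by metis
  then obtain u where u: "E z u" "E p u" "l u \<noteq> l z" "l u \<noteq> l p"
    using third_label[OF good in_V_classes(5)[OF assms(1)] assms(2)] assms(3) by metis
  then have "R z u" "R u p" using cross[of z u] cross[of p u] R_sym by auto
  then show ?thesis using RZ[OF assms(1)] u by auto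
qed

text \<open>Then \<open>{a, b, z}\<close> can be made a part. The vertices \<open>z\<close> and
  \<open>w\<close> have only \<open>a\<close> and \<open>b\<close> as common red neighbours, and
  both now share the label of \<open>z\<close>.\<close>

lemma no_part_ab:
  assumes part_ab: "part a \<subseteq> {a, b}" "part b \<subseteq> {a, b}"
    and z: "z \<in> Z" "w \<in> Z" "l z \<noteq> l w"
  shows False
proof -
  let ?K = "{a, b, z}"
  have zw: "z \<in> V" "w \<in> V" "w \<noteq> z" "w \<notin> ?K" using in_V_classes z notin by auto
  have "good_labelling V E (relabel ?K {})"
  proof (rule good_isolate)
    fix x y u assume x: "x \<in> ?K" "x \<in> V" and y: "y \<in> V" "y \<notin> ?K" and u: "u \<in> V" "u \<notin> ?K"
      and e: "l x = l y" "R x u" "R y u"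
    have "y \<in> part x" using y(1) e(1) by simp
    then have "x = z" using x part_ab y(2) by auto
    then show False using e(2) RZ[OF z(1)] u(2) by simp
  qed (simp_all add: card_insert_if)
  moreover have "\<not> E z w" using cross_not_E[OF zw(1) z(3)] RZ[OF z(1)] zw(4) by blast
  ultimately obtain u where u: "E z u" "E w u" "relabel ?K {} u \<noteq> relabel ?K {} z"
    "relabel ?K {} u \<noteq> relabel ?K {} w"
    using third_label[of "relabel ?K {}" z w] zw(1,2,3) by metis
  have uV: "u \<in> V" using u(1) E_V E_sym by blast
  have "u \<notin> ?K" using u(3) unfolding relabel_eq[OF uV zw(1)] by auto
  moreover have "l u \<noteq> l w" using u(4) zw(4) calculation unfolding relabel_eq[OF uV zw(2)] by auto
  then have "R w u" using cross[OF u(2)] by simp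
  ultimately show False using RZ[OF z(2)] by auto
qed

text \<open>Otherwise the red graph is complete bipartite between \<open>{a, b}\<close> and
  \<open>Z\<close>. A vertex of \<open>Z\<close> in the part of \<open>a\<close> would have a blue
  mate in \<open>Z\<close>, and \<open>a\<close> has the blue mate \<open>b\<close>: four vertices
  in one part. The same mate \<open>b\<close> handles the part of \<open>b\<close>, so
  \<open>no_part_ab\<close> applies.\<close>

lemma X_ne: "X \<noteq> {}"
proof
  assume "X = {}"
  then have Y: "Y = {}" and X: "X = {}" using XY_empty by auto
  have pa: "part a \<subseteq> {a, b}"
  proof
    fix m assume m: "m \<in> part a"
    show "m \<in> {a, b}"
    proof (rule ccontr)
      assume "m \<notin> {a, b}"
      then have mZ: "m \<in> Z" and mV: "m \<in> V" and "m \<noteq> a" using m in_V_iff[of m] X Y by simp_all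
      obtain p where p: "p \<in> part a" "p \<noteq> a" "\<not> R a p" using blue_mate[OF mV in_V_classes(1)] m \<open>m \<noteq> a\<close> by auto
      then have pb: "p = b" using Ra[of p] in_V_iff[of p] X Y by simp
      obtain q where q: "q \<in> part m" "q \<noteq> m" "\<not> R m q" using blue_mate[OF in_V_classes(1) mV] m \<open>m \<noteq> a\<close> by auto
      then have "q \<noteq> a" "q \<noteq> b" using RZ[OF mZ] by auto
      then have "{a, b, m, q} \<subseteq> part a" "card {a, b, m, q} = 4"
        using m p q pb in_V_classes ab mZ notin by (auto simp: card_insert_if)
      then have "4 \<le> card (part a)" using card_mono[OF finite_part] by metis
      then show False using card_part[of a] by simp
    qed
  qed
  have pb: "part b \<subseteq> {a, b}"
  proof
    fix m assume m: "m \<in> part b"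
    show "m \<in> {a, b}"
    proof (rule ccontr)
      assume n: "m \<notin> {a, b}"
      then have mZ: "m \<in> Z" and mV: "m \<in> V" and "m \<noteq> b" using m in_V_iff[of m] X Y by simp_all
      obtain p where p: "p \<in> part b" "p \<noteq> b" "\<not> R b p" using blue_mate[OF mV in_V_classes(2)] m \<open>m \<noteq> b\<close> by auto
      then have "p = a" using Rb[of p] in_V_iff[of p] X Y by simp
      then have "m \<in> part a" using p(1) m by simp
      then show False using pa n by blast
    qed
  qed
  have "4 \<le> card Z" using cards n18 X Y by simp
  moreover obtain z where "z \<in> Z" using Z_ne by blast
  ultimately obtain w where "w \<in> Z" "l w \<noteq> l z" using other_part[of Z "l z"] in_V_classes by blast
  then show False using no_part_ab[OF pa pb \<open>z \<in> Z\<close> \<open>w \<in> Z\<close>] by simp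
qed

text \<open>A third vertex \<open>p\<close> is not in \<open>Z\<close>, where both its mates
  \<open>a\<close> and \<open>b\<close> would be red neighbours. For any \<open>z\<close> in
  \<open>Z\<close>, the common neighbour of \<open>z\<close> and \<open>p\<close> with a third label
  would be \<open>a\<close> or \<open>b\<close>, which share the label of \<open>p\<close>.\<close>

lemma ab_same_part:
  assumes "l a = l b"
  shows "part a = {a, b}"
proof
  show "{a, b} \<subseteq> part a" using assms in_V_classes by simp
  show "part a \<subseteq> {a, b}"
  proof
    fix p assume p: "p \<in> part a"
    show "p \<in> {a, b}"
    proof (rule ccontr)
      assume n: "p \<notin> {a, b}"
      have pV: "p \<in> V" and lp: "l p = l a" using p by auto
      have part: "part a = {a, b, p}"
        by (rule part_eqI) (use p n assms in_V_classes ab in auto)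
      have "p \<notin> Z"
      proof
        assume pZ: "p \<in> Z"
        obtain q where q: "q \<in> part p" "q \<noteq> p" "\<not> R p q" using blue_mate[OF in_V_classes(1) pV] lp n by auto
        then have "q \<in> {a, b, p}" using part part_eq[OF lp] by blast
        then show False using q(2,3) RZ[OF pZ] by blast
      qed
      obtain z where z: "z \<in> Z" using Z_ne by blast
      have "z \<notin> part a" unfolding part using z notin \<open>p \<notin> Z\<close> by auto
      then have lz: "l z \<noteq> l a" using in_V_classes(5)[OF z] by simp
      have "\<not> R z p" using RZ[OF z] n by simp
      then have "l a \<noteq> l p \<or> l b \<noteq> l p" using third_label_Z[OF z pV] lz lp \<open>p \<notin> Z\<close> z by metis
      then show False using lp assms by simp
    qed
  qed
qed

text \<open>\<open>{a, b, s}\<close> can be made a part, since the neighbours of \<open>Y\<close>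
  are \<open>b\<close> and \<open>s\<close> and those of \<open>Z\<close> are \<open>a\<close> and
  \<open>b\<close>. Saturation then forces the edges from \<open>b\<close> to \<open>a\<close> and
  to \<open>s\<close>; neither is red, so all three lie in one old part, against
  \<open>ab_same_part\<close>.\<close>

lemma card_X_neq_1: "card X \<noteq> 1"
proof
  assume "card X = 1"
  then obtain s where s: "X = {s}" by (rule card_1_singletonE)
  let ?K = "{a, b, s}"
  have sX: "s \<in> X" using s by simp
  have V: "a \<in> V" "b \<in> V" "s \<in> V" using in_V_classes s by auto
  have g: "good_labelling V E (relabel ?K {})"
  proof (rule good_isolate)
    fix x y u assume x: "x \<in> ?K" "x \<in> V" and y: "y \<in> V" "y \<notin> ?K" and u: "u \<in> V" "u \<notin> ?K"
      and e: "l x = l y" "R x u" "R y u"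
    have "u \<in> Y \<or> u \<in> Z" using u in_V_iff[of u] s by simp
    then have "u \<in> Y" using RZ[of u y] R_sym[OF e(3)] y(2) by auto
    then show False using RY[of u y] R_sym[OF e(3)] y(2) s by auto
  qed (simp_all add: card_insert_if)
  have same: "relabel ?K {} x = relabel ?K {} y" if "x \<in> ?K" "y \<in> ?K" for x y
    using that V unfolding relabel_def by auto
  have adj: "E x y" if "x \<in> ?K" "y \<in> ?K" "x \<noteq> y" for x y
    using third_label[OF g _ _ that(3)] same[OF that(1,2)] that V by blast
  have "l a = l b" using cross[of a b] adj[of a b] ab Ra[of b] notin by auto
  moreover have "l s = l b" using cross[of s b] adj[of s b] RX[OF sX, of b] notin ab s by auto
  ultimately have "s \<in> part a" using V by simp
  then show False using ab_same_part[OF \<open>l a = l b\<close>] notin sX by auto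
qed

end

section \<open>Pentagons with \<open>a\<close> and \<open>b\<close> in different parts\<close>

locale wide_pentagon = pentagon +
  assumes X2: "2 \<le> card X" and Y2: "2 \<le> card Y" and Z4: "4 \<le> card Z" and l_ab: "l a \<noteq> l b"
begin

lemma swap_wide: "wide_pentagon V E l R b a Y X Z"
proof -
  interpret s: pentagon V E l R b a Y X Z by (rule swap)
  show ?thesis by unfold_locales (use X2 Y2 Z4 l_ab in simp_all)
qed

lemma not_E_ab: "\<not> E a b"
  using cross_not_E[OF in_V_classes(1) l_ab] Ra notin by blast

text \<open>As \<open>a\<close> and \<open>b\<close> are not adjacent, every regrouping that puts
  them together is refuted by this.\<close>

lemma not_same_label:
  assumes "good_labelling V E l'"
  shows "l' a \<noteq> l' b"
  by (rule third_label[OF assms in_V_classes(1,2) ab not_E_ab, THEN conjunct1])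

lemma other_Z: "\<exists>w\<in>Z. l w \<noteq> c"
  using other_part[OF _ Z4] in_V_classes by blast

lemma mate_a:
  assumes "m \<in> part a" "m \<noteq> a"
  shows "\<exists>p\<in>Y. p \<in> part a"
proof -
  have "m \<in> V" "l m = l a" using assms by auto
  then obtain p where p: "p \<in> part a" "p \<noteq> a" "\<not> R a p"
    using blue_mate[OF _ in_V_classes(1) assms(2)] by blast
  moreover have "p \<noteq> b" using p(1) l_ab by auto
  ultimately have "p \<in> Y" using Ra[of p] in_V_iff[of p] by simp
  then show ?thesis using p(1) by blast
qed

text \<open>A further vertex in the part of \<open>a\<close> forces a blue mate \<open>p\<close> of
  \<open>a\<close> in \<open>Y\<close>, so the part is \<open>{a, p, q}\<close>. Now
  \<open>q\<close> is a red neighbour of \<open>a\<close> and needs \<open>p\<close> as its blue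
  mate, which fails for \<open>q\<close> in \<open>X\<close>.\<close>

lemma part_a_X: "part a \<inter> X = {}" and part_a_Z: "q \<in> part a \<Longrightarrow> q \<in> Z \<Longrightarrow> \<exists>p\<in>Y. part a = {a, p, q}"
proof -
  have main: "q \<in> Z \<and> (\<exists>p\<in>Y. part a = {a, p, q})" if q: "q \<in> part a" "q \<in> X \<or> q \<in> Z" for q
  proof -
    have qa: "q \<noteq> a" "q \<in> V" "l q = l a" using q notin by auto
    obtain p where p: "p \<in> Y" "p \<in> part a" using mate_a[OF q(1) qa(1)] by blast
    have "p \<noteq> q" "p \<noteq> a" using p q disj notin by auto
    then have part: "part a = {a, p, q}"
      by (intro part_eqI) (use p q qa in_V_classes in auto)
    obtain m where m: "m \<in> part q" "m \<noteq> q" "\<not> R q m" using blue_mate[OF in_V_classes(1) qa(2)] qa by auto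
    have "R q a" using q(2) RX[of q a] RZ[of q a] by auto
    then have "m = p" using m part part_eq[OF qa(3)] by auto
    then have "q \<notin> X" using RX[of q p] m(3) p(1) by auto
    then show ?thesis using q(2) p(1) part by blast
  qed
  show "part a \<inter> X = {}"
  proof (rule ccontr)
    assume "part a \<inter> X \<noteq> {}"
    then obtain q where "q \<in> part a" "q \<in> X" by blast
    then show False using main[of q] disj by blast
  qed
  show "\<exists>p\<in>Y. part a = {a, p, q}" if "q \<in> part a" "q \<in> Z" using main[of q] that by blast
qed

text \<open>If the part is \<open>{a, p, q}\<close> with \<open>q\<close> in \<open>Z\<close>, no
  \<open>s\<close> in \<open>X\<close> can share the part of \<open>b\<close>: a third label between
  \<open>q\<close> and \<open>s\<close> could only be that of \<open>a\<close> or \<open>b\<close>.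
  So \<open>b\<close> is alone, and \<open>{a, b, p}\<close> can be made a part.\<close>

lemma part_a_Z_empty: "part a \<inter> Z = {}"
proof (rule ccontr)
  interpret s: wide_pentagon V E l R b a Y X Z by (rule swap_wide)
  assume "part a \<inter> Z \<noteq> {}"
  then obtain q where q: "q \<in> part a" "q \<in> Z" by blast
  then obtain p where p: "p \<in> Y" "part a = {a, p, q}" using part_a_Z by blast
  have qV: "q \<in> V" "l q = l a" using q by auto
  have no_X: "s \<notin> part b" if s: "s \<in> X" for s
  proof
    assume sb: "s \<in> part b"
    have "s \<noteq> q" "\<not> R q s" using s q disj RZ[OF q(2)] notin by auto
    moreover have "l s \<noteq> l q" using sb qV l_ab by auto
    moreover have "s \<notin> Y" "s \<notin> Z" using s disj by auto
    ultimately show False using third_label_Z[OF q(2) in_V_classes(3)[OF s]] Rb[of s] qV(2) by simp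
  qed
  have part_b: "part b = {b}"
  proof
    show "part b \<subseteq> {b}" using s.mate_a no_X by blast
    show "{b} \<subseteq> part b" using in_V_classes by simp
  qed
  let ?K = "{a, b, p}"
  have g: "good_labelling V E (relabel ?K {})"
  proof (rule good_isolate)
    fix x y u assume x: "x \<in> ?K" "x \<in> V" and y: "y \<in> V" "y \<notin> ?K" and u: "u \<in> V" "u \<notin> ?K"
      and e: "l x = l y" "R x u" "R y u"
    have "y \<notin> part b" unfolding part_b using y(2) by simp
    then have "x \<noteq> b" using y(1) e(1) by auto
    then have "x \<in> part a" using x(1) p(2) by auto
    then have "y \<in> part a" using e(1) y(1) by simp
    then have "y = q" using p(2) y(2) by auto
    then show False using e(3) RZ[OF q(2)] u(2) by auto
  qed (simp_all add: card_insert_if)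
  have "relabel ?K {} a = relabel ?K {} b" by (simp add: relabel_def)
  then show False using not_same_label[OF g] by simp
qed

lemma part_a_sub: "part a \<subseteq> insert a Y"
proof
  fix m assume m: "m \<in> part a"
  have "m \<noteq> b" using m l_ab by auto
  then show "m \<in> insert a Y" using m in_V_iff[of m] part_a_X part_a_Z_empty by auto
qed

lemma part_b_sub: "part b \<subseteq> insert b X" and part_b_Z_empty: "part b \<inter> Z = {}"
proof -
  interpret s: wide_pentagon V E l R b a Y X Z by (rule swap_wide)
  show "part b \<subseteq> insert b X" by (rule s.part_a_sub)
  show "part b \<inter> Z = {}" by (rule s.part_a_Z_empty)
qed

lemma blue_deg_part_a:
  assumes "card (part a) = 3" "v \<in> part a"
  shows "2 \<le> blue_deg v"
proof (rule blue_deg_2)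
  have e: "part v = part a" using part_eq[of v a] assms(2) by simp
  show "v \<in> V" "card (part v) = 3" using assms e by simp_all
  fix m assume "m \<in> part v"
  then have "m \<in> insert a Y" "v \<in> insert a Y" using part_a_sub e assms(2) by blast+
  then show "\<not> R v m" using Ra[of m] RY[of v m] disj notin ab by auto
qed

lemma blue_deg_part_b:
  assumes "card (part b) = 3" "v \<in> part b"
  shows "2 \<le> blue_deg v"
proof -
  interpret s: wide_pentagon V E l R b a Y X Z by (rule swap_wide)
  show ?thesis by (rule s.blue_deg_part_a[OF assms])
qed

text \<open>Every other vertex of \<open>Z\<close> is not adjacent to \<open>w\<close>, so its part
  has three vertices, as it could otherwise be merged with \<open>{w}\<close>. That part avoids
  \<open>a\<close> and \<open>b\<close>, which gives almost all of \<open>Z\<close> blue degree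
  two.\<close>

lemma enough_blue_of_outside_single:
  assumes w: "w \<in> singles" "w \<noteq> a" "w \<noteq> b"
  shows enough_blue
proof (rule enough_blueI)
  have wV: "w \<in> V" "part w = {w}" using w(1) unfolding singles_def by auto
  show "Z - {w} \<subseteq> V" using in_V_classes by auto
  show "2 \<le> blue_deg z" if z: "z \<in> Z - {w}" for z
  proof (rule blue_deg_2)
    show zV: "z \<in> V" using z in_V_classes by auto
    have "l z \<noteq> l w"
    proof
      assume "l z = l w"
      then have "z \<in> part w" using zV by simp
      then show False using wV z by simp
    qed
    have "\<not> R z w" using RZ[of z w] z w(2,3) by auto
    then have "\<not> E z w" using cross_not_E[OF zV \<open>l z \<noteq> l w\<close>] by blast
    then have "\<not> card (part z) + card (part w) \<le> 3" using small_parts_adjacent[OF zV wV(1)] z by blast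
    then show "card (part z) = 3" using wV(2) card_part[of z] by simp
    show "\<not> R z m" if m: "m \<in> part z" for m
    proof -
      have "z \<notin> part a" "z \<notin> part b" using z part_a_Z_empty part_b_Z_empty by auto
      then have "m \<noteq> a" "m \<noteq> b" using m zV by auto
      then show ?thesis using RZ[of z m] z by auto
    qed
  qed
  have "card Z \<le> card (Z - {w}) + 1" using Z4 by (simp add: card_Diff_singleton_if)
  moreover have "card singles \<le> 2" by (rule card_singles)
  moreover have "16 \<le> card X + card Y + card Z" using cards n18 by simp
  moreover have "3 * card X + 3 * card Y \<le> 2 * card X * card Y + 6"
  proof -
    obtain i j where i: "card X = i + 2" "card Y = j + 2" using X2 Y2 le_Suc_ex by (metis add.commute)
    show ?thesis unfolding i by (simp add: algebra_simps)
  qed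
  ultimately show "7 + 2 * card X + 2 * card Y + card singles \<le> 2 * card X * card Y + card (Z - {w})"
    by linarith
qed

text \<open>If \<open>a\<close> lies in a part of size at most two, a vertex of \<open>X\<close> could be moved into that part,
  unless doing so separates it from a vertex of \<open>X\<close>.\<close>

lemma X_mate:
  assumes small: "card (part a) \<le> 2" and t: "t \<in> X" "t \<notin> part b"
  shows "\<exists>t'\<in>X. t' \<noteq> t \<and> t' \<in> part t"
proof (rule ccontr)
  assume n: "\<not> ?thesis"
  let ?K = "insert t (part a)"
  have tV: "t \<in> V" using t in_V_classes by auto
  have "l t \<noteq> l a" using t(1) tV part_a_X by auto
  have lb: "l t \<noteq> l b" using t(2) tV by simp
  have g: "good_labelling V E (relabel ?K {})"
  proof (rule good_isolate)
    show "card ?K \<le> 3" using small by (simp add: card_insert_if)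
    fix x y u assume x: "x \<in> ?K" "x \<in> V" and y: "y \<in> V" "y \<notin> ?K" and u: "u \<in> V" "u \<notin> ?K"
      and e: "l x = l y" "R x u" "R y u"
    have "x = t" using x(1) y e(1) by auto
    have "u \<noteq> a" using u(2) in_V_classes by auto
    then have "u \<in> Y" using e(2) \<open>x = t\<close> RX[OF t(1)] by simp
    then have "y = b \<or> y \<in> X" using RY[of u y] R_sym[OF e(3)] by simp
    then have "y \<in> X" using e(1) \<open>x = t\<close> lb by auto
    moreover have "y \<in> part t" "y \<noteq> t" using e(1) \<open>x = t\<close> y by auto
    ultimately show False using n by blast
  qed simp
  \<comment> \<open>The only common red neighbour of \<open>t\<close> and \<open>w\<close> is
    \<open>a\<close>, which now has the label of \<open>t\<close>.\<close>
  obtain w where w: "w \<in> Z" "l w \<noteq> l t" using other_Z by blast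
  have "w \<notin> part a" using part_a_Z_empty w(1) by blast
  then have wV: "w \<in> V" "w \<noteq> t" "w \<notin> ?K" using w in_V_classes by auto
  have "\<not> R t w" using RX[OF t(1), of w] w(1) disj notin by auto
  then have "\<not> E t w" using cross_not_E[OF tV] w(2) by metis
  then obtain u where u: "E t u" "E w u" "relabel ?K {} u \<noteq> relabel ?K {} t" "relabel ?K {} u \<noteq> relabel ?K {} w"
    using third_label[OF g tV wV(1)] wV(2) by metis
  have uV: "u \<in> V" using E_V[OF E_sym[OF u(1)]] .
  have uK: "u \<notin> ?K" using u(3) unfolding relabel_eq[OF uV tV] by auto
  have "l u \<noteq> l w" using u(4) uK wV(3) unfolding relabel_eq[OF uV wV(1)] by auto
  then have "R w u" using cross[OF u(2)] by simp
  then have "u = b" using RZ[OF w(1)] uK in_V_classes by auto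
  then have "R t b" using cross[OF u(1)] lb by simp
  then show False using RX[OF t(1)] ab notin by auto
qed

lemma card_part_ab: "4 \<le> card (part a) + card (part b)"
  using small_parts_adjacent[OF in_V_classes(1,2) ab] not_E_ab by linarith

lemma card_part_a_Y: "card (part a) = 1 + card (part a \<inter> Y)"
proof -
  have "part a = insert a (part a \<inter> Y)" using part_a_sub in_V_classes by auto
  moreover have "a \<notin> part a \<inter> Y" using notin by simp
  ultimately show ?thesis by (metis card_insert_disjoint finite_Int finite_part plus_1_eq_Suc)
qed

lemma part_a_eq: "part a = insert a (part a \<inter> Y)"
  using part_a_sub in_V_classes by auto

lemma part_b_eq: "part b = insert b (part b \<inter> X)"
  using part_b_sub in_V_classes by auto

lemma card_part_b_X: "card (part b) = 1 + card (part b \<inter> X)"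
proof -
  interpret s: wide_pentagon V E l R b a Y X Z by (rule swap_wide)
  show ?thesis by (rule s.card_part_a_Y)
qed

lemma card_Y_split: "card Y = card (part a \<inter> Y) + card (Y - part a)"
proof -
  have "card ((part a \<inter> Y) \<union> (Y - part a)) = card (part a \<inter> Y) + card (Y - part a)"
    by (rule card_Un_disjoint) auto
  moreover have "(part a \<inter> Y) \<union> (Y - part a) = Y" by blast
  ultimately show ?thesis by simp
qed

lemma relabel_same: "x \<in> K \<Longrightarrow> y \<in> K \<Longrightarrow> relabel K K' x = relabel K K' y"
  by (simp add: relabel_def)

lemma relabel_other:
  "x \<notin> K \<Longrightarrow> x \<notin> K' \<Longrightarrow> y \<notin> K \<Longrightarrow> y \<notin> K' \<Longrightarrow> l x = l y \<Longrightarrow> relabel K K' x = relabel K K' y"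
  by (simp add: relabel_def)

text \<open>The parts are \<open>insert a Y\<close> and \<open>insert b X\<close>; they are
  regrouped as \<open>{a, b, p}\<close> and \<open>insert q X\<close>. All other vertices lie in
  \<open>Z\<close>, whose red neighbours \<open>a\<close> and \<open>b\<close> stay together, so the
  new labelling is good although \<open>a\<close> and \<open>b\<close> now agree.\<close>

lemma no_triples_if_X2_Y2:
  assumes "card (part a) = 3" "card (part b) = 3" "card X = 2" "card Y = 2"
  shows False
proof -
  have "part a \<inter> Y = Y" by (rule card_seteq) (use assms card_part_a_Y in auto)
  then have pa: "part a = insert a Y" using part_a_eq by simp
  have "part b \<inter> X = X" by (rule card_seteq) (use assms card_part_b_X in auto)
  then have pb: "part b = insert b X" using part_b_eq by simp
  obtain p q where Y: "Y = {p, q}" "p \<noteq> q" using assms(4) unfolding card_2_iff by auto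
  let ?K = "{a, b, p}" and ?K' = "insert q X"
  have all: "u \<in> ?K \<or> u \<in> ?K' \<or> u \<in> Z" if "u \<in> V" for u using that in_V_iff[of u] Y by auto
  have closed: "y \<in> ?K \<or> y \<in> ?K'" if "x \<in> ?K \<or> x \<in> ?K'" "l x = l y" "y \<in> V" for x y
  proof -
    have "x \<in> part a \<or> x \<in> part b" using that(1) pa pb Y(1) by auto
    then have "y \<in> part a \<or> y \<in> part b" using that(2,3) by auto
    then show ?thesis using pa pb Y(1) by auto
  qed
  have g: "good_labelling V E (relabel ?K ?K')"
  proof (rule good_isolate2)
    show "card ?K' \<le> 3" using assms(3) by (simp add: card_insert_if)
    show "?K \<inter> ?K' = {}" using Y notin disj by auto
    fix x y u assume V: "x \<in> V" "y \<in> V" "u \<in> V" and e: "l x = l y" "R x u" "R y u"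
    {
      assume "x \<in> ?K" "y \<notin> ?K" "u \<notin> ?K" "\<not> (y \<in> ?K' \<and> u \<in> ?K')"
      then have "u \<in> Z" using all[OF V(3)] closed[OF _ e(1) V(2)] by blast
      then show False using RZ[of u y] R_sym[OF e(3)] \<open>y \<notin> ?K\<close> by auto
    next
      assume x: "x \<in> ?K'" "y \<notin> ?K'" "u \<notin> ?K'" "\<not> (y \<in> ?K \<and> u \<in> ?K)"
      then have "u \<in> Z" using all[OF V(3)] closed[OF _ e(1) V(2)] by blast
      then have "x = a \<or> x = b" using RZ[of u x] R_sym[OF e(2)] by auto
      then show False using x(1) notin Y by auto
    }
  next
    fix x y u assume "x \<in> ?K" "y \<in> ?K'" and u: "u \<in> V" "u \<notin> ?K" "u \<notin> ?K'" "l x = l y" "l y = l u"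
    then show False using closed[of x u] by simp
  qed (simp_all add: card_insert_if)
  have "relabel ?K ?K' a = relabel ?K ?K' b" by (simp add: relabel_def)
  then show False using not_same_label[OF g] by simp
qed

text \<open>The vertices of \<open>Y\<close> outside the part of \<open>a\<close> join
  \<open>b\<close>, and those in the part of \<open>a\<close> join \<open>X\<close>. A vertex
  \<open>q\<close> of the first kind and a \<open>w\<close> in \<open>Z\<close> have only
  \<open>b\<close> as a common red neighbour, which now has the label of \<open>q\<close>.\<close>

lemma no_small_part_with_triple_X:
  assumes small: "card (part a) \<le> 2" and pb: "part b = insert b X" and X: "card X = 2"
    and Q: "card (Y - part a) \<le> 2"
  shows False
proof -
  let ?Q = "Y - part a" and ?P = "part a \<inter> Y"
  let ?K = "insert b ?Q" and ?K' = "X \<union> ?P"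
  have P1: "card ?P \<le> 1" using small card_part_a_Y by simp
  have lX: "l x = l b" if "x \<in> X" for x
  proof -
    have "x \<in> part b" using that pb by blast
    then show ?thesis by simp
  qed
  have lb: "u = b \<or> u \<in> X" if "u \<in> V" "l u = l b" for u
  proof -
    have "u \<in> part b" using that by simp
    then show ?thesis using pb by blast
  qed
  have la: "u = a \<or> u \<in> ?P" if "u \<in> V" "l u = l a" for u
  proof -
    have "u \<in> part a" using that by simp
    then show ?thesis using part_a_eq by blast
  qed
  have lP: "l u = l a" "u \<in> Y" if "u \<in> ?P" for u using that by auto
  have lQ: "l u \<noteq> l a" "u \<in> Y" if "u \<in> ?Q" for u using that in_V_classes(4)[of u] by auto
  have lQb: "l u \<noteq> l b" if "u \<in> ?Q" for u
    using lb[of u] in_V_classes(4)[of u] that notin disj by auto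
  have g: "good_labelling V E (relabel ?K ?K')"
  proof (rule good_isolate2)
    show "card ?K \<le> 3" using Q by (simp add: card_insert_if)
    show "card ?K' \<le> 3" using card_Un_le[of X ?P] X P1 by linarith
    show "?K \<inter> ?K' = {}" using notin disj by auto
    fix x y u assume V: "x \<in> V" "y \<in> V" "u \<in> V" and e: "l x = l y" "R x u" "R y u"
    note ux = R_sym[OF e(2)] and uy = R_sym[OF e(3)]
    {
      assume x: "x \<in> ?K" and y: "y \<notin> ?K" and u: "u \<notin> ?K" "\<not> (y \<in> ?K' \<and> u \<in> ?K')"
      show False
      proof (cases "x = b")
        case True
        then have yX: "y \<in> X" using lb[of y] V e(1) y by simp
        then have "u \<notin> X" "u \<notin> ?P" using u by auto
        then have "u \<in> Z" using Rb[of u] e(2) True u(1) by auto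
        then show False using RX[OF yX, of u] e(3) notin disj by auto
      next
        case False
        then have xQ: "x \<in> ?Q" using x by simp
        then have uX: "u \<in> X" using RY[OF lQ(2)[OF xQ], of u] e(2) u(1) by simp
        then have "y \<notin> ?P" using u by simp
        moreover have "y = a \<or> y \<in> Y" using RX[OF uX, of y] uy by simp
        ultimately show False using y lQ(1)[OF xQ] e(1) by auto
      qed
    next
      assume x: "x \<in> ?K'" and y: "y \<notin> ?K'" and u: "u \<notin> ?K'" "\<not> (y \<in> ?K \<and> u \<in> ?K)"
      show False
      proof (cases "x \<in> X")
        case True
        then have "y = b" using lb[of y] lX[OF True] V e(1) y by auto
        then have "u \<notin> ?K" using u by simp
        then have "u \<notin> Y" using u by auto
        then show False using \<open>y = b\<close> e(2,3) RX[OF True, of u] Rb[of u] notin by auto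
      next
        case False
        then have xP: "x \<in> ?P" using x by simp
        then have "y = a" using la[of y] lP(1)[OF xP] V e(1) y by auto
        then have "u \<in> X \<or> u \<in> Z" using Ra[of u] e(3) by simp
        then have uZ: "u \<in> Z" using u by simp
        then show False using RZ[OF uZ, of x] ux lP(2)[OF xP] notin by auto
      qed
    }
  next
    fix x y u assume x: "x \<in> ?K" and y: "y \<in> ?K'" and u: "u \<in> V" "u \<notin> ?K" "u \<notin> ?K'" "l x = l y" "l y = l u"
    show False
    proof (cases "x = b")
      case True
      then show False using lb[of u] u by simp
    next
      case False
      then have xQ: "x \<in> ?Q" using x by simp
      show False using lQ(1)[OF xQ] lQb[OF xQ] y lX[of y] lP(1)[of y] u(4) by auto
    qed
  qed simp_all
  have "card ?Q \<noteq> 0" using P1 Y2 card_Y_split by linarith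
  then have "?Q \<noteq> {}" by auto
  then obtain q where q: "q \<in> ?Q" by blast
  then have qV: "q \<in> V" "q \<in> Y" using in_V_classes by auto
  obtain w where w: "w \<in> Z" "l w \<noteq> l q" using other_Z by blast
  have wV: "w \<in> V" "w \<noteq> q" using w in_V_classes by auto
  have wK: "w \<notin> ?K" "w \<notin> ?K'" using w(1) notin disj by auto
  have "\<not> R q w" using RY[OF qV(2), of w] w(1) disj notin by auto
  then have "\<not> E q w" using cross_not_E[OF qV(1)] w(2) by metis
  then obtain u where u: "E q u" "E w u" "relabel ?K ?K' u \<noteq> relabel ?K ?K' q" "relabel ?K ?K' u \<noteq> relabel ?K ?K' w"
    using third_label[OF g qV(1) wV(1)] wV(2) by metis
  have uV: "u \<in> V" using E_V[OF E_sym[OF u(1)]] .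
  have qK: "q \<in> ?K" using q by simp
  have uK: "u \<notin> ?K" using u(3) relabel_same[OF _ qK] by blast
  show False
  proof (cases "l u = l w")
    case True
    then have "u \<in> ?K'" using u(4) relabel_other[OF uK _ wK] by blast
    then have "l w = l b \<or> l w = l a" using lX[of u] lP(1)[of u] True by auto
    then show False using lb[OF wV(1)] la[OF wV(1)] wK w(1) notin disj by auto
  next
    case False
    then have "R w u" using cross[OF u(2)] by simp
    then have "u = a" using RZ[OF w(1)] uK by auto
    then have "R q a" using cross[OF u(1)] lQ(1)[OF q] by simp
    then show False using RY[OF qV(2), of a] ab notin by simp
  qed
qed

text \<open>\<open>q\<close> is not adjacent to \<open>a\<close>, so its part has three vertices. A
  red neighbour of \<open>q\<close> in it would lie in \<open>X\<close> and bring a second vertex of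
  \<open>X\<close> along by \<open>X_mate\<close>; then \<open>q\<close> would have no blue
  mate.\<close>

lemma blue_deg_Y:
  assumes pa: "part a = {a}" and q: "q \<in> Y"
  shows "2 \<le> blue_deg q"
proof (rule blue_deg_2)
  show qV: "q \<in> V" using q in_V_classes by auto
  have "q \<notin> part a" "q \<noteq> a" using pa q notin by auto
  then have lq: "l q \<noteq> l a" using qV by simp
  have "\<not> E a q" using cross_not_E[OF in_V_classes(1), of q] lq Ra[of q] q disj by auto
  then have "\<not> card (part a) + card (part q) \<le> 3"
    using small_parts_adjacent[OF in_V_classes(1) qV] \<open>q \<noteq> a\<close> by blast
  then show c3: "card (part q) = 3" using pa card_part[of q] by simp
  fix m assume m: "m \<in> part q"
  show "\<not> R q m"
  proof
    assume r: "R q m"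
    have "q \<notin> part b" using part_b_sub q disj notin by blast
    then have lqb: "l q \<noteq> l b" using qV by simp
    then have mX: "m \<in> X" using RY[OF q, of m] r m by auto
    have "m \<notin> part b" using m lqb by auto
    then obtain m' where m': "m' \<in> X" "m' \<noteq> m" "m' \<in> part m"
      using X_mate[OF _ mX] pa by auto
    have "q \<noteq> m" "q \<noteq> m'" using q mX m'(1) disj by auto
    then have part: "part q = {q, m, m'}"
      by (intro part_eqI) (use m m' qV in auto)
    obtain k where k: "k \<in> part q" "k \<noteq> q" "\<not> R q k"
      using blue_mate[OF _ qV, of m] m \<open>q \<noteq> m\<close> by auto
    then have "k \<in> X" using part mX m'(1) by auto
    then show False using RY[OF q, of k] k(3) by simp
  qed
qed

text \<open>If the part of \<open>b\<close> contains \<open>X\<close>, then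
  \<open>card X = 2\<close> and \<open>no_small_part_with_triple_X\<close> leaves three vertices of
  \<open>Y\<close> outside the part of \<open>a\<close>. So \<open>card Y\<close> is at least
  \<open>4\<close> or \<open>3\<close>, according to whether the part of \<open>a\<close> has two
  vertices or one, which is just what the count needs. Otherwise \<open>X_mate\<close> raises
  \<open>card X\<close> to \<open>4\<close>.\<close>

lemma enough_blue_small_triple:
  assumes small: "card (part a) \<le> 2" and b3: "card (part b) = 3" and S: "singles \<subseteq> {a, b}"
  shows enough_blue
proof -
  have bS: "b \<notin> singles" using b3 unfolding singles_def by auto
  have part_a_cases: "card (part a) = 2 \<and> singles = {} \<or> part a = {a} \<and> singles \<subseteq> {a}"
  proof (cases "card (part a) = 2")
    case True
    then have "a \<notin> singles" unfolding singles_def by auto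
    then show ?thesis using True S bS by blast
  next
    case False
    then have "card (part a \<inter> Y) = 0" using card_part_a_Y small by linarith
    then have "part a \<inter> Y = {}" by simp
    then show ?thesis using part_a_eq S bS by auto
  qed
  have bX: "card (part b \<inter> X) = 2" using card_part_b_X b3 by simp
  have ge: "3 + card Y \<le> card (part b \<union> Y)"
  proof -
    have "part b \<inter> Y = {}" using part_b_sub disj notin by blast
    then show ?thesis using card_Un_disjoint[of "part b" Y] b3 by simp
  qed
  have V: "part b \<subseteq> V" "part b \<union> Y \<subseteq> V" using in_V_classes by auto
  have Y1: "enough_blue" if "part a = {a}" "singles \<subseteq> {a}"
    "7 + 2 * card X + 2 * card Y + 1 \<le> 2 * card X * card Y + 3 + card Y"
  proof (rule enough_blueI[OF V(2)])
    show "2 \<le> blue_deg v" if "v \<in> part b \<union> Y" for v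
      using that blue_deg_part_b[OF b3] blue_deg_Y[OF \<open>part a = {a}\<close>] by blast
    have "card singles \<le> 1" using card_mono[OF _ that(2)] by simp
    then show "7 + 2 * card X + 2 * card Y + card singles \<le> 2 * card X * card Y + card (part b \<union> Y)"
      using ge that(3) by linarith
  qed
  have Y2': "enough_blue" if "singles = {}" "7 + 2 * card X + 2 * card Y \<le> 2 * card X * card Y + 3"
    by (rule enough_blueI[OF V(1) blue_deg_part_b[OF b3]]) (use that b3 in simp_all)
  show ?thesis
  proof (cases "X \<subseteq> part b")
    case True
    then have pb: "part b = insert b X" using part_b_eq by blast
    have x2: "card X = 2" using bX True by (simp add: Int_absorb1)
    note card_Y_split
    moreover have "\<not> card (Y - part a) \<le> 2" using no_small_part_with_triple_X[OF small pb x2] by blast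
    ultimately have y: "card (part a \<inter> Y) + 3 \<le> card Y" by linarith
    then show ?thesis using part_a_cases card_part_a_Y Y1 Y2' unfolding x2 by auto
  next
    case False
    then obtain t where t: "t \<in> X" "t \<notin> part b" by blast
    obtain t' where t': "t' \<in> X" "t' \<noteq> t" "t' \<in> part t" using X_mate[OF small t] by blast
    have "t' \<notin> part b" using t t' in_V_classes by auto
    then have "card ((part b \<inter> X) \<union> {t, t'}) = 4"
      using t t' bX by (subst card_Un_disjoint) auto
    moreover have "card ((part b \<inter> X) \<union> {t, t'}) \<le> card X" using t t' by (intro card_mono) auto
    ultimately have "4 \<le> card X" by simp
    then obtain i j where ij: "card X = i + 4" "card Y = j + 2" using Y2 le_Suc_ex by (metis add.commute)
    have prod: "2 * card X * card Y = 2 * (i * j) + 4 * i + 8 * j + 16" unfolding ij by (simp add: algebra_simps)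
    have "7 + 2 * card X + 2 * card Y \<le> 2 * card X * card Y + 3"
      "7 + 2 * card X + 2 * card Y + 1 \<le> 2 * card X * card Y + 3 + card Y"
      using prod ij le0[of "i * j"] by linarith+
    then show ?thesis using part_a_cases Y1 Y2' by blast
  qed
qed

text \<open>Regrouping the three pairs as \<open>{a, b, s}\<close> and \<open>{p, t, t'}\<close>
  separates only \<open>a\<close> from \<open>p\<close>. Their common red neighbours lie in
  \<open>X\<close>, hence in one of the new parts, so the labelling stays good.\<close>

lemma no_pairs_with_paired_X:
  assumes pa: "part a = {a, p}" and pb: "part b = {b, s}" and pt: "part t = {t, t'}"
    and X: "X = {s, t, t'}" and p: "p \<in> Y" and d: "distinct [s, t, t']"
  shows False
proof -
  let ?K = "{a, b, s}" and ?K' = "{p, t, t'}"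
  have la: "u = a \<or> u = p" if "u \<in> V" "l u = l a" for u
  proof -
    have "u \<in> part a" using that by simp
    then show ?thesis using pa by blast
  qed
  have lb: "u = b \<or> u = s" if "u \<in> V" "l u = l b" for u
  proof -
    have "u \<in> part b" using that by simp
    then show ?thesis using pb by blast
  qed
  have lt: "u = t \<or> u = t'" if "u \<in> V" "l u = l t" for u
  proof -
    have "u \<in> part t" using that by simp
    then show ?thesis using pt by blast
  qed
  have "p \<in> part a" "s \<in> part b" "t' \<in> part t" using pa pb pt by blast+
  then have l: "l p = l a" "l s = l b" "l t' = l t" by simp_all
  have V: "a \<in> V" "b \<in> V" "p \<in> V" "s \<in> V" "t \<in> V" "t' \<in> V" using in_V_classes X p by auto
  have no: False if "u \<in> V" "R a u" "R p u" "u \<notin> ?K" "u \<notin> ?K'" for u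
  proof -
    have "u \<in> Z" using Ra[of u] that X by auto
    then show False using RY[OF p, of u] that(3) notin disj by auto
  qed
  have g: "good_labelling V E (relabel ?K ?K')"
  proof (rule good_isolate2)
    show "?K \<inter> ?K' = {}" using X p notin disj d by auto
    fix x y u assume xyu: "x \<in> V" "y \<in> V" "u \<in> V" and e: "l x = l y" "R x u" "R y u"
    {
      assume x: "x \<in> ?K" and y: "y \<notin> ?K" and u: "u \<notin> ?K" "\<not> (y \<in> ?K' \<and> u \<in> ?K')"
      have "x = a" using x lb[of y] xyu e(1) l y by auto
      then have "y = p" using la[of y] xyu e(1) y by auto
      then show False using no[OF xyu(3)] e \<open>x = a\<close> u by blast
    next
      assume x: "x \<in> ?K'" and y: "y \<notin> ?K'" and u: "u \<notin> ?K'" "\<not> (y \<in> ?K \<and> u \<in> ?K)"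
      have "x = p" using x lt[of y] xyu e(1) l y by auto
      then have "y = a" using la[of y] xyu e(1) l y by auto
      then show False using no[OF xyu(3)] e \<open>x = p\<close> u by blast
    }
  next
    fix x y u assume x: "x \<in> ?K" and y: "y \<in> ?K'" and u: "u \<in> V" "u \<notin> ?K" "u \<notin> ?K'" "l x = l y" "l y = l u"
    have "l u = l a \<or> l u = l b" using x u l by auto
    then show False using la[OF u(1)] lb[OF u(1)] u(2,3) by auto
  qed (simp_all add: card_insert_if)
  have "relabel ?K ?K' a = relabel ?K ?K' b" by (simp add: relabel_def)
  then show False using not_same_label[OF g] by simp
qed

lemma pair_parts_three_X:
  assumes a2: "card (part a) = 2" and b2: "card (part b) = 2"
  obtains s t t' where "part b = {b, s}" "{s, t, t'} \<subseteq> X" "distinct [s, t, t']" "t' \<in> part t" "t \<notin> part b"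
proof -
  have "card (part b \<inter> X) = 1" using card_part_b_X b2 by simp
  then obtain s where s: "part b \<inter> X = {s}" by (rule card_1_singletonE)
  have pb: "part b = {b, s}" using part_b_eq unfolding s .
  have "X \<noteq> {s}" using X2 by auto
  then obtain t where t: "t \<in> X" "t \<noteq> s" using s by blast
  then have tb: "t \<notin> part b" using s by blast
  obtain t' where t': "t' \<in> X" "t' \<noteq> t" "t' \<in> part t" using X_mate[OF _ t(1) tb] a2 by auto
  have "s \<in> part b" using s by blast
  then have "t' \<noteq> s" using t'(3) tb t(1) in_V_classes(3) by auto
  then show ?thesis using that[OF pb _ _ t'(3) tb] t t' s by auto
qed

text \<open>Both \<open>X\<close> and \<open>Y\<close> have at least three vertices, and the count
  fails only for \<open>3\<close> and \<open>3\<close>, by one. In that case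
  \<open>no_pairs_with_paired_X\<close> enlarges the part of \<open>t\<close> to three vertices, and
  \<open>t\<close> has blue degree two.\<close>

lemma enough_blue_pairs:
  assumes a2: "card (part a) = 2" and b2: "card (part b) = 2" and S: "singles \<subseteq> {a, b}"
  shows enough_blue
proof -
  interpret s: wide_pentagon V E l R b a Y X Z by (rule swap_wide)
  have "a \<notin> singles" "b \<notin> singles" using a2 b2 unfolding singles_def by auto
  then have S0: "singles = {}" using S by blast
  obtain s t t' where stt: "part b = {b, s}" "{s, t, t'} \<subseteq> X" "distinct [s, t, t']" "t' \<in> part t" "t \<notin> part b"
    by (rule pair_parts_three_X[OF a2 b2])
  obtain p r r' where prr: "part a = {a, p}" "{p, r, r'} \<subseteq> Y" "distinct [p, r, r']"
    by (rule s.pair_parts_three_X[OF b2 a2])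
  have tV: "t \<in> V" "t \<in> X" "t' \<in> X" using stt(2) in_V_classes by auto
  have "card {s, t, t'} = 3" "card {p, r, r'} = 3" using stt(3) prr(3) by auto
  then have x3: "3 \<le> card X" and y3: "3 \<le> card Y"
    using card_mono[OF _ stt(2)] card_mono[OF _ prr(2)] by simp_all
  obtain i j where ij: "card X = i + 3" "card Y = j + 3" using x3 y3 le_Suc_ex by (metis add.commute)
  have prod: "2 * card X * card Y = 2 * (i * j) + 6 * i + 6 * j + 18" unfolding ij by (simp add: algebra_simps)
  show ?thesis
  proof (cases "i = 0 \<and> j = 0")
    case False
    then have "7 + 2 * card X + 2 * card Y + card singles \<le> 2 * card X * card Y + card {}"
      using False prod ij le0[of "i * j"] unfolding S0 card.empty by linarith
    then show ?thesis by (rule enough_blueI[rotated 2]) simp_all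
  next
    case True
    then have "{s, t, t'} = X" using stt(2) \<open>card {s, t, t'} = 3\<close> ij by (intro card_seteq) auto
    then have X: "X = {s, t, t'}" by simp
    have "part t \<noteq> {t, t'}"
    proof
      assume "part t = {t, t'}"
      then show False using no_pairs_with_paired_X[OF prr(1) stt(1) _ X _ stt(3)] prr(2) by simp
    qed
    moreover have "{t, t'} \<subseteq> part t" using stt(4) tV by simp
    ultimately obtain m where m: "m \<in> part t" "m \<noteq> t" "m \<noteq> t'" by blast
    have part: "part t = {t, t', m}" by (rule part_eqI) (use m stt(3,4) tV in auto)
    have mV: "m \<in> V" "l m = l t" using m(1) by simp_all
    have "2 \<le> blue_deg t"
    proof (rule blue_deg_2[OF tV(1)])
      show "card (part t) = 3" using part m stt(3) by auto
      fix k assume k: "k \<in> part t"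
      show "\<not> R t k"
      proof
        assume r: "R t k"
        have "t \<notin> part a" using part_a_X tV(2) by blast
        then have "k \<noteq> a" using k tV(1) by auto
        then have "k \<in> Y" using RX[OF tV(2), of k] r by simp
        then have "k = m" using k part tV disj by auto
        then have mY: "m \<in> Y" using \<open>k \<in> Y\<close> by simp
        obtain g where g: "g \<in> part m" "g \<noteq> m" "\<not> R m g"
          using blue_mate[OF tV(1) mV(1)] m mV(2) by auto
        then have "g \<in> {t, t', m}" using part part_eq[OF mV(2)] by blast
        then show False using g(2,3) RY[OF mY, of g] tV by auto
      qed
    qed
    moreover have "7 + 2 * card X + 2 * card Y + card singles \<le> 2 * card X * card Y + card {t}"
      using True prod ij unfolding S0 by simp
    ultimately show ?thesis by (intro enough_blueI[of "{t}"]) (use tV in auto)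
  qed
qed

text \<open>The six vertices of the two parts have blue degree two. This fails to suffice only for
  \<open>card X = card Y = 2\<close>, by one, and \<open>no_triples_if_X2_Y2\<close> excludes that
  case.\<close>

lemma enough_blue_triples:
  assumes a3: "card (part a) = 3" and b3: "card (part b) = 3" and S: "singles \<subseteq> {a, b}"
  shows enough_blue
proof (rule enough_blueI)
  have "a \<notin> singles" "b \<notin> singles" using a3 b3 unfolding singles_def by auto
  then have S0: "singles = {}" using S by blast
  show "part a \<union> part b \<subseteq> V" by auto
  show "2 \<le> blue_deg v" if "v \<in> part a \<union> part b" for v
    using that blue_deg_part_a[OF a3] blue_deg_part_b[OF b3] by blast
  have "part a \<inter> part b = {}" using l_ab by auto
  then have c: "card (part a \<union> part b) = 6" using a3 b3 by (simp add: card_Un_disjoint)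
  obtain i j where ij: "card X = i + 2" "card Y = j + 2" using X2 Y2 le_Suc_ex by (metis add.commute)
  have prod: "2 * card X * card Y = 2 * (i * j) + 4 * i + 4 * j + 8" unfolding ij by (simp add: algebra_simps)
  have "\<not> (i = 0 \<and> j = 0)" using no_triples_if_X2_Y2[OF a3 b3] ij by auto
  then show "7 + 2 * card X + 2 * card Y + card singles \<le> 2 * card X * card Y + card (part a \<union> part b)"
    using prod ij le0[of "i * j"] unfolding S0 c card.empty by linarith
qed

lemma enough_blue: enough_blue
proof (cases "singles \<subseteq> {a, b}")
  case False
  then obtain w where "w \<in> singles" "w \<noteq> a" "w \<noteq> b" by blast
  then show ?thesis by (rule enough_blue_of_outside_single)
next
  case S: True
  interpret s: wide_pentagon V E l R b a Y X Z by (rule swap_wide)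
  have "{b, a} = {a, b}" by auto
  then have S': "singles \<subseteq> {b, a}" using S by simp
  have swapped: "s.enough_blue \<Longrightarrow> enough_blue"
    unfolding enough_blue_def s.enough_blue_def by (simp add: mult.commute mult.left_commute)
  note le = card_part[of a] card_part[of b] card_part_ab
  show ?thesis
  proof (cases "card (part b) = 3")
    case True
    show ?thesis
    proof (cases "card (part a) = 3")
      case True
      then show ?thesis using enough_blue_triples \<open>card (part b) = 3\<close> S by blast
    next
      case False
      then have "card (part a) \<le> 2" using le by linarith
      then show ?thesis using enough_blue_small_triple True S by blast
    qed
  next
    case False
    show ?thesis
    proof (cases "card (part a) = 3")
      case True
      have "card (part b) \<le> 2" using False le by linarith
      then show ?thesis using swapped s.enough_blue_small_triple[OF _ True S'] by blast
    next
      case a3: False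
      then have "card (part a) = 2" "card (part b) = 2" using False le by linarith+
      then show ?thesis using enough_blue_pairs S by blast
    qed
  qed
qed

end

context pentagon
begin

lemma edges_ge: "5 * card V \<le> (\<Sum>v\<in>V. card {u. E v u}) + 1"
proof (rule enough_blue_edges)
  interpret s: pentagon V E l R b a Y X Z by (rule swap)
  have "Y \<noteq> {}" using X_ne XY_empty by blast
  then have "card X \<noteq> 0" "card Y \<noteq> 0" using X_ne by simp_all
  then have X2: "2 \<le> card X" and Y2: "2 \<le> card Y" using card_X_neq_1 s.card_X_neq_1 by linarith+
  obtain i j where ij: "card X = i + 2" "card Y = j + 2" using X2 Y2 le_Suc_ex by (metis add.commute)
  have prod: "2 * card X * card Y = 2 * (i * j) + 4 * i + 4 * j + 8" unfolding ij by (simp add: algebra_simps)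
  show enough_blue
  \<comment> \<open>Here the product \<open>card X * card Y\<close> is large enough without any
    vertex of blue degree two; otherwise \<open>X\<close> and \<open>Y\<close> have at most eight
    vertices together and \<open>Z\<close> is large.\<close>
  proof (cases "i + j \<ge> 5")
    case True
    have "7 + 2 * card X + 2 * card Y + card singles \<le> 2 * card X * card Y + card {}"
      using True card_singles prod ij le0[of "i * j"] unfolding card.empty by linarith
    then show ?thesis by (rule enough_blueI[rotated 2]) simp_all
  next
    case False
    then have Z4: "4 \<le> card Z" using cards n18 unfolding ij by linarith
    show ?thesis
    proof (cases "l a = l b")
      case True
      have pa: "part a = {a, b}" by (rule ab_same_part[OF True])
      then have pb: "part b = {a, b}" using part_eq[OF True] by simp
      obtain z where z: "z \<in> Z" using Z_ne by blast
      obtain w where "w \<in> Z" "l w \<noteq> l z" using other_part[of Z "l z"] Z4 in_V_classes by blast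
      then show ?thesis using no_part_ab[of z w] pa pb z by simp
    next
      case False
      interpret w: wide_pentagon V E l R a b X Y Z by unfold_locales (use X2 Y2 Z4 False in simp_all)
      show ?thesis by (rule w.enough_blue)
    qed
  qed
qed

end

section \<open>The lower bound\<close>

context red_coloured
begin

lemma red_degree_pos:
  assumes v: "v \<in> V"
  shows "deg v \<noteq> 0"
proof
  assume "deg v = 0"
  then have no: "\<not> R v z" for z by (metis card_0_eq empty_iff finite_nb in_nb)
  have "\<not> V \<subseteq> {v}" using n18 card_mono[of "{v}" V] by auto
  then obtain u where "u \<in> V" "u \<noteq> v" by blast
  then show False using common_nb[OF v, of u] no by blast
qed

text \<open>The only neighbour \<open>a\<close> of \<open>v\<close> would be adjacent to all other
  vertices, so the red graph would be a star. With \<open>{a, v}\<close> made a part,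
  \<open>v\<close> and a vertex \<open>w\<close> of another part have no common neighbour with a
  third label.\<close>

lemma red_degree_neq_1:
  assumes v: "v \<in> V"
  shows "deg v \<noteq> 1"
proof
  assume "deg v = 1"
  then obtain a where a: "nb v = {a}" by (rule card_1_singletonE)
  have Rv: "R v u \<longleftrightarrow> u = a" for u using a in_nb[of u v] by simp
  have va: "v \<noteq> a" "a \<in> V" using Rv[of a] irrefl[of v] in_V[OF sym[of v a]] by auto
  have hub: "R a u" if "u \<in> V" "u \<noteq> v" "u \<noteq> a" for u
    using common_nb[OF v that(1)] that Rv sym by metis
  have "4 \<le> card (V - {a})" using n18 va(2) by simp
  then obtain w where w: "w \<in> V" "w \<noteq> a" "l w \<noteq> l v" using other_part[of "V - {a}" "l v"] by auto
  let ?K = "{a, v}"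
  have g: "good_labelling V E (relabel ?K {})"
  proof (rule good_isolate)
    fix x y u assume x: "x \<in> ?K" and V: "y \<in> V" "u \<in> V" and n: "y \<notin> ?K" "u \<notin> ?K" and e: "R x u" "R y u"
    have "R a y" "R a u" using hub V n by auto
    then show False using triangle_free[of a y u] e(2) by blast
  qed (use va in auto)
  have "w \<noteq> v" using w(3) by blast
  have "\<not> E v w" using cross[of v w] w Rv by metis
  then obtain u where u: "E v u" "E w u" "relabel ?K {} u \<noteq> relabel ?K {} v" "relabel ?K {} u \<noteq> relabel ?K {} w"
    using third_label[OF g v w(1)] \<open>w \<noteq> v\<close> by metis
  have "u \<in> V" using E_V[OF E_sym[OF u(1)]] .
  have uK: "u \<notin> ?K" using u(3) unfolding relabel_def by auto
  have "l u \<noteq> l w" using u(4) uK \<open>w \<noteq> v\<close> w(2) unfolding relabel_def by auto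
  then have "R w u" using cross[OF u(2)] by simp
  moreover have "R a w" "R a u" using hub w \<open>w \<noteq> v\<close> uK \<open>u \<in> V\<close> by auto
  ultimately show False using triangle_free[of a w u] by blast
qed

text \<open>Every other vertex shares a neighbour with \<open>v\<close>, so it sees \<open>a\<close>
  or \<open>b\<close>, and the classes record which; \<open>v\<close> itself lies in the last one. A
  missing edge between the first two classes would need a common neighbour, which also sees
  \<open>a\<close> or \<open>b\<close> and so closes a triangle.\<close>

lemma degree_2_pentagon:
  assumes v: "v \<in> V" and v2: "nb v = {a, b}" "a \<noteq> b"
  shows "pentagon V E l R a b {u. R a u \<and> \<not> R b u} {u. R b u \<and> \<not> R a u} {u. R a u \<and> R b u}"
proof -
  have Rv: "R v u \<longleftrightarrow> u = a \<or> u = b" for u using v2(1) in_nb[of u v] by simp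
  have nab: "\<not> R a b" "\<not> R b a" using triangle_free[of v a b] Rv sym by blast+
  have Rva: "R a v" "R b v" using Rv sym by blast+
  have near: "R a u \<or> R b u" if "u \<in> V" "u \<noteq> a" "u \<noteq> b" for u
  proof (cases "u = v")
    case False
    then show ?thesis using common_nb[OF v that(1)] Rv that sym by metis
  qed (use Rva in simp)
  have tri: False if "R x y" "R c x" "R c y" for c x y using triangle_free[OF that(2,1)] that(3) by blast
  have complete: "R x y" if "R a x" "\<not> R b x" "R b y" "\<not> R a y" for x y
  proof (rule ccontr)
    assume "\<not> R x y"
    moreover have "x \<in> V" "y \<in> V" "x \<noteq> y" using that in_V[OF sym] by auto
    ultimately obtain z where z: "R x z" "R y z" using common_nb by blast
    have "z \<noteq> a" "z \<noteq> b" using z that sym by blast+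
    then have "R a z \<or> R b z" using near in_V[OF sym[OF z(1)]] by blast
    then show False using tri[OF z(1) that(1)] tri[OF z(2) that(3)] by blast
  qed
  have nbXY: "R u w \<Longrightarrow> R a u \<Longrightarrow> w \<noteq> a \<Longrightarrow> w \<noteq> b \<Longrightarrow> R b w \<and> \<not> R a w"
    "R u w \<Longrightarrow> R b u \<Longrightarrow> w \<noteq> a \<Longrightarrow> w \<noteq> b \<Longrightarrow> R a w \<and> \<not> R b w" for u w
    using near[of w] tri in_V[OF sym] by blast+
  have nbZ: "w = a \<or> w = b" if "R u w" "R a u" "R b u" for u w
    using nbXY[OF that(1)] that by blast
  show ?thesis
  proof unfold_locales
    show "V = {a, b} \<union> {u. R a u \<and> \<not> R b u} \<union> {u. R b u \<and> \<not> R a u} \<union> {u. R a u \<and> R b u}"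
    proof
      show "V \<subseteq> {a, b} \<union> {u. R a u \<and> \<not> R b u} \<union> {u. R b u \<and> \<not> R a u} \<union> {u. R a u \<and> R b u}"
        using near by blast
      have "a \<in> V" "b \<in> V" using Rva in_V by blast+
      then show "{a, b} \<union> {u. R a u \<and> \<not> R b u} \<union> {u. R b u \<and> \<not> R a u} \<union> {u. R a u \<and> R b u} \<subseteq> V"
        using in_V[OF sym] by blast
    qed
    show "R x u \<longleftrightarrow> u = a \<or> u \<in> {u. R b u \<and> \<not> R a u}" if x: "x \<in> {u. R a u \<and> \<not> R b u}" for x u
    proof
      assume r: "R x u"
      have "u \<noteq> b" using r x sym by blast
      then show "u = a \<or> u \<in> {u. R b u \<and> \<not> R a u}" using nbXY(1)[OF r] x by blast
    qed (use x complete sym in blast)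
    show "R y u \<longleftrightarrow> u = b \<or> u \<in> {u. R a u \<and> \<not> R b u}" if y: "y \<in> {u. R b u \<and> \<not> R a u}" for y u
    proof
      assume r: "R y u"
      have "u \<noteq> a" using r y sym by blast
      then show "u = b \<or> u \<in> {u. R a u \<and> \<not> R b u}" using nbXY(2)[OF r] y by blast
    qed (use y complete sym in blast)
    show "R z u \<longleftrightarrow> u = a \<or> u = b" if z: "z \<in> {u. R a u \<and> R b u}" for z u
      using nbZ[of z u] z sym by blast
    show "{u. R a u \<and> R b u} \<noteq> {}" using Rva by blast
    show "{u. R a u \<and> \<not> R b u} = {} \<longleftrightarrow> {u. R b u \<and> \<not> R a u} = {}"
    proof -
      have "\<exists>x. R c x \<and> \<not> R d x" if y: "R d y" "\<not> R c y" and cd: "c = a \<and> d = b \<or> c = b \<and> d = a" for c d y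
      proof -
        have V: "y \<in> V" "c \<in> V" using in_V[OF sym[OF y(1)]] cd Rva in_V by blast+
        have "y \<noteq> c" using y cd nab by blast
        then obtain z where z: "R y z" "R c z" using common_nb[OF V] y sym by blast
        then have "\<not> R d z" using tri[OF z(1) y(1)] by blast
        then show ?thesis using z by blast
      qed
      then show ?thesis by blast
    qed
  qed (use v2(2) nab irrefl in auto)
qed

lemma saturated_degree_sum: "5 * card V \<le> (\<Sum>v\<in>V. card {u. E v u}) + 1"
proof (cases "\<forall>v\<in>V. 3 \<le> deg v")
  case True
  then have "4 * card V + 1 \<le> (\<Sum>v\<in>V. deg v)" using min_degree_3_sum n18 by blast
  moreover have "card V \<le> (\<Sum>v\<in>V. blue_deg v) + card singles"
    using blue_deg_sum[of "{}"] by simp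
  moreover note card_singles
  ultimately show ?thesis unfolding deg_blue_deg sum.distrib by linarith
next
  case False
  then obtain v where v: "v \<in> V" "\<not> 3 \<le> deg v" by blast
  then have "deg v = 2" using red_degree_pos[OF v(1)] red_degree_neq_1[OF v(1)] by linarith
  then obtain a b where "nb v = {a, b}" "a \<noteq> b" unfolding card_2_iff by blast
  then interpret pentagon V E l R a b "{u. R a u \<and> \<not> R b u}" "{u. R b u \<and> \<not> R a u}" "{u. R a u \<and> R b u}"
    by (rule degree_2_pentagon[OF v(1)])
  show ?thesis by (rule edges_ge)
qed

end

context saturated_graph
begin

text \<open>Both choices are maxima of bounded quantities: first the number of labels, then the
  number of red pairs. A blue edge whose ends have no common red neighbour could be added to
  \<open>R\<close>.\<close>

lemma red_colouring_exists:
  assumes "good_labelling V E l0"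
  shows "\<exists>l R. red_coloured V E l R"
proof -
  have "\<exists>l. good_labelling V E l \<and> (\<forall>l'. good_labelling V E l' \<longrightarrow> card (l' ` V) \<le> card (l ` V))"
    by (rule ex_has_greatest_nat[of _ l0 _ "Suc (card V)"])
      (use assms card_image_le[OF fin] in \<open>auto simp: less_Suc_eq_le\<close>)
  then obtain l where l: "good_labelling V E l" "\<And>l'. good_labelling V E l' \<Longrightarrow> card (l' ` V) \<le> card (l ` V)" by blast
  define P where "P R \<longleftrightarrow> (\<forall>x y. R x y \<longrightarrow> E x y) \<and> (\<forall>x y. E x y \<longrightarrow> l x \<noteq> l y \<longrightarrow> R x y) \<and>
    (\<forall>x y. R x y \<longrightarrow> R y x) \<and> (\<forall>x y z. R x y \<longrightarrow> R y z \<longrightarrow> \<not> R x z)" for R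
  define f where "f R = card {(x, y). R x y}" for R :: "'a \<Rightarrow> 'a \<Rightarrow> bool"
  have sub: "{(x, y). R x y} \<subseteq> V \<times> V" if "P R" for R
  proof -
    have "x \<in> V \<and> y \<in> V" if "R x y" for x y
    proof -
      have "E x y" using \<open>P R\<close> that unfolding P_def by blast
      then show ?thesis using E_V[of x y] E_V[OF E_sym[of x y]] by blast
    qed
    then show ?thesis by auto
  qed
  have finR: "finite {(x, y). R x y}" if "P R" for R
    by (rule finite_subset[OF sub[OF that]]) (use fin in simp)
  have "P (\<lambda>x y. E x y \<and> l x \<noteq> l y)"
  proof -
    have s: "E y x \<and> l y \<noteq> l x" if "E x y \<and> l x \<noteq> l y" for x y using that E_sym[of x y] by auto
    have t: "\<not> (E x z \<and> l x \<noteq> l z)" if "E x y \<and> l x \<noteq> l y" "E y z \<and> l y \<noteq> l z" for x y z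
      using that l(1)[unfolded good_labelling_def, THEN conjunct2, rule_format, of x y z] by blast
    show ?thesis unfolding P_def
    proof (intro conjI)
      show "\<forall>x y. E x y \<and> l x \<noteq> l y \<longrightarrow> E y x \<and> l y \<noteq> l x" using s by blast
      show "\<forall>x y z. E x y \<and> l x \<noteq> l y \<longrightarrow> E y z \<and> l y \<noteq> l z \<longrightarrow> \<not> (E x z \<and> l x \<noteq> l z)"
        using t by blast
    qed simp_all
  qed
  moreover have "f R \<le> card (V \<times> V)" if "P R" for R
    unfolding f_def by (rule card_mono[OF _ sub[OF that]]) (use fin in simp)
  ultimately have "\<exists>R. P R \<and> (\<forall>R'. P R' \<longrightarrow> f R' \<le> f R)"
    by (intro ex_has_greatest_nat[of P _ f "Suc (card (V \<times> V))"]) (simp_all add: less_Suc_eq_le)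
  then obtain R where R: "P R" "\<And>R'. P R' \<Longrightarrow> f R' \<le> f R" by blast
  note P = R(1)[unfolded P_def]
  note RE = P[THEN conjunct1, rule_format]
    and cross = P[THEN conjunct2, THEN conjunct1, rule_format]
    and sym = P[THEN conjunct2, THEN conjunct2, THEN conjunct1, rule_format]
    and tri = P[THEN conjunct2, THEN conjunct2, THEN conjunct2, rule_format]
  have "red_coloured V E l R"
  proof unfold_locales
    fix x y assume xy: "E x y" "\<not> R x y"
    show "\<exists>z. R x z \<and> R y z"
    proof (rule ccontr)
      assume no: "\<nexists>z. R x z \<and> R y z"
      define R' where "R' p q \<longleftrightarrow> R p q \<or> p = x \<and> q = y \<or> p = y \<and> q = x" for p q
      have "x \<noteq> y" using xy E_irrefl by blast
      have irr: "\<not> R p p" for p using tri[of p p p] by blast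
      have "\<not> R' p r" if "R' p q" "R' q r" for p q r
        using that no irr sym tri \<open>x \<noteq> y\<close> unfolding R'_def by metis
      moreover have "R' p q \<longrightarrow> E p q" "R' p q \<longrightarrow> R' q p" "E p q \<longrightarrow> l p \<noteq> l q \<longrightarrow> R' p q" for p q
        using RE[of p q] cross[of p q] sym[of p q] xy E_sym[of x y] unfolding R'_def by blast+
      ultimately have "P R'" unfolding P_def by blast
      moreover have "{(x, y). R x y} \<subset> {(x, y). R' x y}" using xy unfolding R'_def by auto
      then have "f R < f R'" unfolding f_def by (intro psubset_card_mono finR[OF \<open>P R'\<close>])
      ultimately show False using R(2)[of R'] by simp
    qed
  qed (rule l RE cross sym tri; assumption)+
  then show ?thesis by blast
qed

end

lemma simple_graph_degree_sum:
  assumes G: "simple_graph G"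
  shows "(\<Sum>v\<in>verts G. card {u. adj G v u}) = 2 * card (edges G)"
proof -
  have fin: "finite (verts G)" "finite (edges G)" using G finite_edges unfolding simple_graph_def by blast+
  have "card {u. adj G v u} = card {e \<in> edges G. v \<in> e}" for v
  proof (rule bij_betw_same_card[of "\<lambda>u. {v, u}"])
    show "bij_betw (\<lambda>u. {v, u}) {u. adj G v u} {e \<in> edges G. v \<in> e}"
    proof (rule bij_betwI')
      show "\<exists>u\<in>{u. adj G v u}. e = {v, u}" if e: "e \<in> {e \<in> edges G. v \<in> e}" for e
      proof -
        have "card e = 2" using e G unfolding simple_graph_def by blast
        then obtain p q where "e = {p, q}" unfolding card_2_iff by blast
        then show ?thesis using e by (auto simp: insert_commute)
      qed
    qed (auto simp: doubleton_eq_iff)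
  qed
  moreover have "card {e \<in> edges G. v \<in> e} = (\<Sum>e\<in>edges G. if v \<in> e then 1 else 0)" for v
    unfolding card_eq_sum by (rule sum.inter_filter[OF fin(2)])
  ultimately have "(\<Sum>v\<in>verts G. card {u. adj G v u}) = (\<Sum>v\<in>verts G. \<Sum>e\<in>edges G. if v \<in> e then 1 else 0)"
    by (simp only:)
  also have "\<dots> = (\<Sum>e\<in>edges G. \<Sum>v\<in>verts G. if v \<in> e then 1 else 0)" by (rule sum.swap)
  also have "\<dots> = (\<Sum>e\<in>edges G. 2)"
  proof (rule sum.cong[OF refl])
    fix e assume "e \<in> edges G"
    then have "e \<subseteq> verts G" "card e = 2" using G unfolding simple_graph_def by blast+
    then show "(\<Sum>v\<in>verts G. if v \<in> e then 1 else 0) = (2::nat)"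
      using fin by (simp add: sum.If_cases Int_absorb1)
  qed
  finally show ?thesis by simp
qed

lemma add_edge_adj: "adj (add_edge G {u, v}) x y \<longleftrightarrow> adj G x y \<or> x = u \<and> y = v \<or> x = v \<and> y = u"
  unfolding add_edge_def by (auto simp: doubleton_eq_iff)

theorem saturated_lower_bound:
  fixes G :: "nat graph"
  assumes "saturated (R_min {complete_graph 3} (trees 4)) G" and n: "18 \<le> card (verts G)"
  shows "5 * card (verts G) \<le> 2 * card (edges G) + 1"
proof -
  have G: "simple_graph G" and ex: "\<exists>l. good_labelling (verts G) (adj G) l"
    and add: "\<And>e l. e \<in> complement_edges G \<Longrightarrow> \<not> good_labelling (verts G) (adj (add_edge G e)) l"
    using assms(1) unfolding saturated_iff_good_labelling by blast+
  interpret saturated_graph "verts G" "adj G"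
  proof
    show "finite (verts G)" using G unfolding simple_graph_def by blast
    show "x \<in> verts G" if "adj G x y" for x y using adjD[OF G that] by blast
    show "adj G y x" if "adj G x y" for x y using that by (simp add: insert_commute)
    show "\<not> adj G x x" for x using adjD(3)[OF G] by blast
    show "18 \<le> card (verts G)" by (rule n)
    fix l u v assume l: "good_labelling (verts G) (adj G) l" and uv: "u \<in> verts G" "v \<in> verts G" "u \<noteq> v" "\<not> adj G u v"
    have "{u, v} \<in> complement_edges G" using uv unfolding complement_edges_def by auto
    then have "\<not> good_labelling (verts G) (adj (add_edge G {u, v})) l" by (rule add)
    then obtain x y z where t: "adj (add_edge G {u, v}) x y" "adj (add_edge G {u, v}) y z"
      "adj (add_edge G {u, v}) x z" and d: "l x \<noteq> l y" "l y \<noteq> l z" "l x \<noteq> l z"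
      using l unfolding good_labelling_def by blast
    have comm: "adj G p q \<Longrightarrow> adj G q p" "adj (add_edge G {u, v}) p q \<Longrightarrow> adj (add_edge G {u, v}) q p" for p q
      by (simp_all add: insert_commute)
    have "\<not> (adj G x y \<and> adj G y z \<and> adj G x z)" using l d unfolding good_labelling_def by blast
    \<comment> \<open>The triangle contains the new edge; whichever side that is, the opposite
      vertex is the required one.\<close>
    then consider "\<not> adj G x y" | "\<not> adj G y z" | "\<not> adj G x z" by blast
    moreover have "l u \<noteq> l v \<and> (\<exists>z. adj G u z \<and> adj G v z \<and> l z \<noteq> l u \<and> l z \<noteq> l v)"
      if "\<not> adj G p q" "adj (add_edge G {u, v}) p q" "adj (add_edge G {u, v}) p r" "adj (add_edge G {u, v}) q r"
        "l p \<noteq> l q" "l p \<noteq> l r" "l q \<noteq> l r" for p q r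
    proof -
      have pq: "p = u \<and> q = v \<or> p = v \<and> q = u" using that(1,2) unfolding add_edge_adj by blast
      then have "r \<noteq> u" "r \<noteq> v" using that(6,7) by auto
      then have "adj G p r" "adj G q r" using that(3,4) unfolding add_edge_adj by blast+
      then show ?thesis using pq that(5-7) by metis
    qed
    ultimately show "l u \<noteq> l v \<and> (\<exists>z. adj G u z \<and> adj G v z \<and> l z \<noteq> l u \<and> l z \<noteq> l v)"
      using t d d[symmetric] t[THEN comm(2)] by cases metis+
  qed
  obtain l R where "red_coloured (verts G) (adj G) l R" using red_colouring_exists ex by blast
  then interpret red_coloured "verts G" "adj G" l R .
  show ?thesis using saturated_degree_sum unfolding simple_graph_degree_sum[OF G] .
qed

section \<open>The extremal graph\<close>

text \<open>The red graph is a blown-up pentagon with classes \<open>{0}\<close>, \<open>{4..<m}\<close>, \<open>{1, 2}\<close>, \<open>{3}\<close>, \<open>{m..<n}\<close>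
  in cyclic order, where \<open>m\<close> is \<open>7\<close> for even and \<open>8\<close> for odd \<open>n\<close>. The blue components are
  \<open>{0, 1, 2}\<close>, then \<open>{3, 4, 5}\<close> if \<open>n\<close> is even, and consecutive pairs.\<close>

definition red_pair :: "nat \<Rightarrow> nat \<Rightarrow> nat \<Rightarrow> bool" where
  "red_pair n i j \<longleftrightarrow> i = 0 \<and> 4 \<le> j \<or> (i = 1 \<or> i = 2) \<and> 3 \<le> j \<and> j < (if even n then 7 else 8)
     \<or> i = 3 \<and> (if even n then 7 else 8) \<le> j"

definition blue_part :: "nat \<Rightarrow> nat \<Rightarrow> nat" where
  "blue_part n i = (if i < 3 then 0 else if even n then (if i < 6 then 1 else i div 2) else Suc i div 2)"

definition extremal_adj :: "nat \<Rightarrow> nat \<Rightarrow> nat \<Rightarrow> bool" where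
  "extremal_adj n i j \<longleftrightarrow> i < n \<and> j < n \<and> i \<noteq> j \<and>
     (blue_part n i = blue_part n j \<or> red_pair n i j \<or> red_pair n j i)"

definition extremal_graph :: "nat \<Rightarrow> nat graph" where
  "extremal_graph n = ({..<n}, {{i, j} | i j. extremal_adj n i j})"

lemma extremal_adj_sym: "extremal_adj n i j \<Longrightarrow> extremal_adj n j i"
  unfolding extremal_adj_def by auto

lemma adj_extremal_graph [simp]: "adj (extremal_graph n) i j \<longleftrightarrow> extremal_adj n i j"
  unfolding extremal_graph_def using extremal_adj_sym by (auto simp: doubleton_eq_iff)

lemma verts_extremal_graph [simp]: "verts (extremal_graph n) = {..<n}"
  by (simp add: extremal_graph_def)

lemma simple_extremal_graph: "simple_graph (extremal_graph n)"
  unfolding simple_graph_def extremal_graph_def by (auto simp: extremal_adj_def)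

lemma red_pair_less: "red_pair n i j \<Longrightarrow> i < j"
  unfolding red_pair_def by (auto split: if_splits)

lemma red_pair_triangle_free: "red_pair n x y \<Longrightarrow> red_pair n y z \<Longrightarrow> \<not> red_pair n x z"
  unfolding red_pair_def by (auto split: if_splits)

lemma red_triangle_free:
  assumes "red_pair n x y \<or> red_pair n y x" "red_pair n y z \<or> red_pair n z y"
  shows "\<not> (red_pair n x z \<or> red_pair n z x)"
proof -
  note t = red_pair_triangle_free[of n x y z] red_pair_triangle_free[of n x z y]
    red_pair_triangle_free[of n y x z] red_pair_triangle_free[of n y z x]
    red_pair_triangle_free[of n z x y] red_pair_triangle_free[of n z y x]
  note l = red_pair_less[of n x y] red_pair_less[of n y x] red_pair_less[of n x z]
    red_pair_less[of n z x] red_pair_less[of n y z] red_pair_less[of n z y]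
  consider "x < y" "y < z" | "x < z" "z < y" | "y < x" "x < z" | "y < z" "z < x" | "z < x" "x < y" | "z < y" "y < x"
    | "x = y \<or> y = z \<or> x = z" by linarith
  then show ?thesis using assms t l by cases auto
qed

lemma blue_part_eq_0: "blue_part n i = 0 \<longleftrightarrow> i < 3"
  unfolding blue_part_def by auto

lemma card_blue_part: "card {v \<in> {..<n}. blue_part n v = c} \<le> 3"
proof -
  have le: "card {v \<in> {..<n}. blue_part n v = c} \<le> 3" if "{v \<in> {..<n}. blue_part n v = c} \<subseteq> set xs" "length xs \<le> 3" for xs
    using card_mono[OF _ that(1)] card_length[of xs] that(2) by simp
  consider "c = 0" | "c = 1" "even n" | "c \<ge> 2" "even n" | "c \<ge> 1" "odd n" by linarith
  then show ?thesis
  proof cases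
    case 1
    show ?thesis by (rule le[of "[0, 1, 2]"]) (use 1 blue_part_eq_0 in auto)
  next
    case 2
    show ?thesis by (rule le[of "[3, 4, 5]"]) (use 2 in \<open>auto simp: blue_part_def split: if_splits\<close>)
  next
    case 3
    show ?thesis by (rule le[of "[2 * c, 2 * c + 1]"]) (use 3 in \<open>auto simp: blue_part_def split: if_splits\<close>)
  next
    case 4
    show ?thesis by (rule le[of "[2 * c - 1, 2 * c]"]) (use 4 in \<open>auto simp: blue_part_def split: if_splits\<close>)
  qed
qed

lemma good_blue_part: "good_labelling {..<n} (extremal_adj n) (blue_part n)"
  unfolding good_labelling_def
proof (intro conjI allI impI)
  fix x y z assume "extremal_adj n x y" "extremal_adj n y z" "extremal_adj n x z"
  then show "blue_part n x = blue_part n y \<or> blue_part n y = blue_part n z \<or> blue_part n x = blue_part n z"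
    using red_triangle_free[of n x y z] unfolding extremal_adj_def by auto
qed (rule card_blue_part)

text \<open>The witness is a common red neighbour in the pentagon: \<open>n - 1\<close> for
  \<open>0\<close> and \<open>3\<close>, \<open>3\<close> for \<open>1\<close> or \<open>2\<close>
  with the last class, \<open>1\<close> for \<open>3\<close> with the class of \<open>4\<close>, and
  \<open>0\<close> for two vertices from \<open>4\<close> on.\<close>

lemma third_part_less:
  assumes n: "18 \<le> n" and uv: "u < v" "v < n" and no: "\<not> extremal_adj n u v"
  shows "blue_part n u \<noteq> blue_part n v \<and>
    (\<exists>z. extremal_adj n u z \<and> extremal_adj n v z \<and> blue_part n z \<noteq> blue_part n u \<and> blue_part n z \<noteq> blue_part n v)"
proof -
  have d: "blue_part n u \<noteq> blue_part n v" "\<not> red_pair n u v"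
    using no uv unfolding extremal_adj_def by auto
  have v3: "u < 3 \<Longrightarrow> 3 \<le> v" using d(1) blue_part_eq_0[of n u] blue_part_eq_0[of n v] by fastforce
  have z: ?thesis if "extremal_adj n u z" "extremal_adj n v z" "blue_part n z \<noteq> blue_part n u"
    "blue_part n z \<noteq> blue_part n v" for z
    using that d(1) by blast
  consider "u = 0" | "u = 1 \<or> u = 2" | "u = 3" | "4 \<le> u" by linarith
  then show ?thesis
  proof cases
    case 1
    then have v: "v = 3" using v3 d(2) unfolding red_pair_def by auto
    show ?thesis
      by (rule z[of "n - 1"]) (use n in \<open>auto simp: 1 v extremal_adj_def red_pair_def blue_part_def\<close>)
  next
    case 2
    then have v: "(if even n then 7 else 8) \<le> v" using v3 d(2) unfolding red_pair_def by auto
    show ?thesis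
      by (rule z[of 3])
        (use 2 v n uv in \<open>auto simp: extremal_adj_def red_pair_def blue_part_def split: if_splits\<close>)
  next
    case 3
    then have v: "v < (if even n then 7 else 8)" using d(2) unfolding red_pair_def by auto
    show ?thesis
      by (rule z[of 1])
        (use 3 v n uv in \<open>auto simp: extremal_adj_def red_pair_def blue_part_def split: if_splits\<close>)
  next
    case 4
    show ?thesis
      by (rule z[of 0])
        (use 4 n uv in \<open>auto simp: extremal_adj_def red_pair_def blue_part_def split: if_splits\<close>)
  qed
qed

lemma third_part:
  assumes "18 \<le> n" "u \<noteq> v" "u < n" "v < n" "\<not> extremal_adj n u v"
  shows "blue_part n u \<noteq> blue_part n v \<and>
    (\<exists>z. extremal_adj n u z \<and> extremal_adj n v z \<and> blue_part n z \<noteq> blue_part n u \<and> blue_part n z \<noteq> blue_part n v)"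
proof (cases "u < v")
  case True
  then show ?thesis using third_part_less assms by blast
next
  case False
  then have "v < u" "\<not> extremal_adj n v u" using assms(2,5) extremal_adj_sym by auto
  then show ?thesis using third_part_less[of n v u] assms(1,3) by metis
qed

section \<open>Uniqueness of the splitting into parts\<close>

context
  fixes n :: nat and l :: "nat \<Rightarrow> nat"
  assumes n: "18 \<le> n" and good: "good_labelling {..<n} (extremal_adj n) l"
begin

lemma triangle: "extremal_adj n x y \<Longrightarrow> extremal_adj n y z \<Longrightarrow> extremal_adj n x z \<Longrightarrow> l x = l y \<or> l y = l z \<or> l x = l z"
  using good unfolding good_labelling_def by blast

lemma class_le: "card {v \<in> {..<n}. l v = c} \<le> 3"
  using good unfolding good_labelling_def by blast

lemma not_four:
  assumes "distinct [w, x, y, z]" "w < n" "x < n" "y < n" "z < n" "l w = l x" "l x = l y"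
  shows "l y \<noteq> l z"
proof
  assume "l y = l z"
  then have "{w, x, y, z} \<subseteq> {v \<in> {..<n}. l v = l w}" using assms by auto
  then have "card {w, x, y, z} \<le> card {v \<in> {..<n}. l v = l w}" by (intro card_mono) auto
  then show False using class_le[of "l w"] assms(1) by auto
qed

lemma not_seven:
  assumes "distinct xs" "length xs = 7" "\<And>x. x \<in> set xs \<Longrightarrow> x < n \<and> (l x = A \<or> l x = B)"
  shows False
proof -
  have "set xs \<subseteq> {v \<in> {..<n}. l v = A} \<union> {v \<in> {..<n}. l v = B}" using assms(3) by auto
  then have "card (set xs) \<le> card ({v \<in> {..<n}. l v = A} \<union> {v \<in> {..<n}. l v = B})" by (intro card_mono) auto
  also have "\<dots> \<le> 3 + 3" using card_Un_le class_le add_mono le_trans by meson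
  finally show False using distinct_card[OF assms(1)] assms(2) by simp
qed

lemma adj_low: "i < 3 \<Longrightarrow> j < 3 \<Longrightarrow> i \<noteq> j \<Longrightarrow> extremal_adj n i j"
  using n unfolding extremal_adj_def blue_part_def by auto

lemma adj_Y: "i < 3 \<Longrightarrow> 4 \<le> y \<Longrightarrow> y < 7 \<or> odd n \<and> y = 7 \<Longrightarrow> extremal_adj n i y"
  using n unfolding extremal_adj_def red_pair_def by auto

lemma adj_0: "4 \<le> y \<Longrightarrow> y < n \<Longrightarrow> extremal_adj n 0 y"
  using n unfolding extremal_adj_def red_pair_def by auto

lemma adj_3: "i = 1 \<or> i = 2 \<Longrightarrow> extremal_adj n i 3"
  using n unfolding extremal_adj_def red_pair_def by auto

lemma adj_same_part: "i < n \<Longrightarrow> j < n \<Longrightarrow> i \<noteq> j \<Longrightarrow> blue_part n i = blue_part n j \<Longrightarrow> extremal_adj n i j"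
  unfolding extremal_adj_def by auto

text \<open>Unless it is one of them, \<open>x\<close> forms a triangle with \<open>i\<close> and
  \<open>k\<close>, so only their two labels remain for it.\<close>

lemma two_labels:
  assumes "i < 3" "k < 3" "l i \<noteq> l k" "x < 3 \<or> 4 \<le> x \<and> (x < 7 \<or> odd n \<and> x = 7)"
  shows "x < n \<and> (l x = l i \<or> l x = l k)"
proof (cases "x = i \<or> x = k")
  case False
  then have "extremal_adj n i x" "extremal_adj n k x" using adj_low[of _ x] adj_Y[of _ x] assms by auto
  moreover have "extremal_adj n i k" using adj_low assms by blast
  ultimately show ?thesis using triangle[of i k x] assms(3) unfolding extremal_adj_def by auto
qed (use assms n in auto)

text \<open>If \<open>0\<close>, \<open>1\<close>, \<open>2\<close> did not share a label, their two labels would be forced on seven vertices,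
  but a label occurs at most three times.\<close>

lemma label_012: "l 1 = l 0" "l 2 = l 0"
proof -
  have odd: False if "odd n" "i < 3" "k < 3" "l i \<noteq> l k" for i k
  proof (rule not_seven[of "[0, 1, 2, 4, 5, 6, 7]" "l i" "l k"])
    fix x :: nat assume "x \<in> set [0, 1, 2, 4, 5, 6, 7]"
    then have "x < 3 \<or> 4 \<le> x \<and> (x < 7 \<or> odd n \<and> x = 7)" using that(1) by auto
    then show "x < n \<and> (l x = l i \<or> l x = l k)" by (rule two_labels[OF that(2-4)])
  qed auto
  \<comment> \<open>For even \<open>n\<close> the two labels are forced on only six vertices;
    \<open>y\<close> is the seventh that completes the contradiction.\<close>
  have even: False if "even n" "i < 3" "k < 3" "l i \<noteq> l k" "l y = l i \<or> l y = l k" "y = 3 \<or> y = 7" for i k y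
  proof (rule not_seven[of "[0, 1, 2, 4, 5, 6, y]" "l i" "l k"])
    fix x :: nat assume "x \<in> set [0, 1, 2, 4, 5, 6, y]"
    then consider "x = y" | "x < 3 \<or> 4 \<le> x \<and> (x < 7 \<or> odd n \<and> x = 7)" by fastforce
    then show "x < n \<and> (l x = l i \<or> l x = l k)"
    proof cases
      case 1
      then show ?thesis using that(5,6) n by auto
    qed (rule two_labels[OF that(2-4)])
  qed (use that(6) in auto)
  have 12: "l 1 = l 2"
  proof (rule ccontr)
    assume d: "l 1 \<noteq> l 2"
    then have "even n" using odd[of 1 2] by auto
    moreover have "l 3 = l 1 \<or> l 3 = l 2"
      using triangle[of 1 2 3] adj_low[of 1 2] adj_3 d by auto
    ultimately show False using even[of 1 2 3] d by auto
  qed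
  moreover have "l 0 = l 1"
  proof (rule ccontr)
    assume d: "l 0 \<noteq> l 1"
    then have e: "even n" using odd[of 0 1] by auto
    \<comment> \<open>Now \<open>3\<close> and \<open>7\<close> avoid both labels. The triangle
      \<open>0, 6, 7\<close> gives \<open>6\<close> the label of \<open>0\<close>, the triangle
      \<open>3, 4, 5\<close> makes \<open>4\<close> and \<open>5\<close> agree, and so
      \<open>0, 4, 5, 6\<close> or \<open>1, 2, 4, 5\<close> share a label.\<close>
    have n3: "l 3 \<noteq> l 0" "l 3 \<noteq> l 1" "l 7 \<noteq> l 0" "l 7 \<noteq> l 1"
      using even[OF e _ _ d, of 3] even[OF e _ _ d, of 7] by auto
    note two = two_labels[OF _ _ d]
    have "extremal_adj n 6 7" "extremal_adj n 4 5" "extremal_adj n 5 3" "extremal_adj n 4 3"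
      using e n by (auto intro!: adj_same_part simp: blue_part_def)
    note adj = this
    have in_two: "l 4 = l 0 \<or> l 4 = l 1" "l 5 = l 0 \<or> l 5 = l 1" "l 6 = l 0 \<or> l 6 = l 1"
      using two[of 4] two[of 5] two[of 6] by simp_all
    have "l 0 = l 6 \<or> l 6 = l 7 \<or> l 0 = l 7"
      by (rule triangle) (use adj(1) adj_0[of 6] adj_0[of 7] n in simp_all)
    then have l6: "l 6 = l 0" using in_two(3) n3 by metis
    have "l 4 = l 5 \<or> l 5 = l 3 \<or> l 4 = l 3" by (rule triangle[OF adj(2,3,4)])
    then have "l 4 = l 5" using in_two(1,2) n3 by metis
    moreover have "l 0 = l 4 \<Longrightarrow> l 4 \<noteq> l 5"
      by (rule not_four[of 6 0 4 5]) (use n l6 in simp_all)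
    moreover have "l 2 = l 4 \<Longrightarrow> l 4 \<noteq> l 5"
      by (rule not_four[of 1 2 4 5]) (use n 12 in simp_all)
    ultimately show False using in_two(1) 12 by metis
  qed
  ultimately show "l 1 = l 0" "l 2 = l 0" by simp_all
qed

lemma label_neq_0:
  assumes "3 \<le> x" "x < n"
  shows "l x \<noteq> l 0"
proof -
  have "l 0 \<noteq> l x" by (rule not_four[of 1 2 0 x]) (use label_012 assms n in simp_all)
  then show ?thesis by simp
qed

lemma label_same_part:
  assumes "i < n" "j < n" "blue_part n i = blue_part n j"
  shows "l i = l j"
proof (cases "i = j \<or> i < 3")
  case True
  then consider "i = j" | "i < 3" "j < 3" using assms(3) blue_part_eq_0 by metis
  then show ?thesis
  proof cases
    case 2
    then have "i = 0 \<or> i = 1 \<or> i = 2" "j = 0 \<or> j = 1 \<or> j = 2" by auto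
    then show ?thesis using label_012 by auto
  qed simp
next
  case False
  then have ge: "3 \<le> i" "3 \<le> j" "i \<noteq> j" using assms(3) blue_part_eq_0 by (metis not_less)+
  have ij: "extremal_adj n i j" using adj_same_part assms ge by blast
  obtain h where h: "h < 3" "extremal_adj n h i" "extremal_adj n h j"
  proof (cases "i = 3 \<or> j = 3")
    case True
    then have "(i = 3 \<or> i = 4 \<or> i = 5) \<and> (j = 3 \<or> j = 4 \<or> j = 5)"
      using assms(3) ge by (auto simp: blue_part_def split: if_splits)
    then show ?thesis using that[of 1] adj_3[of 1] adj_Y[of 1 4] adj_Y[of 1 5] by auto
  next
    case False
    then show ?thesis using that[of 0] adj_0[of i] adj_0[of j] ge assms by auto
  qed
  have "h = 0 \<or> h = 1 \<or> h = 2" using h(1) by linarith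
  then have "l h = l 0" using label_012 by blast
  then show ?thesis using triangle[OF h(2) ij h(3)] label_neq_0[of i] label_neq_0[of j] ge assms by auto
qed

lemma part_mate:
  assumes "3 \<le> i" "i < n"
  shows "\<exists>j. 3 \<le> j \<and> j < n \<and> j \<noteq> i \<and> blue_part n j = blue_part n i"
proof -
  consider "even n" "i < 5" | "even n" "i = 5" | "even n" "6 \<le> i" "even i" | "even n" "6 \<le> i" "odd i"
    | "odd n" "odd i" | "odd n" "even i" by linarith
  then show ?thesis
  proof cases
    case 1
    then have "i = 3 \<or> i = 4" using assms by auto
    then show ?thesis using 1 n by (intro exI[of _ 5]) (auto simp: blue_part_def)
  next
    case 2
    then show ?thesis using n by (intro exI[of _ 3]) (auto simp: blue_part_def)
  next
    case 3
    then have "i + 1 < n" using assms by (metis Suc_eq_plus1 Suc_lessI even_Suc)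
    then show ?thesis using 3 by (intro exI[of _ "i + 1"]) (auto simp: blue_part_def)
  next
    case 4
    then show ?thesis using assms by (intro exI[of _ "i - 1"]) (auto simp: blue_part_def elim!: oddE)
  next
    case 5
    then have "i + 1 < n" using assms by (metis Suc_eq_plus1 Suc_lessI even_Suc)
    then show ?thesis using 5 assms by (intro exI[of _ "i + 1"]) (auto simp: blue_part_def elim!: oddE)
  next
    case 6
    then have "4 \<le> i" using assms(1) by (cases "i = 3") auto
    then show ?thesis using 6 assms by (intro exI[of _ "i - 1"]) (auto simp: blue_part_def elim!: evenE)
  qed
qed

text \<open>Outside \<open>{0, 1, 2}\<close> every part has at least two vertices by
  \<open>part_mate\<close>, so two such parts with the same label would give it four
  vertices.\<close>

lemma label_other_part:
  assumes "i < n" "j < n" "blue_part n i \<noteq> blue_part n j"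
  shows "l i \<noteq> l j"
proof (cases "i < 3 \<or> j < 3")
  case True
  have low: "l x \<noteq> l y" if "x < 3" "y < n" "blue_part n x \<noteq> blue_part n y" for x y
  proof -
    have "3 \<le> y" using that blue_part_eq_0 by (metis not_less)
    moreover have "l x = l 0" using label_same_part[of x 0] that(1) n blue_part_eq_0[of n x] blue_part_eq_0[of n 0] by simp
    ultimately show ?thesis using label_neq_0 that(2) by metis
  qed
  show ?thesis using True low[of i j] low[of j i] assms by metis
next
  case False
  then obtain i' j' where m: "i' < n" "i' \<noteq> i" "blue_part n i' = blue_part n i"
    "j' < n" "j' \<noteq> j" "blue_part n j' = blue_part n j"
    using part_mate[of i] part_mate[of j] assms by auto
  then have "distinct [i', i, j, j']" using assms by auto
  then show ?thesis
    using not_four[of i' i j j'] label_same_part[of i' i] label_same_part[of j j'] m assms by auto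
qed

end

text \<open>A good labelling of the enlarged graph is also good for the original one, so it has the
  parts of \<open>blue_part\<close>; then the new edge and the vertex from \<open>third_part\<close>
  form a triangle with three labels.\<close>

theorem saturated_extremal_graph:
  assumes n: "18 \<le> n"
  shows "saturated (R_min {complete_graph 3} (trees 4)) (extremal_graph n)"
  unfolding saturated_iff_good_labelling
proof (intro conjI ballI notI)
  show "simple_graph (extremal_graph n)" by (rule simple_extremal_graph)
  have "adj (extremal_graph n) = extremal_adj n" by (intro ext) simp
  then show "\<exists>l. good_labelling (verts (extremal_graph n)) (adj (extremal_graph n)) l"
    using good_blue_part[of n] by auto
  fix e assume "e \<in> complement_edges (extremal_graph n)"
  then have e: "e \<subseteq> {..<n}" "card e = 2" "e \<notin> edges (extremal_graph n)" unfolding complement_edges_def by auto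
  then obtain u v where uv: "e = {u, v}" "u \<noteq> v" unfolding card_2_iff by blast
  then have V: "u < n" "v < n" "\<not> extremal_adj n u v" using e adj_extremal_graph[of n u v] by auto
  assume "\<exists>l. good_labelling (verts (extremal_graph n)) (adj (add_edge (extremal_graph n) e)) l"
  then obtain l where l: "good_labelling {..<n} (adj (add_edge (extremal_graph n) e)) l" by auto
  have sub: "adj (add_edge (extremal_graph n) e) x y" if "extremal_adj n x y" for x y
    using that adj_extremal_graph[of n x y] unfolding add_edge_def by simp
  have new: "adj (add_edge (extremal_graph n) e) u v" unfolding add_edge_def uv by simp
  have good: "good_labelling {..<n} (extremal_adj n) l"
    using l sub unfolding good_labelling_def by meson
  obtain z where z: "extremal_adj n u z" "extremal_adj n v z" "blue_part n u \<noteq> blue_part n v"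
    "blue_part n z \<noteq> blue_part n u" "blue_part n z \<noteq> blue_part n v"
    using third_part[OF n uv(2) V] by blast
  have "z < n" using z(1) unfolding extremal_adj_def by simp
  then have "l u \<noteq> l v" "l z \<noteq> l u" "l z \<noteq> l v"
    using label_other_part[OF n good] V z by blast+
  moreover have "l u = l v \<or> l v = l z \<or> l u = l z"
    using l new sub[OF z(2)] sub[OF z(1)] unfolding good_labelling_def by blast
  ultimately show False by metis
qed

text \<open>Each edge is counted at its larger end. After the initial table the blue pairs repeat
  with lengths \<open>2\<close> and \<open>3\<close>, that is five edges for every two
  vertices.\<close>

definition down_nbs :: "nat \<Rightarrow> nat \<Rightarrow> nat list" where
  "down_nbs n v = (if even n then
     (if v < 8 then [[], [0], [0, 1], [1, 2], [0, 1, 2, 3], [0, 1, 2, 3, 4], [0, 1, 2], [0, 3, 6]] ! v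
      else if even v then [0, 3] else [0, 3, v - 1])
   else (if v < 9 then [[], [0], [0, 1], [1, 2], [0, 1, 2, 3], [0, 1, 2], [0, 1, 2, 5], [0, 1, 2], [0, 3, 7]] ! v
      else if odd v then [0, 3] else [0, 3, v - 1]))"

lemma less_8: "v < 8 \<Longrightarrow> v = 0 \<or> v = 1 \<or> v = 2 \<or> v = 3 \<or> v = 4 \<or> v = 5 \<or> v = 6 \<or> v = (7::nat)"
  by linarith

lemma extremal_adj_down:
  assumes "extremal_adj n u v" "u < v"
  shows "u \<in> set (down_nbs n v)"
proof -
  have "blue_part n u = blue_part n v \<or> red_pair n u v"
    using assms red_pair_less[of n v u] unfolding extremal_adj_def by auto
  then show ?thesis
  proof
    assume b: "blue_part n u = blue_part n v"
    consider "v < 8" | "v = 8" | "9 \<le> v" by linarith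
    then show ?thesis
    proof cases
      case 1
      then show ?thesis using b assms(2) less_8[OF 1] less_8[of u]
        by (auto simp: down_nbs_def blue_part_def split: if_splits)
    next
      case 2
      then show ?thesis using b assms(2) less_8[of u]
        by (auto simp: down_nbs_def blue_part_def split: if_splits)
    next
      case 3
      then have "u = v - 1 \<and> (even n \<longleftrightarrow> odd v)" using b assms(2)
        by (auto simp: blue_part_def split: if_splits; presburger)
      then show ?thesis using 3 by (auto simp: down_nbs_def)
    qed
  next
    assume "red_pair n u v"
    then show ?thesis using less_8[of v] by (cases "v < 8"; cases "v = 8")
      (auto simp: down_nbs_def red_pair_def split: if_splits)
  qed
qed

text \<open>The table of eight vertices contributes \<open>20\<close>, half of \<open>5 * 8\<close>,
  so the sum is \<open>5 * n / 2\<close>. The odd table of nine contributes \<open>22\<close>, the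
  floor of \<open>45 / 2\<close>.\<close>

lemma sum_down_nbs_even: "even n \<Longrightarrow> (\<Sum>v<8 + 2 * k. length (down_nbs n v)) = 20 + 5 * k"
proof (induction k)
  case 0
  then show ?case by (simp add: down_nbs_def eval_nat_numeral)
next
  case (Suc k)
  have "8 + 2 * Suc k = Suc (Suc (8 + 2 * k))" by simp
  moreover have "length (down_nbs n (8 + 2 * k)) = 2" "length (down_nbs n (Suc (8 + 2 * k))) = 3"
    using Suc.prems by (simp_all add: down_nbs_def)
  moreover note Suc.IH[OF Suc.prems]
  ultimately show ?case by (simp only: sum.lessThan_Suc)
qed

lemma sum_down_nbs_odd: "odd n \<Longrightarrow> (\<Sum>v<9 + 2 * k. length (down_nbs n v)) = 22 + 5 * k"
proof (induction k)
  case 0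
  then show ?case by (simp add: down_nbs_def eval_nat_numeral)
next
  case (Suc k)
  have "9 + 2 * Suc k = Suc (Suc (9 + 2 * k))" by simp
  moreover have "length (down_nbs n (9 + 2 * k)) = 2" "length (down_nbs n (Suc (9 + 2 * k))) = 3"
    using Suc.prems by (simp_all add: down_nbs_def)
  moreover note Suc.IH[OF Suc.prems]
  ultimately show ?case by (simp only: sum.lessThan_Suc)
qed

lemma card_edges_extremal_graph:
  assumes n: "18 \<le> n"
  shows "2 * card (edges (extremal_graph n)) \<le> 5 * n"
proof -
  have "edges (extremal_graph n) \<subseteq> (\<Union>v<n. (\<lambda>u. {u, v}) ` set (down_nbs n v))"
  proof
    fix e assume "e \<in> edges (extremal_graph n)"
    then obtain i j where "e = {i, j}" "extremal_adj n i j" unfolding extremal_graph_def by auto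
    moreover have "i \<noteq> j" using calculation unfolding extremal_adj_def by simp
    ultimately obtain u v where uv: "e = {u, v}" "extremal_adj n u v" "u < v"
      using extremal_adj_sym by (metis insert_commute nat_neq_iff)
    then have "v < n" "u \<in> set (down_nbs n v)" using extremal_adj_down unfolding extremal_adj_def by auto
    then show "e \<in> (\<Union>v<n. (\<lambda>u. {u, v}) ` set (down_nbs n v))" using uv(1) by blast
  qed
  then have "card (edges (extremal_graph n)) \<le> card (\<Union>v<n. (\<lambda>u. {u, v}) ` set (down_nbs n v))"
    by (intro card_mono) auto
  also have "\<dots> \<le> (\<Sum>v<n. card ((\<lambda>u. {u, v}) ` set (down_nbs n v)))" by (rule card_UN_le) simp
  also have "\<dots> \<le> (\<Sum>v<n. length (down_nbs n v))"
    by (intro sum_mono) (meson card_image_le card_length finite_set le_trans)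
  finally have le: "card (edges (extremal_graph n)) \<le> (\<Sum>v<n. length (down_nbs n v))" .
  show ?thesis
  proof (cases "even n")
    case True
    then have "n = 8 + 2 * ((n - 8) div 2)" using n by simp
    then obtain k where k: "n = 8 + 2 * k" by blast
    show ?thesis using le sum_down_nbs_even[OF True, of k] unfolding k[symmetric] using k by linarith
  next
    case False
    then have "n = 9 + 2 * ((n - 9) div 2)" using n by simp
    then obtain k where k: "n = 9 + 2 * k" by blast
    show ?thesis using le sum_down_nbs_odd[OF False, of k] unfolding k[symmetric] using k by linarith
  qed
qed

theorem theorem1p4:
  fixes n :: nat
  assumes "n \<ge> 18"
  shows "int (sat n (R_min {complete_graph 3} (trees 4))) = \<lfloor>5 * real n / 2\<rfloor>"
proof -
  let ?F = "R_min {complete_graph 3} (trees 4)"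
  let ?S = "{card (edges G) | G :: nat graph. saturated ?F G \<and> card (verts G) = n}"
  have ex: "card (edges (extremal_graph n)) \<in> ?S"
    unfolding mem_Collect_eq
    by (intro exI[of _ "extremal_graph n"]) (simp add: saturated_extremal_graph[OF assms])
  \<comment> \<open>The set is nonempty by \<open>ex\<close>, so the infimum is attained and is not
    the default value \<open>0\<close>.\<close>
  have "sat n ?F \<in> ?S"
    unfolding sat_def using ex by (intro Inf_nat_def1) blast
  then obtain G :: "nat graph" where G: "saturated ?F G" "card (verts G) = n" "sat n ?F = card (edges G)"
    by blast
  then have "5 * n \<le> 2 * sat n ?F + 1"
    using saturated_lower_bound[OF G(1)] assms by simp
  moreover have "sat n ?F \<le> card (edges (extremal_graph n))"
    unfolding sat_def using ex by (rule cInf_lower) simp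
  then have "2 * sat n ?F \<le> 5 * n"
    using card_edges_extremal_graph[OF assms] by linarith
  \<comment> \<open>Exactly one of \<open>5 * n - 1\<close> and \<open>5 * n\<close> is even, so the
    two bounds determine the value for either parity of \<open>n\<close>.\<close>
  ultimately have "int (sat n ?F) = (5 * int n) div 2" by presburger
  then show ?thesis
    using floor_divide_of_int_eq[of "5 * int n" 2, where ?'a = real] by simp
qed

end
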